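(* The functor $R\colon\mathbf{Law}\to[\mathbf F,\mathbf{Set}]\text{-}\mathbf{CAT}$ which views a Lawvere theory $\mathbf T$ as an $[\mathbf F,\mathbf{Set}]$-category $R\mathbf T$ fits into a triangle commuting to within pseudonatural equivalence: the (contravariant) functors to $\mathbf{CAT}$ $$\mathbf T\mapsto\mathbf T\text{-}\mathbf{Mod}\qquad\text{and}\qquad\mathbf T\mapsto[\mathbf F,\mathbf{Set}]\text{-}\mathbf{CAT}(R\mathbf T,\mathcal S)$$ on $\mathbf{Law}$ are pseudonaturally equivalent.
   Context: A Lawvere theory is a category $\mathbf T$ with finite products whose objects are the distinct finite powers $X^n$ ($n\in\mathbb N$) of a distinguished object $X$ (the powers $X^n$ with their projections $X^n\to X$ being part of the structure, with $X^1=X$ and identity projection). A morphism of Lawvere theories is a functor strictly preserving finite products and the distinguished object; $\mathbf{Law}$ is the resulting category. A model of $\mathbf T$ is a finite-product-preserving functor $\mathbf T\to\mathbf{Set}$; $\mathbf T\text{-}\mathbf{Mod}$ is the category of models and natural transformations, and a morphism $\mathbf S\to\mathbf T$ of theories induces $\mathbf T\text{-}\mathbf{Mod}\to\mathbf S\text{-}\mathbf{Mod}$ by precomposition. $\mathbf F$ is the full subcategory of $\mathbf{Set}$ on the finite cardinals; $[\mathbf F,\mathbf{Set}]$ is monoidal with unit the inclusion $\mathbf F\to\mathbf{Set}$ and tensor $(A\otimes B)(n)=\int^{m\in\mathbf F}Am\times(Bn)^m$. $[\mathbf F,\mathbf{Set}]\text{-}\mathbf{CAT}$ is the $2$-category of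 (possibly large) categories $\mathcal M$ enriched in $[\mathbf F,\mathbf{Set}]$ (composition $\mathcal M(Y,Z)\otimes\mathcal M(X,Y)\to\mathcal M(X,Z)$), enriched functors and enriched natural transformations; we write $\mathcal M_n(X,Y)$ for $\mathcal M(X,Y)(n)$. Thus composition amounts to operations $\mathcal M_m(Y,Z)\times\mathcal M_n(X,Y)^m\to\mathcal M_n(X,Z)$, $(g,f_1,\dots,f_m)\mapsto g\circ(f_1,\dots,f_m)$. For a category $\mathcal C$ with finite powers, $R\mathcal C$ is the $[\mathbf F,\mathbf{Set}]$-category with the same objects, $R\mathcal C_n(X,Y)=\mathcal C(X^n,Y)$, composition $(g,f_1,\dots,f_m)\mapsto g\circ\langle f_1,\dots,f_m\rangle$, and identities those of $\mathcal C$ (reindexing along maps of $\mathbf F$ being induced by the product projections). For a finite-power-preserving functor $F\colon\mathcal C\to\mathcal D$, $RF$ acts as $F$ on objects and by $\mathcal C(X^n,Y)\to\mathcal D(F(X^n),FY)\cong\mathcal D((FX)^n,FY)$ on homs. $\mathcal S=R(\mathbf{Set})$, so $\mathcal S_n(X,Y)=\mathbf{Set}(X^n,Y)$. *)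

theory Defs
  imports Main "HOL-Library.FuncSet" "HOL-Library.Infinite_Typeclass"
begin

section \<open>Categories, functors, natural transformations\<close>

text \<open>
  Hom-sets are indexed by their endpoints and need not be disjoint, so identities and composition
  carry the objects as arguments: \<open>Cmp C X Y Z g f\<close> is the composite of \<open>f\<close> from \<open>X\<close> to \<open>Y\<close>
  and \<open>g\<close> from \<open>Y\<close> to \<open>Z\<close>.  Functors and transformations are extensional (\<open>undefined\<close> outside
  their domain), so that HOL equality of them is mathematical equality.
\<close>

record ('o, 'a) cat =
  Ob :: "'o set"
  Hom :: "'o \<Rightarrow> 'o \<Rightarrow> 'a set"
  Idn :: "'o \<Rightarrow> 'a"
  Cmp :: "'o \<Rightarrow> 'o \<Rightarrow> 'o \<Rightarrow> 'a \<Rightarrow> 'a \<Rightarrow> 'a"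

definition category :: "('o, 'a, 'z) cat_scheme \<Rightarrow> bool" where
  "category C \<longleftrightarrow>
     (\<forall>X\<in>Ob C. Idn C X \<in> Hom C X X) \<and>
     (\<forall>X\<in>Ob C. \<forall>Y\<in>Ob C. \<forall>Z\<in>Ob C. \<forall>g\<in>Hom C Y Z. \<forall>f\<in>Hom C X Y. Cmp C X Y Z g f \<in> Hom C X Z) \<and>
     (\<forall>X\<in>Ob C. \<forall>Y\<in>Ob C. \<forall>f\<in>Hom C X Y.
        Cmp C X X Y f (Idn C X) = f \<and> Cmp C X Y Y (Idn C Y) f = f) \<and>
     (\<forall>W\<in>Ob C. \<forall>X\<in>Ob C. \<forall>Y\<in>Ob C. \<forall>Z\<in>Ob C.
        \<forall>h\<in>Hom C Y Z. \<forall>g\<in>Hom C X Y. \<forall>f\<in>Hom C W X.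
          Cmp C W Y Z h (Cmp C W X Y g f) = Cmp C W X Z (Cmp C X Y Z h g) f)"

definition opcat :: "('o, 'a) cat \<Rightarrow> ('o, 'a) cat" where
  "opcat C = \<lparr>Ob = Ob C, Hom = (\<lambda>X Y. Hom C Y X), Idn = Idn C,
              Cmp = (\<lambda>X Y Z g f. Cmp C Z Y X f g)\<rparr>"

record ('o, 'a, 'p, 'b) func =
  fob :: "'o \<Rightarrow> 'p"
  far :: "'o \<Rightarrow> 'o \<Rightarrow> 'a \<Rightarrow> 'b"

definition is_functor ::
  "('o, 'a, 'y) cat_scheme \<Rightarrow> ('p, 'b, 'z) cat_scheme \<Rightarrow> ('o, 'a, 'p, 'b) func \<Rightarrow> bool" where
  "is_functor C D F \<longleftrightarrow>
     fob F \<in> Ob C \<rightarrow>\<^sub>E Ob D \<and>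
     far F \<in> (\<Pi>\<^sub>E X\<in>Ob C. \<Pi>\<^sub>E Y\<in>Ob C. Hom C X Y \<rightarrow>\<^sub>E Hom D (fob F X) (fob F Y)) \<and>
     (\<forall>X\<in>Ob C. far F X X (Idn C X) = Idn D (fob F X)) \<and>
     (\<forall>X\<in>Ob C. \<forall>Y\<in>Ob C. \<forall>Z\<in>Ob C. \<forall>g\<in>Hom C Y Z. \<forall>f\<in>Hom C X Y.
        far F X Z (Cmp C X Y Z g f) = Cmp D (fob F X) (fob F Y) (fob F Z) (far F Y Z g) (far F X Y f))"

definition id_func :: "('o, 'a, 'z) cat_scheme \<Rightarrow> ('o, 'a, 'o, 'a) func" where
  "id_func C = \<lparr>fob = (\<lambda>X\<in>Ob C. X), far = (\<lambda>X\<in>Ob C. \<lambda>Y\<in>Ob C. \<lambda>f\<in>Hom C X Y. f)\<rparr>"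

text \<open>\<open>comp_func C G F\<close> is \<open>G \<circ> F\<close> for \<open>F\<close> with domain \<open>C\<close>.\<close>

definition comp_func ::
  "('o, 'a, 'z) cat_scheme \<Rightarrow> ('p, 'b, 'q, 'c) func \<Rightarrow> ('o, 'a, 'p, 'b) func \<Rightarrow> ('o, 'a, 'q, 'c) func" where
  "comp_func C G F =
     \<lparr>fob = (\<lambda>X\<in>Ob C. fob G (fob F X)),
      far = (\<lambda>X\<in>Ob C. \<lambda>Y\<in>Ob C. \<lambda>f\<in>Hom C X Y. far G (fob F X) (fob F Y) (far F X Y f))\<rparr>"

definition op_func :: "('o, 'a, 'p, 'b) func \<Rightarrow> ('o, 'a, 'p, 'b) func" where
  "op_func F = \<lparr>fob = fob F, far = (\<lambda>X Y. far F Y X)\<rparr>"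

definition nat_trans ::
  "('o, 'a, 'y) cat_scheme \<Rightarrow> ('p, 'b, 'z) cat_scheme \<Rightarrow>
   ('o, 'a, 'p, 'b) func \<Rightarrow> ('o, 'a, 'p, 'b) func \<Rightarrow> ('o \<Rightarrow> 'b) set" where
  "nat_trans C D F G =
     {t \<in> (\<Pi>\<^sub>E X\<in>Ob C. Hom D (fob F X) (fob G X)).
        \<forall>X\<in>Ob C. \<forall>Y\<in>Ob C. \<forall>f\<in>Hom C X Y.
          Cmp D (fob F X) (fob F Y) (fob G Y) (t Y) (far F X Y f) =
          Cmp D (fob F X) (fob G X) (fob G Y) (far G X Y f) (t X)}"

definition is_iso :: "('o, 'a, 'z) cat_scheme \<Rightarrow> 'o \<Rightarrow> 'o \<Rightarrow> 'a \<Rightarrow> bool" where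
  "is_iso C X Y f \<longleftrightarrow>
     f \<in> Hom C X Y \<and> (\<exists>g\<in>Hom C Y X. Cmp C X Y X g f = Idn C X \<and> Cmp C Y X Y f g = Idn C Y)"

definition nat_iso ::
  "('o, 'a, 'y) cat_scheme \<Rightarrow> ('p, 'b, 'z) cat_scheme \<Rightarrow>
   ('o, 'a, 'p, 'b) func \<Rightarrow> ('o, 'a, 'p, 'b) func \<Rightarrow> ('o \<Rightarrow> 'b) \<Rightarrow> bool" where
  "nat_iso C D F G t \<longleftrightarrow>
     t \<in> nat_trans C D F G \<and> (\<forall>X\<in>Ob C. is_iso D (fob F X) (fob G X) (t X))"

definition equivalence_functor ::
  "('o, 'a, 'y) cat_scheme \<Rightarrow> ('p, 'b, 'z) cat_scheme \<Rightarrow> ('o, 'a, 'p, 'b) func \<Rightarrow> bool" where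
  "equivalence_functor C D F \<longleftrightarrow>
     is_functor C D F \<and>
     (\<exists>G s t. is_functor D C G \<and>
        nat_iso C C (id_func C) (comp_func C G F) s \<and>
        nat_iso D D (comp_func D F G) (id_func D) t)"

definition CAT :: "(('o, 'a) cat, ('o, 'a, 'o, 'a) func) cat" where
  "CAT = \<lparr>Ob = {C. category C}, Hom = (\<lambda>C D. {F. is_functor C D F}), Idn = id_func,
          Cmp = (\<lambda>C D E G F. comp_func C G F)\<rparr>"


section \<open>Pseudonatural equivalence of CAT-valued functors\<close>

text \<open>
  \<open>B\<close> is an ordinary category, regarded as a 2-category with only identity 2-cells, and \<open>\<Phi>\<close>, \<open>\<Psi>\<close>
  are strict functors from \<open>B\<close> to \<open>CAT\<close>.  The 2-cell attached to \<open>f : X \<rightarrow> Y\<close> is the invertible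
  \<open>\<tau> X Y f : \<Psi> f \<circ> \<sigma> X \<Rightarrow> \<sigma> Y \<circ> \<Phi> f\<close>.  The two functors may take values in categories of different HOL
  types.
\<close>

definition pseudonatural_trans ::
  "('b, 'f) cat \<Rightarrow> ('b, 'f, ('o, 'a) cat, ('o, 'a, 'o, 'a) func) func \<Rightarrow>
   ('b, 'f, ('p, 'c) cat, ('p, 'c, 'p, 'c) func) func \<Rightarrow>
   ('b \<Rightarrow> ('o, 'a, 'p, 'c) func) \<Rightarrow> ('b \<Rightarrow> 'b \<Rightarrow> 'f \<Rightarrow> 'o \<Rightarrow> 'c) \<Rightarrow> bool" where
  "pseudonatural_trans B \<Phi> \<Psi> \<sigma> \<tau> \<longleftrightarrow>
     (\<forall>X\<in>Ob B. is_functor (fob \<Phi> X) (fob \<Psi> X) (\<sigma> X)) \<and>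
     (\<forall>X\<in>Ob B. \<forall>Y\<in>Ob B. \<forall>f\<in>Hom B X Y.
        nat_iso (fob \<Phi> X) (fob \<Psi> Y)
          (comp_func (fob \<Phi> X) (far \<Psi> X Y f) (\<sigma> X)) (comp_func (fob \<Phi> X) (\<sigma> Y) (far \<Phi> X Y f))
          (\<tau> X Y f)) \<and>
     (\<forall>X\<in>Ob B. \<forall>M\<in>Ob (fob \<Phi> X). \<tau> X X (Idn B X) M = Idn (fob \<Psi> X) (fob (\<sigma> X) M)) \<and>
     (\<forall>X\<in>Ob B. \<forall>Y\<in>Ob B. \<forall>Z\<in>Ob B. \<forall>g\<in>Hom B Y Z. \<forall>f\<in>Hom B X Y. \<forall>M\<in>Ob (fob \<Phi> X).
        (let P = fob (far \<Psi> Y Z g) (fob (far \<Psi> X Y f) (fob (\<sigma> X) M));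
             Q = fob (far \<Psi> Y Z g) (fob (\<sigma> Y) (fob (far \<Phi> X Y f) M));
             R = fob (\<sigma> Z) (fob (far \<Phi> Y Z g) (fob (far \<Phi> X Y f) M))
         in \<tau> X Z (Cmp B X Y Z g f) M =
            Cmp (fob \<Psi> Z) P Q R
              (\<tau> Y Z g (fob (far \<Phi> X Y f) M))
              (far (far \<Psi> Y Z g) (fob (far \<Psi> X Y f) (fob (\<sigma> X) M))
                                 (fob (\<sigma> Y) (fob (far \<Phi> X Y f) M)) (\<tau> X Y f M))))"

definition pseudonaturally_equivalent ::
  "('b, 'f) cat \<Rightarrow> ('b, 'f, ('o, 'a) cat, ('o, 'a, 'o, 'a) func) func \<Rightarrow>
   ('b, 'f, ('p, 'c) cat, ('p, 'c, 'p, 'c) func) func \<Rightarrow> bool" where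
  "pseudonaturally_equivalent B \<Phi> \<Psi> \<longleftrightarrow>
     (\<exists>\<sigma> \<tau>. pseudonatural_trans B \<Phi> \<Psi> \<sigma> \<tau> \<and>
        (\<forall>X\<in>Ob B. equivalence_functor (fob \<Phi> X) (fob \<Psi> X) (\<sigma> X)))"


section \<open>Finite products\<close>

definition is_product ::
  "('o, 'a, 'z) cat_scheme \<Rightarrow> nat \<Rightarrow> (nat \<Rightarrow> 'o) \<Rightarrow> 'o \<Rightarrow> (nat \<Rightarrow> 'a) \<Rightarrow> bool" where
  "is_product C n A P p \<longleftrightarrow>
     P \<in> Ob C \<and> (\<forall>i<n. A i \<in> Ob C) \<and> (\<forall>i<n. p i \<in> Hom C P (A i)) \<and>
     (\<forall>W\<in>Ob C. \<forall>f. (\<forall>i<n. f i \<in> Hom C W (A i)) \<longrightarrow>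
        (\<exists>!u. u \<in> Hom C W P \<and> (\<forall>i<n. Cmp C W P (A i) (p i) u = f i)))"

definition has_finite_products :: "('o, 'a, 'z) cat_scheme \<Rightarrow> bool" where
  "has_finite_products C \<longleftrightarrow> (\<forall>n A. (\<forall>i<n. A i \<in> Ob C) \<longrightarrow> (\<exists>P p. is_product C n A P p))"

definition preserves_finite_products ::
  "('o, 'a, 'y) cat_scheme \<Rightarrow> ('p, 'b, 'z) cat_scheme \<Rightarrow> ('o, 'a, 'p, 'b) func \<Rightarrow> bool" where
  "preserves_finite_products C D F \<longleftrightarrow>
     (\<forall>n A P p. is_product C n A P p \<longrightarrow>
        is_product D n (\<lambda>i. fob F (A i)) (fob F P) (\<lambda>i. far F P (A i) (p i)))"

text \<open>The map from \<open>W\<close> into the product cone \<open>(P, p)\<close> of \<open>A 0, \<dots>, A (n - 1)\<close> with components \<open>f i\<close>.\<close>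

definition tuple ::
  "('o, 'a, 'z) cat_scheme \<Rightarrow> nat \<Rightarrow> (nat \<Rightarrow> 'o) \<Rightarrow> 'o \<Rightarrow> (nat \<Rightarrow> 'a) \<Rightarrow> 'o \<Rightarrow> (nat \<Rightarrow> 'a) \<Rightarrow> 'a" where
  "tuple C n A P p W f = (THE u. u \<in> Hom C W P \<and> (\<forall>i<n. Cmp C W P (A i) (p i) u = f i))"

text \<open>A category with chosen finite powers: \<open>Pwr C X n\<close> is the power, \<open>Prj C X n i\<close> its projections.\<close>

record ('o, 'a) pcat = "('o, 'a) cat" +
  Pwr :: "'o \<Rightarrow> nat \<Rightarrow> 'o"
  Prj :: "'o \<Rightarrow> nat \<Rightarrow> nat \<Rightarrow> 'a"

definition finite_powers :: "('o, 'a, 'z) pcat_scheme \<Rightarrow> bool" where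
  "finite_powers C \<longleftrightarrow>
     category C \<and>
     (\<forall>X\<in>Ob C. (\<forall>n. is_product C n (\<lambda>_. X) (Pwr C X n) (Prj C X n)) \<and>
                Pwr C X 1 = X \<and> Prj C X 1 0 = Idn C X)"

definition pow_tuple :: "('o, 'a, 'z) pcat_scheme \<Rightarrow> nat \<Rightarrow> 'o \<Rightarrow> 'o \<Rightarrow> (nat \<Rightarrow> 'a) \<Rightarrow> 'a" where
  "pow_tuple C n Y W f = tuple C n (\<lambda>_. Y) (Pwr C Y n) (Prj C Y n) W f"


section \<open>Sets\<close>

definition SetC :: "('u set, 'u \<Rightarrow> 'u) cat" where
  "SetC = \<lparr>Ob = UNIV, Hom = (\<lambda>X Y. X \<rightarrow>\<^sub>E Y), Idn = (\<lambda>X. \<lambda>x\<in>X. x),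
           Cmp = (\<lambda>X Y Z g f. compose X g f)\<rparr>"

text \<open>
  An arbitrary infinite type \<open>'u\<close> plays the role of the universe: the category of sets consists of all
  subsets of \<open>'u\<close> and all functions between them.  It is closed under finite powers: the elements of \<open>X\<^sup>n\<close> are codes of lists of length \<open>n\<close>, except that \<open>X\<^sup>1\<close> is \<open>X\<close> itself.
\<close>

definition list_code :: "'u::infinite list \<Rightarrow> 'u" where
  "list_code = (SOME e. inj e)"

definition set_power :: "'u::infinite set \<Rightarrow> nat \<Rightarrow> 'u set" where
  "set_power X n = (if n = 1 then X else list_code ` {xs. length xs = n \<and> set xs \<subseteq> X})"

definition SetP :: "('u::infinite set, 'u \<Rightarrow> 'u) pcat" where
  "SetP = \<lparr>Ob = Ob SetC, Hom = Hom SetC, Idn = Idn SetC, Cmp = Cmp SetC,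
           Pwr = set_power,
           Prj = (\<lambda>X n i. \<lambda>v\<in>set_power X n. if n = 1 then v else inv list_code v ! i)\<rparr>"


section \<open>Lawvere theories and their models\<close>

text \<open>\<open>pw T n\<close> is \<open>X\<^sup>n\<close>, \<open>pr T n i\<close> is the projection \<open>X\<^sup>n \<rightarrow> X\<close>, and \<open>X\<close> is \<open>pw T 1\<close>.\<close>

record ('o, 'a) law = "('o, 'a) cat" +
  pw :: "nat \<Rightarrow> 'o"
  pr :: "nat \<Rightarrow> nat \<Rightarrow> 'a"

definition lawvere_theory :: "('o, 'a) law \<Rightarrow> bool" where
  "lawvere_theory T \<longleftrightarrow>
     category T \<and> has_finite_products T \<and> Ob T = range (pw T) \<and> inj (pw T) \<and>
     (\<forall>n. is_product T n (\<lambda>_. pw T 1) (pw T n) (pr T n)) \<and> pr T 1 0 = Idn T (pw T 1)"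

definition law_morphism :: "('o, 'a) law \<Rightarrow> ('p, 'b) law \<Rightarrow> ('o, 'a, 'p, 'b) func \<Rightarrow> bool" where
  "law_morphism S T F \<longleftrightarrow>
     is_functor S T F \<and> (\<forall>n. fob F (pw S n) = pw T n) \<and>
     (\<forall>n. \<forall>i<n. far F (pw S n) (pw S 1) (pr S n i) = pr T n i)"

definition Law :: "(('o, 'a) law, ('o, 'a, 'o, 'a) func) cat" where
  "Law = \<lparr>Ob = {T. lawvere_theory T}, Hom = (\<lambda>S T. {F. law_morphism S T F}), Idn = id_func,
          Cmp = (\<lambda>S T U G F. comp_func S G F)\<rparr>"

text \<open>
  The powers of an arbitrary object \<open>X\<^sup>k\<close> of a theory: \<open>(X\<^sup>k)\<^sup>n\<close> is \<open>X\<^bsup>kn\<^esup>\<close>, with \<open>i\<close>-th projection the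
  \<open>i\<close>-th block of \<open>k\<close> coordinates.  For \<open>k = 1\<close> these are the powers belonging to the theory, and for
  \<open>n = 1\<close> they are trivial.
\<close>

definition law_exponent :: "('o, 'a) law \<Rightarrow> 'o \<Rightarrow> nat" where
  "law_exponent T A = inv (pw T) A"

definition law_powers :: "('o, 'a) law \<Rightarrow> ('o, 'a) pcat" where
  "law_powers T =
     \<lparr>Ob = Ob T, Hom = Hom T, Idn = Idn T, Cmp = Cmp T,
      Pwr = (\<lambda>A n. pw T (law_exponent T A * n)),
      Prj = (\<lambda>A n i. let k = law_exponent T A in
               tuple T k (\<lambda>_. pw T 1) (pw T k) (pr T k) (pw T (k * n)) (\<lambda>j. pr T (k * n) (i * k + j)))\<rparr>"

definition Mod :: "('o, 'a) law \<Rightarrow> (('o, 'a, 'u set, 'u \<Rightarrow> 'u) func, 'o \<Rightarrow> 'u \<Rightarrow> 'u) cat" where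
  "Mod T =
     \<lparr>Ob = {M. is_functor T (SetC :: ('u set, 'u \<Rightarrow> 'u) cat) M \<and> preserves_finite_products T SetC M},
      Hom = (\<lambda>M N. nat_trans T SetC M N),
      Idn = (\<lambda>M. \<lambda>A\<in>Ob T. Idn SetC (fob M A)),
      Cmp = (\<lambda>M N P t s. \<lambda>A\<in>Ob T. Cmp SetC (fob M A) (fob N A) (fob P A) (t A) (s A))\<rparr>"

text \<open>The functor \<open>Mod T \<rightarrow> Mod S\<close> given by precomposition with a morphism \<open>F : S \<rightarrow> T\<close>.\<close>

definition Mod_precomp ::
  "('o, 'a) law \<Rightarrow> ('o, 'a) law \<Rightarrow> ('o, 'a, 'o, 'a) func \<Rightarrow>
   (('o, 'a, 'u set, 'u \<Rightarrow> 'u) func, 'o \<Rightarrow> 'u \<Rightarrow> 'u,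
    ('o, 'a, 'u set, 'u \<Rightarrow> 'u) func, 'o \<Rightarrow> 'u \<Rightarrow> 'u) func" where
  "Mod_precomp S T F =
     \<lparr>fob = (\<lambda>M\<in>Ob (Mod T). comp_func S M F),
      far = (\<lambda>M\<in>Ob (Mod T). \<lambda>N\<in>Ob (Mod T). \<lambda>t\<in>Hom (Mod T) M N. \<lambda>A\<in>Ob S. t (fob F A))\<rparr>"

definition Mod_functor ::
  "(('o, 'a) law, ('o, 'a, 'o, 'a) func,
    (('o, 'a, 'u set, 'u \<Rightarrow> 'u) func, 'o \<Rightarrow> 'u \<Rightarrow> 'u) cat,
    (('o, 'a, 'u set, 'u \<Rightarrow> 'u) func, 'o \<Rightarrow> 'u \<Rightarrow> 'u,
     ('o, 'a, 'u set, 'u \<Rightarrow> 'u) func, 'o \<Rightarrow> 'u \<Rightarrow> 'u) func) func" where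
  "Mod_functor =
     \<lparr>fob = (\<lambda>T\<in>Ob Law. Mod T),
      far = (\<lambda>T\<in>Ob Law. \<lambda>S\<in>Ob Law. \<lambda>F\<in>Hom Law S T. Mod_precomp S T F)\<rparr>"


section \<open>The monoidal category of functors from finite cardinals to sets\<close>

definition Fcat :: "(nat, nat \<Rightarrow> nat) cat" where
  "Fcat = \<lparr>Ob = UNIV, Hom = (\<lambda>m n. {..<m} \<rightarrow>\<^sub>E {..<n}), Idn = (\<lambda>n. \<lambda>i\<in>{..<n}. i),
           Cmp = (\<lambda>l m n t s. compose {..<l} t s)\<rparr>"

type_synonym 'a fset_obj = "(nat, nat \<Rightarrow> nat, 'a set, 'a \<Rightarrow> 'a) func"

text \<open>
  An object of \<open>[\<^bold>F, \<^bold>S\<^bold>e\<^bold>t]\<close> is a functor \<open>A\<close> with \<open>is_functor Fcat SetC A\<close>.  Its elements live in an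
  arbitrary type, and morphisms are allowed to go between objects with different types of elements
  (\<open>nat_trans Fcat SetC\<close> would force the two types to be the same).
\<close>

definition FS_hom :: "'a fset_obj \<Rightarrow> 'b fset_obj \<Rightarrow> (nat \<Rightarrow> 'a \<Rightarrow> 'b) set" where
  "FS_hom A B =
     {t. (\<forall>n. t n \<in> fob A n \<rightarrow>\<^sub>E fob B n) \<and>
         (\<forall>m n. \<forall>s\<in>Hom Fcat m n. \<forall>x\<in>fob A m. t n (far A m n s x) = far B m n s (t m x))}"

definition FS_unit :: "nat fset_obj" where
  "FS_unit = \<lparr>fob = (\<lambda>n. {..<n}), far = (\<lambda>m n. \<lambda>s\<in>Hom Fcat m n. s)\<rparr>"

text \<open>
  The coend: \<open>(A \<otimes> B) n\<close> is the quotient of the set of triples \<open>(m, a, b)\<close> with \<open>a \<in> A m\<close> and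
  \<open>b \<in> (B n)\<^sup>m\<close>, a function on \<open>{..<m}\<close>, by the equivalence relation generated by
  \<open>(m', A s a, b) \<sim> (m, a, b \<circ> s)\<close> for \<open>s : m \<rightarrow> m'\<close>.
\<close>

definition coend_points :: "'a fset_obj \<Rightarrow> 'b fset_obj \<Rightarrow> nat \<Rightarrow> (nat \<times> 'a \<times> (nat \<Rightarrow> 'b)) set" where
  "coend_points A B n = {(m, a, b). a \<in> fob A m \<and> b \<in> {..<m} \<rightarrow>\<^sub>E fob B n}"

definition coend_step ::
  "'a fset_obj \<Rightarrow> 'b fset_obj \<Rightarrow> nat \<Rightarrow> ((nat \<times> 'a \<times> (nat \<Rightarrow> 'b)) \<times> (nat \<times> 'a \<times> (nat \<Rightarrow> 'b))) set" where
  "coend_step A B n =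
     {((m', far A m m' s a, b), (m, a, compose {..<m} b s)) | m m' s a b.
        s \<in> Hom Fcat m m' \<and> a \<in> fob A m \<and> b \<in> {..<m'} \<rightarrow>\<^sub>E fob B n}"

definition coend_class ::
  "'a fset_obj \<Rightarrow> 'b fset_obj \<Rightarrow> nat \<Rightarrow> nat \<times> 'a \<times> (nat \<Rightarrow> 'b) \<Rightarrow> (nat \<times> 'a \<times> (nat \<Rightarrow> 'b)) set" where
  "coend_class A B n x = ((coend_step A B n \<union> (coend_step A B n)\<inverse>)\<^sup>*) `` {x}"

definition coend :: "'a fset_obj \<Rightarrow> 'b fset_obj \<Rightarrow> nat \<Rightarrow> (nat \<times> 'a \<times> (nat \<Rightarrow> 'b)) set set" where
  "coend A B n = coend_class A B n ` coend_points A B n"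

text \<open>The map on \<open>(A \<otimes> B) n\<close> induced by a map \<open>f\<close> on triples that is constant on equivalence classes.\<close>

definition coend_lift ::
  "'a fset_obj \<Rightarrow> 'b fset_obj \<Rightarrow> nat \<Rightarrow> (nat \<Rightarrow> 'a \<Rightarrow> (nat \<Rightarrow> 'b) \<Rightarrow> 'c) \<Rightarrow>
   (nat \<times> 'a \<times> (nat \<Rightarrow> 'b)) set \<Rightarrow> 'c" where
  "coend_lift A B n f = (\<lambda>c\<in>coend A B n. the_elem ((\<lambda>(m, a, b). f m a b) ` c))"

definition FS_tensor ::
  "'a fset_obj \<Rightarrow> 'b fset_obj \<Rightarrow> (nat \<times> 'a \<times> (nat \<Rightarrow> 'b)) set fset_obj" where
  "FS_tensor A B =
     \<lparr>fob = coend A B,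
      far = (\<lambda>n n'. \<lambda>s\<in>Hom Fcat n n'.
               coend_lift A B n (\<lambda>m a b. coend_class A B n' (m, a, compose {..<m} (far B n n' s) b)))\<rparr>"

definition FS_tensor_map ::
  "'a fset_obj \<Rightarrow> 'b fset_obj \<Rightarrow> 'c fset_obj \<Rightarrow> 'd fset_obj \<Rightarrow>
   (nat \<Rightarrow> 'a \<Rightarrow> 'c) \<Rightarrow> (nat \<Rightarrow> 'b \<Rightarrow> 'd) \<Rightarrow>
   nat \<Rightarrow> (nat \<times> 'a \<times> (nat \<Rightarrow> 'b)) set \<Rightarrow> (nat \<times> 'c \<times> (nat \<Rightarrow> 'd)) set" where
  "FS_tensor_map A B A' B' t u =
     (\<lambda>n. coend_lift A B n (\<lambda>m a b. coend_class A' B' n (m, t m a, compose {..<m} (u n) b)))"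

definition FS_id :: "'a fset_obj \<Rightarrow> nat \<Rightarrow> 'a \<Rightarrow> 'a" where
  "FS_id A = (\<lambda>n. \<lambda>x\<in>fob A n. x)"

text \<open>The associativity constraint \<open>(A \<otimes> B) \<otimes> C \<rightarrow> A \<otimes> (B \<otimes> C)\<close>.\<close>

definition FS_assoc ::
  "'a fset_obj \<Rightarrow> 'b fset_obj \<Rightarrow> 'c fset_obj \<Rightarrow> nat \<Rightarrow>
   (nat \<times> (nat \<times> 'a \<times> (nat \<Rightarrow> 'b)) set \<times> (nat \<Rightarrow> 'c)) set \<Rightarrow>
   (nat \<times> 'a \<times> (nat \<Rightarrow> (nat \<times> 'b \<times> (nat \<Rightarrow> 'c)) set)) set" where
  "FS_assoc A B C =
     (\<lambda>n. coend_lift (FS_tensor A B) C n (\<lambda>m x c.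
        coend_lift A B m (\<lambda>k a b.
          coend_class A (FS_tensor B C) n (k, a, \<lambda>i\<in>{..<k}. coend_class B C n (m, b i, c))) x))"

text \<open>The unit constraints \<open>I \<otimes> A \<rightarrow> A\<close> and \<open>A \<otimes> I \<rightarrow> A\<close>, followed by their inverses.\<close>

definition FS_lunit :: "'a fset_obj \<Rightarrow> nat \<Rightarrow> (nat \<times> nat \<times> (nat \<Rightarrow> 'a)) set \<Rightarrow> 'a" where
  "FS_lunit A = (\<lambda>n. coend_lift FS_unit A n (\<lambda>m i b. b i))"

definition FS_runit :: "'a fset_obj \<Rightarrow> nat \<Rightarrow> (nat \<times> 'a \<times> (nat \<Rightarrow> nat)) set \<Rightarrow> 'a" where
  "FS_runit A = (\<lambda>n. coend_lift A FS_unit n (\<lambda>m a s. far A m n s a))"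

definition FS_lunit_inv :: "'a fset_obj \<Rightarrow> nat \<Rightarrow> 'a \<Rightarrow> (nat \<times> nat \<times> (nat \<Rightarrow> 'a)) set" where
  "FS_lunit_inv A = (\<lambda>n. \<lambda>x\<in>fob A n. coend_class FS_unit A n (1, 0, \<lambda>i\<in>{..<1}. x))"

definition FS_runit_inv :: "'a fset_obj \<Rightarrow> nat \<Rightarrow> 'a \<Rightarrow> (nat \<times> 'a \<times> (nat \<Rightarrow> nat)) set" where
  "FS_runit_inv A = (\<lambda>n. \<lambda>x\<in>fob A n. coend_class A FS_unit n (n, x, \<lambda>i\<in>{..<n}. i))"


section \<open>Categories enriched in \<open>[\<^bold>F, \<^bold>S\<^bold>e\<^bold>t]\<close>\<close>

text \<open>
  \<open>EComp M X Y Z\<close> is the composition \<open>M(Y, Z) \<otimes> M(X, Y) \<rightarrow> M(X, Z)\<close> and \<open>EId M X\<close> the unit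
  \<open>I \<rightarrow> M(X, X)\<close>.
\<close>

record ('o, 'a) ecat =
  EOb :: "'o set"
  EHom :: "'o \<Rightarrow> 'o \<Rightarrow> 'a fset_obj"
  EId :: "'o \<Rightarrow> nat \<Rightarrow> nat \<Rightarrow> 'a"
  EComp :: "'o \<Rightarrow> 'o \<Rightarrow> 'o \<Rightarrow> nat \<Rightarrow> (nat \<times> 'a \<times> (nat \<Rightarrow> 'a)) set \<Rightarrow> 'a"

definition enriched_category :: "('o, 'a) ecat \<Rightarrow> bool" where
  "enriched_category M \<longleftrightarrow>
     (\<forall>X\<in>EOb M. \<forall>Y\<in>EOb M. is_functor Fcat SetC (EHom M X Y)) \<and>
     (\<forall>X\<in>EOb M. EId M X \<in> FS_hom FS_unit (EHom M X X)) \<and>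
     (\<forall>X\<in>EOb M. \<forall>Y\<in>EOb M. \<forall>Z\<in>EOb M.
        EComp M X Y Z \<in> FS_hom (FS_tensor (EHom M Y Z) (EHom M X Y)) (EHom M X Z)) \<and>
     (\<forall>W\<in>EOb M. \<forall>X\<in>EOb M. \<forall>Y\<in>EOb M. \<forall>Z\<in>EOb M. \<forall>n.
        \<forall>x\<in>fob (FS_tensor (FS_tensor (EHom M Y Z) (EHom M X Y)) (EHom M W X)) n.
          EComp M W X Z n
            (FS_tensor_map (FS_tensor (EHom M Y Z) (EHom M X Y)) (EHom M W X) (EHom M X Z) (EHom M W X)
               (EComp M X Y Z) (FS_id (EHom M W X)) n x) =
          EComp M W Y Z n
            (FS_tensor_map (EHom M Y Z) (FS_tensor (EHom M X Y) (EHom M W X)) (EHom M Y Z) (EHom M W Y)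
               (FS_id (EHom M Y Z)) (EComp M W X Y) n
               (FS_assoc (EHom M Y Z) (EHom M X Y) (EHom M W X) n x))) \<and>
     (\<forall>X\<in>EOb M. \<forall>Y\<in>EOb M. \<forall>n. \<forall>x\<in>fob (FS_tensor FS_unit (EHom M X Y)) n.
        EComp M X Y Y n
          (FS_tensor_map FS_unit (EHom M X Y) (EHom M Y Y) (EHom M X Y) (EId M Y) (FS_id (EHom M X Y)) n x) =
        FS_lunit (EHom M X Y) n x) \<and>
     (\<forall>X\<in>EOb M. \<forall>Y\<in>EOb M. \<forall>n. \<forall>x\<in>fob (FS_tensor (EHom M X Y) FS_unit) n.
        EComp M X X Y n
          (FS_tensor_map (EHom M X Y) FS_unit (EHom M X Y) (EHom M X X) (FS_id (EHom M X Y)) (EId M X) n x) =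
        FS_runit (EHom M X Y) n x)"

record ('o, 'a, 'p, 'b) efunc =
  eob :: "'o \<Rightarrow> 'p"
  ear :: "'o \<Rightarrow> 'o \<Rightarrow> nat \<Rightarrow> 'a \<Rightarrow> 'b"

definition enriched_functor ::
  "('o, 'a) ecat \<Rightarrow> ('p, 'b) ecat \<Rightarrow> ('o, 'a, 'p, 'b) efunc \<Rightarrow> bool" where
  "enriched_functor M N G \<longleftrightarrow>
     eob G \<in> EOb M \<rightarrow>\<^sub>E EOb N \<and>
     ear G \<in> (\<Pi>\<^sub>E X\<in>EOb M. \<Pi>\<^sub>E Y\<in>EOb M. FS_hom (EHom M X Y) (EHom N (eob G X) (eob G Y))) \<and>
     (\<forall>X\<in>EOb M. \<forall>n. \<forall>i<n. ear G X X n (EId M X n i) = EId N (eob G X) n i) \<and>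
     (\<forall>X\<in>EOb M. \<forall>Y\<in>EOb M. \<forall>Z\<in>EOb M. \<forall>n. \<forall>x\<in>fob (FS_tensor (EHom M Y Z) (EHom M X Y)) n.
        ear G X Z n (EComp M X Y Z n x) =
        EComp N (eob G X) (eob G Y) (eob G Z) n
          (FS_tensor_map (EHom M Y Z) (EHom M X Y)
             (EHom N (eob G Y) (eob G Z)) (EHom N (eob G X) (eob G Y)) (ear G Y Z) (ear G X Y) n x))"

definition id_efunc :: "('o, 'a) ecat \<Rightarrow> ('o, 'a, 'o, 'a) efunc" where
  "id_efunc M = \<lparr>eob = (\<lambda>X\<in>EOb M. X), ear = (\<lambda>X\<in>EOb M. \<lambda>Y\<in>EOb M. FS_id (EHom M X Y))\<rparr>"

definition comp_efunc ::
  "('o, 'a) ecat \<Rightarrow> ('p, 'b, 'q, 'c) efunc \<Rightarrow> ('o, 'a, 'p, 'b) efunc \<Rightarrow> ('o, 'a, 'q, 'c) efunc" where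
  "comp_efunc M H G =
     \<lparr>eob = (\<lambda>X\<in>EOb M. eob H (eob G X)),
      ear = (\<lambda>X\<in>EOb M. \<lambda>Y\<in>EOb M. \<lambda>n. \<lambda>f\<in>fob (EHom M X Y) n.
               ear H (eob G X) (eob G Y) n (ear G X Y n f))\<rparr>"

text \<open>
  A transformation \<open>t : G \<Rightarrow> H\<close> has components \<open>t X : I \<rightarrow> N(GX, HX)\<close>; the condition is the usual
  hexagon comparing \<open>M(X, Y) \<cong> I \<otimes> M(X, Y) \<rightarrow> N(GY, HY) \<otimes> N(GX, GY) \<rightarrow> N(GX, HY)\<close> with
  \<open>M(X, Y) \<cong> M(X, Y) \<otimes> I \<rightarrow> N(HX, HY) \<otimes> N(GX, HX) \<rightarrow> N(GX, HY)\<close>.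
\<close>

definition enriched_trans ::
  "('o, 'a) ecat \<Rightarrow> ('p, 'b) ecat \<Rightarrow> ('o, 'a, 'p, 'b) efunc \<Rightarrow> ('o, 'a, 'p, 'b) efunc \<Rightarrow>
   ('o \<Rightarrow> nat \<Rightarrow> nat \<Rightarrow> 'b) set" where
  "enriched_trans M N G H =
     {t \<in> (\<Pi>\<^sub>E X\<in>EOb M. FS_hom FS_unit (EHom N (eob G X) (eob H X))).
        \<forall>X\<in>EOb M. \<forall>Y\<in>EOb M. \<forall>n. \<forall>f\<in>fob (EHom M X Y) n.
          EComp N (eob G X) (eob G Y) (eob H Y) n
            (FS_tensor_map FS_unit (EHom M X Y) (EHom N (eob G Y) (eob H Y)) (EHom N (eob G X) (eob G Y))
               (t Y) (ear G X Y) n (FS_lunit_inv (EHom M X Y) n f)) =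
          EComp N (eob G X) (eob H X) (eob H Y) n
            (FS_tensor_map (EHom M X Y) FS_unit (EHom N (eob H X) (eob H Y)) (EHom N (eob G X) (eob H X))
               (ear H X Y) (t X) n (FS_runit_inv (EHom M X Y) n f))}"

text \<open>The component of a composite is \<open>I \<cong> I \<otimes> I \<rightarrow> N(HX, KX) \<otimes> N(GX, HX) \<rightarrow> N(GX, KX)\<close>.\<close>

definition enriched_functor_cat ::
  "('o, 'a) ecat \<Rightarrow> ('p, 'b) ecat \<Rightarrow> (('o, 'a, 'p, 'b) efunc, 'o \<Rightarrow> nat \<Rightarrow> nat \<Rightarrow> 'b) cat" where
  "enriched_functor_cat M N =
     \<lparr>Ob = {G. enriched_functor M N G},
      Hom = (\<lambda>G H. enriched_trans M N G H),
      Idn = (\<lambda>G. \<lambda>X\<in>EOb M. EId N (eob G X)),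
      Cmp = (\<lambda>G H K u t. \<lambda>X\<in>EOb M. \<lambda>n. \<lambda>i\<in>{..<n}.
               EComp N (eob G X) (eob H X) (eob K X) n
                 (FS_tensor_map FS_unit FS_unit (EHom N (eob H X) (eob K X)) (EHom N (eob G X) (eob H X))
                    (u X) (t X) n (FS_lunit_inv FS_unit n i)))\<rparr>"

text \<open>The underlying ordinary category of the 2-category \<open>[\<^bold>F, \<^bold>S\<^bold>e\<^bold>t]-CAT\<close>.\<close>

definition ECAT :: "(('o, 'a) ecat, ('o, 'a, 'o, 'a) efunc) cat" where
  "ECAT = \<lparr>Ob = {M. enriched_category M}, Hom = (\<lambda>M N. {G. enriched_functor M N G}),
           Idn = id_efunc, Cmp = (\<lambda>L M N H G. comp_efunc L H G)\<rparr>"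

text \<open>
  The representable \<open>[\<^bold>F, \<^bold>S\<^bold>e\<^bold>t]-CAT(-, N)\<close>: an enriched functor \<open>K : L \<rightarrow> M\<close> acts by precomposition, which
  on a transformation \<open>t\<close> is whiskering.
\<close>

definition enriched_precomp ::
  "('p, 'b) ecat \<Rightarrow> ('o, 'a) ecat \<Rightarrow> ('o, 'a) ecat \<Rightarrow> ('o, 'a, 'o, 'a) efunc \<Rightarrow>
   (('o, 'a, 'p, 'b) efunc, 'o \<Rightarrow> nat \<Rightarrow> nat \<Rightarrow> 'b,
    ('o, 'a, 'p, 'b) efunc, 'o \<Rightarrow> nat \<Rightarrow> nat \<Rightarrow> 'b) func" where
  "enriched_precomp N L M K =
     \<lparr>fob = (\<lambda>G\<in>Ob (enriched_functor_cat M N). comp_efunc L G K),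
      far = (\<lambda>G\<in>Ob (enriched_functor_cat M N). \<lambda>H\<in>Ob (enriched_functor_cat M N).
               \<lambda>t\<in>Hom (enriched_functor_cat M N) G H. \<lambda>X\<in>EOb L. t (eob K X))\<rparr>"

definition ECAT_into ::
  "('p, 'b) ecat \<Rightarrow>
   (('o, 'a) ecat, ('o, 'a, 'o, 'a) efunc,
    (('o, 'a, 'p, 'b) efunc, 'o \<Rightarrow> nat \<Rightarrow> nat \<Rightarrow> 'b) cat,
    (('o, 'a, 'p, 'b) efunc, 'o \<Rightarrow> nat \<Rightarrow> nat \<Rightarrow> 'b,
     ('o, 'a, 'p, 'b) efunc, 'o \<Rightarrow> nat \<Rightarrow> nat \<Rightarrow> 'b) func) func" where
  "ECAT_into N =
     \<lparr>fob = (\<lambda>M\<in>Ob ECAT. enriched_functor_cat M N),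
      far = (\<lambda>M\<in>Ob ECAT. \<lambda>L\<in>Ob ECAT. \<lambda>K\<in>Hom ECAT L M. enriched_precomp N L M K)\<rparr>"


section \<open>The construction \<open>R\<close>\<close>

text \<open>
  For \<open>C\<close> with \<open>finite_powers C\<close>: \<open>R_n(X, Y) = C(X\<^sup>n, Y)\<close>, with \<open>s : m \<rightarrow> n\<close> acting by precomposition with
  \<open>\<langle>\<pi> (s 0), \<dots>, \<pi> (s (m - 1))\<rangle> : X\<^sup>n \<rightarrow> X\<^sup>m\<close>.  The unit \<open>I \<rightarrow> R(X, X)\<close> sends \<open>i \<in> I n\<close> to the projection
  \<open>\<pi> i : X\<^sup>n \<rightarrow> X\<close>; it is determined by its value at \<open>0 \<in> I 1\<close>, the identity of \<open>X\<close>.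
\<close>

definition R_hom :: "('o, 'a) pcat \<Rightarrow> 'o \<Rightarrow> 'o \<Rightarrow> 'a fset_obj" where
  "R_hom C X Y =
     \<lparr>fob = (\<lambda>n. Hom C (Pwr C X n) Y),
      far = (\<lambda>m n. \<lambda>s\<in>Hom Fcat m n. \<lambda>f\<in>Hom C (Pwr C X m) Y.
               Cmp C (Pwr C X n) (Pwr C X m) Y f (pow_tuple C m X (Pwr C X n) (\<lambda>i. Prj C X n (s i))))\<rparr>"

definition R :: "('o, 'a) pcat \<Rightarrow> ('o, 'a) ecat" where
  "R C =
     \<lparr>EOb = Ob C, EHom = R_hom C, EId = (\<lambda>X n. \<lambda>i\<in>{..<n}. Prj C X n i),
      EComp = (\<lambda>X Y Z n. coend_lift (R_hom C Y Z) (R_hom C X Y) n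
                 (\<lambda>m g f. Cmp C (Pwr C X n) (Pwr C Y m) Z g (pow_tuple C m Y (Pwr C X n) f)))\<rparr>"

text \<open>
  On functors preserving finite powers: \<open>f : X\<^sup>n \<rightarrow> Y\<close> is sent to \<open>F f\<close> preceded by the canonical isomorphism
  \<open>(F X)\<^sup>n \<rightarrow> F (X\<^sup>n)\<close>, that is, the map into the product cone \<open>(F (X\<^sup>n), F \<pi>)\<close> induced by the
  projections of \<open>(F X)\<^sup>n\<close>.
\<close>

definition R_func :: "('o, 'a) pcat \<Rightarrow> ('p, 'b) pcat \<Rightarrow> ('o, 'a, 'p, 'b) func \<Rightarrow> ('o, 'a, 'p, 'b) efunc" where
  "R_func C D F =
     \<lparr>eob = (\<lambda>X\<in>Ob C. fob F X),
      ear = (\<lambda>X\<in>Ob C. \<lambda>Y\<in>Ob C. \<lambda>n. \<lambda>f\<in>Hom C (Pwr C X n) Y.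
               Cmp D (Pwr D (fob F X) n) (fob F (Pwr C X n)) (fob F Y)
                 (far F (Pwr C X n) Y f)
                 (tuple D n (\<lambda>_. fob F X) (fob F (Pwr C X n)) (\<lambda>i. far F (Pwr C X n) X (Prj C X n i))
                    (Pwr D (fob F X) n) (Prj D (fob F X) n)))\<rparr>"

definition R_Law ::
  "(('o, 'a) law, ('o, 'a, 'o, 'a) func, ('o, 'a) ecat, ('o, 'a, 'o, 'a) efunc) func" where
  "R_Law =
     \<lparr>fob = (\<lambda>T\<in>Ob Law. R (law_powers T)),
      far = (\<lambda>S\<in>Ob Law. \<lambda>T\<in>Ob Law. \<lambda>F\<in>Hom Law S T. R_func (law_powers S) (law_powers T) F)\<rparr>"

definition S_ecat :: "('u::infinite set, 'u \<Rightarrow> 'u) ecat" where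
  "S_ecat = R SetP"

text \<open>\<open>T \<mapsto> [\<^bold>F, \<^bold>S\<^bold>e\<^bold>t]-CAT(R T, \<S>)\<close>\<close>

definition ECAT_R_S ::
  "(('o, 'a) law, ('o, 'a, 'o, 'a) func,
    (('o, 'a, 'u::infinite set, 'u \<Rightarrow> 'u) efunc, 'o \<Rightarrow> nat \<Rightarrow> nat \<Rightarrow> 'u \<Rightarrow> 'u) cat,
    (('o, 'a, 'u set, 'u \<Rightarrow> 'u) efunc, 'o \<Rightarrow> nat \<Rightarrow> nat \<Rightarrow> 'u \<Rightarrow> 'u,
     ('o, 'a, 'u set, 'u \<Rightarrow> 'u) efunc, 'o \<Rightarrow> nat \<Rightarrow> nat \<Rightarrow> 'u \<Rightarrow> 'u) func) func" where
  "ECAT_R_S = comp_func (opcat Law) (ECAT_into S_ecat) (op_func R_Law)"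

end

theory Submission
  imports Defs
begin

text \<open>
  All equivalences involved are strict.  A functor that preserves finite products between categories with
  finite powers is the same thing as an enriched functor between their images under \<open>R\<close>: the functor is
  recovered from the unary operations, and it preserves the power \<open>X\<^sup>n\<close> because \<open>X\<^sup>n\<close> is an absolute limit
  in \<open>R\<close>, the identity of \<open>X\<^sup>n\<close> read as an \<open>n\<close>-ary map from \<open>X\<close> being inverse to the tuple of
  projections.  Likewise an enriched transformation is determined by its unary components, by the Yoneda
  lemma for the unit \<open>\<^bold>F(1, -)\<close>.  Hence each comparison functor from models to enriched functors is an
  isomorphism of categories.  Since \<open>R\<close> is strictly functorial, these isomorphisms are strictly natural.
\<close>

section \<open>Categories and functors\<close>

text \<open>Composition in \<open>R C\<close> lives on a quotient, but on a representative
  \<open>(m, g, f)\<close> it is the substitution of the family \<open>f\<close> into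
  \<open>g\<close>, written \<open>mcomp\<close>. Once this is known to respect the coend relation,
  the enriched axioms are the laws of an abstract clone. A model must preserve all finite products,
  whereas an enriched functor controls only chosen powers. For a Lawvere theory the two agree: every
  object is a power of the generator, so any product is a product of copies of the generator, and a
  functor that is right on the cones \<open>X^n\<close> is right on all of them. Because
  \<open>X^1\<close> is \<open>X\<close> itself, unary operations are literally the arrows of
  \<open>C\<close>, and passing to an enriched functor and back returns the original data, not an
  isomorphic copy. \<open>F (X^n)\<close> may still differ from \<open>(F X)^n\<close>; the
  comparison \<open>power_iso\<close> absorbs the difference, and strict functoriality of
  \<open>R\<close> rests on these comparisons composing. Arity 1 is kept as the literal
  \<open>1\<close>, the form in which the rules about it are stated.\<close>

declare One_nat_def [simp del]

lemma cat_id: "category C \<Longrightarrow> X \<in> Ob C \<Longrightarrow> Idn C X \<in> Hom C X X"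
  by (simp add: category_def)

lemma cat_comp:
  "category C \<Longrightarrow> X \<in> Ob C \<Longrightarrow> Y \<in> Ob C \<Longrightarrow> Z \<in> Ob C \<Longrightarrow> g \<in> Hom C Y Z \<Longrightarrow> f \<in> Hom C X Y \<Longrightarrow>
   Cmp C X Y Z g f \<in> Hom C X Z"
  by (simp add: category_def)

lemma cat_id_right:
  "category C \<Longrightarrow> X \<in> Ob C \<Longrightarrow> Y \<in> Ob C \<Longrightarrow> f \<in> Hom C X Y \<Longrightarrow> Cmp C X X Y f (Idn C X) = f"
  by (simp add: category_def)

lemma cat_id_left:
  "category C \<Longrightarrow> X \<in> Ob C \<Longrightarrow> Y \<in> Ob C \<Longrightarrow> f \<in> Hom C X Y \<Longrightarrow> Cmp C X Y Y (Idn C Y) f = f"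
  by (simp add: category_def)

lemma cat_assoc:
  "category C \<Longrightarrow> W \<in> Ob C \<Longrightarrow> X \<in> Ob C \<Longrightarrow> Y \<in> Ob C \<Longrightarrow> Z \<in> Ob C \<Longrightarrow>
   h \<in> Hom C Y Z \<Longrightarrow> g \<in> Hom C X Y \<Longrightarrow> f \<in> Hom C W X \<Longrightarrow>
   Cmp C W X Z (Cmp C X Y Z h g) f = Cmp C W Y Z h (Cmp C W X Y g f)"
  by (simp add: category_def)

lemmas cat_rules = cat_id cat_comp cat_id_right cat_id_left

lemma categoryI:
  assumes "\<And>X. X \<in> Ob C \<Longrightarrow> Idn C X \<in> Hom C X X"
    and "\<And>X Y Z f g. X \<in> Ob C \<Longrightarrow> Y \<in> Ob C \<Longrightarrow> Z \<in> Ob C \<Longrightarrow> g \<in> Hom C Y Z \<Longrightarrow> f \<in> Hom C X Y \<Longrightarrow>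
      Cmp C X Y Z g f \<in> Hom C X Z"
    and "\<And>X Y f. X \<in> Ob C \<Longrightarrow> Y \<in> Ob C \<Longrightarrow> f \<in> Hom C X Y \<Longrightarrow> Cmp C X X Y f (Idn C X) = f"
    and "\<And>X Y f. X \<in> Ob C \<Longrightarrow> Y \<in> Ob C \<Longrightarrow> f \<in> Hom C X Y \<Longrightarrow> Cmp C X Y Y (Idn C Y) f = f"
    and "\<And>W X Y Z f g h. W \<in> Ob C \<Longrightarrow> X \<in> Ob C \<Longrightarrow> Y \<in> Ob C \<Longrightarrow> Z \<in> Ob C \<Longrightarrow>
      h \<in> Hom C Y Z \<Longrightarrow> g \<in> Hom C X Y \<Longrightarrow> f \<in> Hom C W X \<Longrightarrow>
      Cmp C W Y Z h (Cmp C W X Y g f) = Cmp C W X Z (Cmp C X Y Z h g) f"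
  shows "category C"
  unfolding category_def by (intro conjI ballI) (simp_all add: assms)

lemma func_eqI: "fob F = fob G \<Longrightarrow> far F = far G \<Longrightarrow> F = (G :: ('o, 'a, 'p, 'b) func)"
  by simp

lemma functorI:
  assumes "fob F \<in> extensional (Ob C)" "far F \<in> extensional (Ob C)"
    and "\<And>X. X \<in> Ob C \<Longrightarrow> far F X \<in> extensional (Ob C)"
    and "\<And>X. X \<in> Ob C \<Longrightarrow> fob F X \<in> Ob D"
    and "\<And>X Y. X \<in> Ob C \<Longrightarrow> Y \<in> Ob C \<Longrightarrow> far F X Y \<in> extensional (Hom C X Y)"
    and "\<And>X Y f. X \<in> Ob C \<Longrightarrow> Y \<in> Ob C \<Longrightarrow> f \<in> Hom C X Y \<Longrightarrow> far F X Y f \<in> Hom D (fob F X) (fob F Y)"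
    and "\<And>X. X \<in> Ob C \<Longrightarrow> far F X X (Idn C X) = Idn D (fob F X)"
    and "\<And>X Y Z f g. X \<in> Ob C \<Longrightarrow> Y \<in> Ob C \<Longrightarrow> Z \<in> Ob C \<Longrightarrow> g \<in> Hom C Y Z \<Longrightarrow> f \<in> Hom C X Y \<Longrightarrow>
       far F X Z (Cmp C X Y Z g f) = Cmp D (fob F X) (fob F Y) (fob F Z) (far F Y Z g) (far F X Y f)"
  shows "is_functor C D F"
  unfolding is_functor_def PiE_def using assms by (simp add: Pi_iff)

lemma functor_ob: "is_functor C D F \<Longrightarrow> X \<in> Ob C \<Longrightarrow> fob F X \<in> Ob D"
  by (auto simp: is_functor_def)

lemma functor_ar:
  "is_functor C D F \<Longrightarrow> X \<in> Ob C \<Longrightarrow> Y \<in> Ob C \<Longrightarrow> f \<in> Hom C X Y \<Longrightarrow> far F X Y f \<in> Hom D (fob F X) (fob F Y)"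
  unfolding is_functor_def by (meson PiE_mem)

lemma functor_id: "is_functor C D F \<Longrightarrow> X \<in> Ob C \<Longrightarrow> far F X X (Idn C X) = Idn D (fob F X)"
  by (simp add: is_functor_def)

lemma functor_comp:
  "is_functor C D F \<Longrightarrow> X \<in> Ob C \<Longrightarrow> Y \<in> Ob C \<Longrightarrow> Z \<in> Ob C \<Longrightarrow> g \<in> Hom C Y Z \<Longrightarrow> f \<in> Hom C X Y \<Longrightarrow>
   far F X Z (Cmp C X Y Z g f) = Cmp D (fob F X) (fob F Y) (fob F Z) (far F Y Z g) (far F X Y f)"
  by (simp add: is_functor_def)

lemma functor_ext:
  assumes "is_functor C D F"
  shows "fob F \<in> extensional (Ob C)" "far F \<in> extensional (Ob C)"
    "X \<in> Ob C \<Longrightarrow> far F X \<in> extensional (Ob C)"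
    "X \<in> Ob C \<Longrightarrow> Y \<in> Ob C \<Longrightarrow> far F X Y \<in> extensional (Hom C X Y)"
  using assms unfolding is_functor_def by (auto simp: PiE_iff)

lemma functor_eqI:
  assumes F: "is_functor C D F" and G: "is_functor C D' G"
    and "\<And>X. X \<in> Ob C \<Longrightarrow> fob F X = fob G X"
    and "\<And>X Y f. X \<in> Ob C \<Longrightarrow> Y \<in> Ob C \<Longrightarrow> f \<in> Hom C X Y \<Longrightarrow> far F X Y f = far G X Y f"
  shows "F = G"
proof (rule func_eqI)
  show "fob F = fob G"
    using functor_ext(1)[OF F] functor_ext(1)[OF G] assms(3) by (rule extensionalityI)
  show "far F = far G"
  proof (rule extensionalityI[OF functor_ext(2)[OF F] functor_ext(2)[OF G]])
    fix X assume X: "X \<in> Ob C"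
    show "far F X = far G X"
    proof (rule extensionalityI[OF functor_ext(3)[OF F X] functor_ext(3)[OF G X]])
      fix Y assume Y: "Y \<in> Ob C"
      show "far F X Y = far G X Y"
        by (rule extensionalityI[OF functor_ext(4)[OF F X Y] functor_ext(4)[OF G X Y]])
          (rule assms(4)[OF X Y])
    qed
  qed
qed

lemma comp_func_simps [simp]:
  "X \<in> Ob C \<Longrightarrow> fob (comp_func C G F) X = fob G (fob F X)"
  "X \<in> Ob C \<Longrightarrow> Y \<in> Ob C \<Longrightarrow> f \<in> Hom C X Y \<Longrightarrow>
   far (comp_func C G F) X Y f = far G (fob F X) (fob F Y) (far F X Y f)"
  by (simp_all add: comp_func_def)

lemma id_func_simps [simp]:
  "X \<in> Ob C \<Longrightarrow> fob (id_func C) X = X"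
  "X \<in> Ob C \<Longrightarrow> Y \<in> Ob C \<Longrightarrow> f \<in> Hom C X Y \<Longrightarrow> far (id_func C) X Y f = f"
  by (simp_all add: id_func_def)

lemma is_functor_comp_func:
  assumes "category C" and F: "is_functor C D F" and G: "is_functor D E G"
  shows "is_functor C E (comp_func C G F)"
proof (rule functorI)
  show "fob (comp_func C G F) \<in> extensional (Ob C)" "far (comp_func C G F) \<in> extensional (Ob C)"
    by (simp_all add: comp_func_def)
  show "X \<in> Ob C \<Longrightarrow> far (comp_func C G F) X \<in> extensional (Ob C)" for X
    by (simp add: comp_func_def)
  show "X \<in> Ob C \<Longrightarrow> Y \<in> Ob C \<Longrightarrow> far (comp_func C G F) X Y \<in> extensional (Hom C X Y)" for X Y
    by (simp add: comp_func_def)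
qed (simp_all add: cat_id cat_comp functor_ob[OF F] functor_ar[OF F] functor_id[OF F] functor_comp[OF F]
      functor_ob[OF G] functor_ar[OF G] functor_id[OF G] functor_comp[OF G] assms(1))

lemma is_functor_id_func:
  assumes "category C" shows "is_functor C C (id_func C)"
proof (rule functorI)
  show "fob (id_func C) \<in> extensional (Ob C)" "far (id_func C) \<in> extensional (Ob C)"
    by (simp_all add: id_func_def)
  show "X \<in> Ob C \<Longrightarrow> far (id_func C) X \<in> extensional (Ob C)" for X
    by (simp add: id_func_def)
  show "X \<in> Ob C \<Longrightarrow> Y \<in> Ob C \<Longrightarrow> far (id_func C) X Y \<in> extensional (Hom C X Y)" for X Y
    by (simp add: id_func_def)
qed (simp_all add: cat_id cat_comp assms)

lemma comp_func_assoc: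
  assumes "category C" "is_functor C D F" "is_functor D E G" "is_functor E E' H"
  shows "comp_func C H (comp_func C G F) = comp_func C (comp_func D H G) F"
  by (simp add: comp_func_def functor_ob[OF assms(2)] functor_ar[OF assms(2)] cong: restrict_cong)

lemma comp_func_id:
  assumes "category C" "is_functor C D F"
  shows "comp_func C F (id_func C) = F"
  by (rule functor_eqI[OF is_functor_comp_func[OF assms(1) is_functor_id_func[OF assms(1)] assms(2)] assms(2)])
    auto

lemma opcat_simps [simp]:
  "Ob (opcat C) = Ob C" "Hom (opcat C) X Y = Hom C Y X" "Idn (opcat C) = Idn C"
  "Cmp (opcat C) X Y Z g f = Cmp C Z Y X f g"
  by (simp_all add: opcat_def)

text \<open>This joins the covariant \<open>R_Law\<close> to the contravariant representable, giving
  the contravariant \<open>ECAT_R_S\<close>.\<close>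

lemma is_functor_comp_op_func:
  assumes "category C" and F: "is_functor C D F" and G: "is_functor (opcat D) E G"
  shows "is_functor (opcat C) E (comp_func (opcat C) G (op_func F))"
proof (rule functorI)
  let ?H = "comp_func (opcat C) G (op_func F)"
  show "fob ?H \<in> extensional (Ob (opcat C))" "far ?H \<in> extensional (Ob (opcat C))"
    by (simp_all add: comp_func_def)
  show "X \<in> Ob (opcat C) \<Longrightarrow> far ?H X \<in> extensional (Ob (opcat C))" for X
    by (simp add: comp_func_def)
  show "X \<in> Ob (opcat C) \<Longrightarrow> Y \<in> Ob (opcat C) \<Longrightarrow> far ?H X Y \<in> extensional (Hom (opcat C) X Y)" for X Y
    by (simp add: comp_func_def)
qed (simp_all add: op_func_def cat_id cat_comp functor_ob[OF F] functor_ar[OF F] functor_id[OF F]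
    functor_comp[OF F] functor_ob[OF G, simplified] functor_ar[OF G, simplified]
    functor_id[OF G, simplified] functor_comp[OF G, simplified] assms(1))

section \<open>Finite products\<close>

text \<open>Arbitrary index sets let iterated products be indexed by a \<open>Sigma\<close> and
  moved along bijections, without arithmetic on positions.\<close>

definition prod_on ::
  "('o, 'a, 'z) cat_scheme \<Rightarrow> 'i set \<Rightarrow> ('i \<Rightarrow> 'o) \<Rightarrow> 'o \<Rightarrow> ('i \<Rightarrow> 'a) \<Rightarrow> bool" where
  "prod_on C I A P p \<longleftrightarrow>
     P \<in> Ob C \<and> (\<forall>i\<in>I. A i \<in> Ob C) \<and> (\<forall>i\<in>I. p i \<in> Hom C P (A i)) \<and>
     (\<forall>W\<in>Ob C. \<forall>f. (\<forall>i\<in>I. f i \<in> Hom C W (A i)) \<longrightarrow>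
        (\<exists>!u. u \<in> Hom C W P \<and> (\<forall>i\<in>I. Cmp C W P (A i) (p i) u = f i)))"

lemma is_product_iff: "is_product C n A P p \<longleftrightarrow> prod_on C {..<n} A P p"
  by (simp add: is_product_def prod_on_def Ball_def)

lemma prod_onI:
  assumes "P \<in> Ob C" "\<And>i. i \<in> I \<Longrightarrow> A i \<in> Ob C" "\<And>i. i \<in> I \<Longrightarrow> p i \<in> Hom C P (A i)"
    and "\<And>W f. W \<in> Ob C \<Longrightarrow> (\<And>i. i \<in> I \<Longrightarrow> f i \<in> Hom C W (A i)) \<Longrightarrow>
      \<exists>u\<in>Hom C W P. \<forall>i\<in>I. Cmp C W P (A i) (p i) u = f i"
    and "\<And>W u v. W \<in> Ob C \<Longrightarrow> u \<in> Hom C W P \<Longrightarrow> v \<in> Hom C W P \<Longrightarrow>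
      (\<And>i. i \<in> I \<Longrightarrow> Cmp C W P (A i) (p i) u = Cmp C W P (A i) (p i) v) \<Longrightarrow> u = v"
  shows "prod_on C I A P p"
  unfolding prod_on_def
proof (intro conjI ballI allI impI)
  fix W f assume W: "W \<in> Ob C" and f: "\<forall>i\<in>I. f i \<in> Hom C W (A i)"
  obtain u where u: "u \<in> Hom C W P" "\<forall>i\<in>I. Cmp C W P (A i) (p i) u = f i"
    using assms(4)[OF W, of f] f by auto
  show "\<exists>!u. u \<in> Hom C W P \<and> (\<forall>i\<in>I. Cmp C W P (A i) (p i) u = f i)"
  proof (rule ex1I)
    show "u \<in> Hom C W P \<and> (\<forall>i\<in>I. Cmp C W P (A i) (p i) u = f i)" using u by simp
    fix v assume v: "v \<in> Hom C W P \<and> (\<forall>i\<in>I. Cmp C W P (A i) (p i) v = f i)"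
    show "v = u" by (rule assms(5)[OF W]) (use u v in auto)
  qed
qed (use assms in auto)

lemma prod_onD:
  assumes "prod_on C I A P p"
  shows "P \<in> Ob C" "i \<in> I \<Longrightarrow> A i \<in> Ob C" "i \<in> I \<Longrightarrow> p i \<in> Hom C P (A i)"
  using assms by (auto simp: prod_on_def)

lemma prod_on_factor:
  assumes "prod_on C I A P p" "W \<in> Ob C" "\<And>i. i \<in> I \<Longrightarrow> f i \<in> Hom C W (A i)"
  obtains u where "u \<in> Hom C W P" "\<And>i. i \<in> I \<Longrightarrow> Cmp C W P (A i) (p i) u = f i"
proof -
  have "\<exists>!u. u \<in> Hom C W P \<and> (\<forall>i\<in>I. Cmp C W P (A i) (p i) u = f i)"
    using assms(1)[unfolded prod_on_def] assms(2,3) by simp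
  then show thesis using that by auto
qed

lemma prod_on_eqI:
  assumes "category C" "prod_on C I A P p" "W \<in> Ob C" "u \<in> Hom C W P" "v \<in> Hom C W P"
    and "\<And>i. i \<in> I \<Longrightarrow> Cmp C W P (A i) (p i) u = Cmp C W P (A i) (p i) v"
  shows "u = v"
proof -
  let ?f = "\<lambda>i. Cmp C W P (A i) (p i) v"
  have "\<forall>i\<in>I. ?f i \<in> Hom C W (A i)"
    using assms(3,5) by (simp add: cat_comp assms(1) prod_onD[OF assms(2)])
  then have "\<exists>!u. u \<in> Hom C W P \<and> (\<forall>i\<in>I. Cmp C W P (A i) (p i) u = ?f i)"
    using assms(2)[unfolded prod_on_def] assms(3) by simp
  then show ?thesis using assms(4-6) by blast
qed

lemma prod_on_cong:
  assumes "\<And>i. i \<in> I \<Longrightarrow> A i = B i" "\<And>i. i \<in> I \<Longrightarrow> p i = q i"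
  shows "prod_on C I A P p \<longleftrightarrow> prod_on C I B P q"
  unfolding prod_on_def using assms by simp

lemma is_product_cong:
  assumes "\<And>i. i < n \<Longrightarrow> A i = B i" "P = Q" "\<And>i. i < n \<Longrightarrow> p i = q i"
  shows "is_product C n A P p \<longleftrightarrow> is_product C n B Q q"
  unfolding is_product_iff \<open>P = Q\<close> by (rule prod_on_cong) (simp_all add: assms(1,3))

lemma prod_on_reindex:
  assumes C: "category C" and h: "bij_betw h I J" and P: "prod_on C J A P p"
  shows "prod_on C I (\<lambda>i. A (h i)) P (\<lambda>i. p (h i))"
proof (rule prod_onI)
  have hI: "h i \<in> J" if "i \<in> I" for i using h that by (auto simp: bij_betw_def)
  show "A (h i) \<in> Ob C" "p (h i) \<in> Hom C P (A (h i))" if "i \<in> I" for i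
    using that by (simp_all add: prod_onD[OF P] hI)
  show "P \<in> Ob C" using prod_onD[OF P] by simp
  have inv: "inv_into I h j \<in> I" "h (inv_into I h j) = j" if "j \<in> J" for j
    using h that by (auto simp: bij_betw_def inv_into_into f_inv_into_f)
  fix W assume W: "W \<in> Ob C"
  { fix f assume f: "\<And>i. i \<in> I \<Longrightarrow> f i \<in> Hom C W (A (h i))"
    have "f (inv_into I h j) \<in> Hom C W (A j)" if "j \<in> J" for j
      using f[OF inv(1)[OF that]] inv(2)[OF that] by simp
    from prod_on_factor[OF P W this]
    obtain u where "u \<in> Hom C W P" "\<And>j. j \<in> J \<Longrightarrow> Cmp C W P (A j) (p j) u = f (inv_into I h j)"
      by blast
    moreover have "inv_into I h (h i) = i" if "i \<in> I" for i
      using h that by (simp add: bij_betw_def)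
    ultimately have "\<forall>i\<in>I. Cmp C W P (A (h i)) (p (h i)) u = f i"
      using hI by simp
    with \<open>u \<in> Hom C W P\<close> show "\<exists>u\<in>Hom C W P. \<forall>i\<in>I. Cmp C W P (A (h i)) (p (h i)) u = f i"
      by (rule bexI[rotated]) }
  fix u v assume "u \<in> Hom C W P" "v \<in> Hom C W P"
    and eq: "\<And>i. i \<in> I \<Longrightarrow> Cmp C W P (A (h i)) (p (h i)) u = Cmp C W P (A (h i)) (p (h i)) v"
  show "u = v"
  proof (rule prod_on_eqI[OF C P W])
    show "u \<in> Hom C W P" "v \<in> Hom C W P" by fact+
    fix j assume "j \<in> J"
    then show "Cmp C W P (A j) (p j) u = Cmp C W P (A j) (p j) v"
      using eq[OF inv(1)[of j]] inv(2)[of j] by simp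
  qed
qed

text \<open>A product of products is a product: a family of arrows factors through each
  \<open>A i\<close>, and the resulting arrows factor through \<open>P\<close>. Uniqueness is tested
  in the same two stages.\<close>

lemma prod_on_Sigma:
  assumes C: "category C" and A: "\<And>i. i \<in> I \<Longrightarrow> prod_on C (J i) (B i) (A i) (q i)"
    and P: "prod_on C I A P p"
  shows "prod_on C (Sigma I J) (\<lambda>(i, j). B i j) P (\<lambda>(i, j). Cmp C P (A i) (B i j) (q i j) (p i))"
proof (rule prod_onI)
  note PD = prod_onD[OF P]
  note AD = prod_onD[OF A]
  show "P \<in> Ob C" by (rule PD)
  show "(case k of (i, j) \<Rightarrow> B i j) \<in> Ob C" if "k \<in> Sigma I J" for k
    using that by (auto simp: AD)
  show "(case k of (i, j) \<Rightarrow> Cmp C P (A i) (B i j) (q i j) (p i)) \<in> Hom C P (case k of (i, j) \<Rightarrow> B i j)"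
    if "k \<in> Sigma I J" for k
    using that by (auto simp: AD PD C cat_comp)
  fix W assume W: "W \<in> Ob C"
  { fix f assume f: "\<And>k. k \<in> Sigma I J \<Longrightarrow> f k \<in> Hom C W (case k of (i, j) \<Rightarrow> B i j)"
    have "\<exists>g. g \<in> Hom C W (A i) \<and> (\<forall>j\<in>J i. Cmp C W (A i) (B i j) (q i j) g = f (i, j))" if i: "i \<in> I" for i
    proof -
      have "f (i, j) \<in> Hom C W (B i j)" if "j \<in> J i" for j
        using f[of "(i, j)"] i that by simp
      from prod_on_factor[OF A[OF i] W this] show ?thesis by metis
    qed
    then obtain g where g: "\<And>i. i \<in> I \<Longrightarrow> g i \<in> Hom C W (A i)"
      "\<And>i j. i \<in> I \<Longrightarrow> j \<in> J i \<Longrightarrow> Cmp C W (A i) (B i j) (q i j) (g i) = f (i, j)"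
      by metis
    obtain u where u: "u \<in> Hom C W P" "\<And>i. i \<in> I \<Longrightarrow> Cmp C W P (A i) (p i) u = g i"
      using prod_on_factor[OF P W g(1)] by metis
    show "\<exists>u\<in>Hom C W P. \<forall>k\<in>Sigma I J. Cmp C W P (case k of (i, j) \<Rightarrow> B i j)
         (case k of (i, j) \<Rightarrow> Cmp C P (A i) (B i j) (q i j) (p i)) u = f k"
      by (rule bexI[OF _ u(1)]) (auto simp: cat_assoc[OF C] W PD AD u g) }
  fix u v assume u: "u \<in> Hom C W P" and v: "v \<in> Hom C W P"
    and eq: "\<And>k. k \<in> Sigma I J \<Longrightarrow> Cmp C W P (case k of (i, j) \<Rightarrow> B i j)
         (case k of (i, j) \<Rightarrow> Cmp C P (A i) (B i j) (q i j) (p i)) u =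
       Cmp C W P (case k of (i, j) \<Rightarrow> B i j) (case k of (i, j) \<Rightarrow> Cmp C P (A i) (B i j) (q i j) (p i)) v"
  show "u = v"
  proof (rule prod_on_eqI[OF C P W u v])
    fix i assume i: "i \<in> I"
    show "Cmp C W P (A i) (p i) u = Cmp C W P (A i) (p i) v"
    proof (rule prod_on_eqI[OF C A[OF i] W])
      fix j assume j: "j \<in> J i"
      show "Cmp C W (A i) (B i j) (q i j) (Cmp C W P (A i) (p i) u) =
         Cmp C W (A i) (B i j) (q i j) (Cmp C W P (A i) (p i) v)"
        using eq[of "(i, j)"] i j u v W by (simp add: cat_assoc[OF C] PD AD)
    qed (simp_all add: C W PD i u v AD cat_comp)
  qed
qed

text \<open>Converse of \<open>prod_on_Sigma\<close>, and the device for recognising products. The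
  arrows \<open>q i j\<close> out of each \<open>A i\<close> are jointly monic, so equations into
  \<open>A i\<close> may be tested after composing with them, where the total cone decides.\<close>

lemma prod_on_Sigma_cancel:
  assumes C: "category C" and A: "\<And>i. i \<in> I \<Longrightarrow> prod_on C (J i) (B i) (A i) (q i)"
    and P0: "P \<in> Ob C" and p: "\<And>i. i \<in> I \<Longrightarrow> p i \<in> Hom C P (A i)"
    and P: "prod_on C (Sigma I J) (\<lambda>(i, j). B i j) P (\<lambda>(i, j). Cmp C P (A i) (B i j) (q i j) (p i))"
  shows "prod_on C I A P p"
proof (rule prod_onI)
  note AD = prod_onD[OF A]
  show "P \<in> Ob C" "\<And>i. i \<in> I \<Longrightarrow> A i \<in> Ob C" "\<And>i. i \<in> I \<Longrightarrow> p i \<in> Hom C P (A i)"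
    by (simp_all add: P0 p AD)
  fix W assume W: "W \<in> Ob C"
  { fix f assume f: "\<And>i. i \<in> I \<Longrightarrow> f i \<in> Hom C W (A i)"
    let ?f = "\<lambda>(i, j). Cmp C W (A i) (B i j) (q i j) (f i)"
    have "\<And>k. k \<in> Sigma I J \<Longrightarrow> ?f k \<in> Hom C W (case k of (i, j) \<Rightarrow> B i j)"
      by (auto simp: C W AD f cat_comp)
    from prod_on_factor[OF P W this] obtain u where u: "u \<in> Hom C W P"
      "\<And>k. k \<in> Sigma I J \<Longrightarrow> Cmp C W P (case k of (i, j) \<Rightarrow> B i j)
         (case k of (i, j) \<Rightarrow> Cmp C P (A i) (B i j) (q i j) (p i)) u = ?f k"
      by blast
    show "\<exists>u\<in>Hom C W P. \<forall>i\<in>I. Cmp C W P (A i) (p i) u = f i"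
    proof (rule bexI[OF _ u(1)], rule ballI)
      fix i assume i: "i \<in> I"
      show "Cmp C W P (A i) (p i) u = f i"
      proof (rule prod_on_eqI[OF C A[OF i] W])
        fix j assume j: "j \<in> J i"
        show "Cmp C W (A i) (B i j) (q i j) (Cmp C W P (A i) (p i) u) = Cmp C W (A i) (B i j) (q i j) (f i)"
          using u(2)[of "(i, j)"] i j u(1) W P0 by (simp add: cat_assoc[OF C] p AD)
      qed (simp_all add: C W P0 p AD i u f cat_comp)
    qed }
  fix u v assume u: "u \<in> Hom C W P" and v: "v \<in> Hom C W P"
    and eq: "\<And>i. i \<in> I \<Longrightarrow> Cmp C W P (A i) (p i) u = Cmp C W P (A i) (p i) v"
  show "u = v"
    by (rule prod_on_eqI[OF C P W u v]) (auto simp: cat_assoc[OF C] eq u v W P0 p AD)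
qed

text \<open>Any two product cones of the same family are isomorphic, and functors preserve isomorphisms.\<close>

lemma functor_preserves_prod_on_iso:
  assumes C: "category C" and D: "category D" and F: "is_functor C D F"
    and P: "prod_on C I A P p" and Q: "prod_on C I A Q q"
    and FQ: "prod_on D I (\<lambda>i. fob F (A i)) (fob F Q) (\<lambda>i. far F Q (A i) (q i))"
  shows "prod_on D I (\<lambda>i. fob F (A i)) (fob F P) (\<lambda>i. far F P (A i) (p i))"
proof -
  note PD = prod_onD[OF P]
  note QD = prod_onD[OF Q]
  obtain u where u: "u \<in> Hom C P Q" "\<And>i. i \<in> I \<Longrightarrow> Cmp C P Q (A i) (q i) u = p i"
    using prod_on_factor[OF Q PD(1) PD(3)] by metis
  obtain v where v: "v \<in> Hom C Q P" "\<And>i. i \<in> I \<Longrightarrow> Cmp C Q P (A i) (p i) v = q i"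
    using prod_on_factor[OF P QD(1) QD(3)] by metis
  \<comment> \<open>After applying \<open>F\<close>, this makes the image of \<open>u\<close> a
    split monomorphism, so uniqueness for the cone on \<open>fob F Q\<close> passes to
    \<open>fob F P\<close>. Existence composes a factorisation through \<open>fob F Q\<close> with
    the image of \<open>v\<close>.\<close>
  have vu: "Cmp C P Q P v u = Idn C P"
    by (rule prod_on_eqI[OF C P PD(1)]) (simp_all add: C u v PD QD cat_rules cat_assoc[OF C, symmetric])
  have Fp: "far F P (A i) (p i) = Cmp D (fob F P) (fob F Q) (fob F (A i)) (far F Q (A i) (q i)) (far F P Q u)"
    if "i \<in> I" for i
    using functor_comp[OF F, of P Q "A i" "q i" u] by (simp add: u PD QD that)
  have Fq: "far F Q (A i) (q i) = Cmp D (fob F Q) (fob F P) (fob F (A i)) (far F P (A i) (p i)) (far F Q P v)"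
    if "i \<in> I" for i
    using functor_comp[OF F, of Q P "A i" "p i" v] by (simp add: v PD QD that)
  have Fvu: "Cmp D (fob F P) (fob F Q) (fob F P) (far F Q P v) (far F P Q u) = Idn D (fob F P)"
    using functor_comp[OF F, of P Q P v u] by (simp add: vu functor_id[OF F] u v PD QD)
  note obs = functor_ob[OF F PD(1)] functor_ob[OF F QD(1)] functor_ob[OF F PD(2)]
    functor_ar[OF F PD(1) QD(1) u(1)] functor_ar[OF F QD(1) PD(1) v(1)] functor_ar[OF F QD(1) QD(2) QD(3)]
    functor_ar[OF F PD(1) PD(2) PD(3)]
  show ?thesis
  proof (rule prod_onI)
    fix W assume W: "W \<in> Ob D"
    { fix f assume f: "\<And>i. i \<in> I \<Longrightarrow> f i \<in> Hom D W (fob F (A i))"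
      obtain w where w: "w \<in> Hom D W (fob F Q)"
        "\<And>i. i \<in> I \<Longrightarrow> Cmp D W (fob F Q) (fob F (A i)) (far F Q (A i) (q i)) w = f i"
        using prod_on_factor[OF FQ W f] by metis
      have "Cmp D W (fob F P) (fob F (A i)) (far F P (A i) (p i)) (Cmp D W (fob F Q) (fob F P) (far F Q P v) w) = f i"
        if i: "i \<in> I" for i
        using w(2)[OF i] Fq[OF i] by (simp add: cat_assoc D W w obs i)
      then show "\<exists>u\<in>Hom D W (fob F P). \<forall>i\<in>I. Cmp D W (fob F P) (fob F (A i)) (far F P (A i) (p i)) u = f i"
        by (intro bexI[of _ "Cmp D W (fob F Q) (fob F P) (far F Q P v) w"]) (simp_all add: cat_comp D W w obs) }
    fix x y assume x: "x \<in> Hom D W (fob F P)" and y: "y \<in> Hom D W (fob F P)"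
      and eq: "\<And>i. i \<in> I \<Longrightarrow> Cmp D W (fob F P) (fob F (A i)) (far F P (A i) (p i)) x =
         Cmp D W (fob F P) (fob F (A i)) (far F P (A i) (p i)) y"
    have "Cmp D W (fob F P) (fob F Q) (far F P Q u) x = Cmp D W (fob F P) (fob F Q) (far F P Q u) y"
    proof (rule prod_on_eqI[OF D FQ W])
      fix i assume i: "i \<in> I"
      show "Cmp D W (fob F Q) (fob F (A i)) (far F Q (A i) (q i)) (Cmp D W (fob F P) (fob F Q) (far F P Q u) x) =
          Cmp D W (fob F Q) (fob F (A i)) (far F Q (A i) (q i)) (Cmp D W (fob F P) (fob F Q) (far F P Q u) y)"
        using eq[OF i] by (simp add: Fp[OF i] cat_assoc[OF D] W x y obs i)
    qed (simp_all add: cat_comp D W x y obs)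
    then have "Cmp D W (fob F Q) (fob F P) (far F Q P v) (Cmp D W (fob F P) (fob F Q) (far F P Q u) x) =
       Cmp D W (fob F Q) (fob F P) (far F Q P v) (Cmp D W (fob F P) (fob F Q) (far F P Q u) y)" by simp
    then show "x = y"
      by (simp add: cat_assoc[OF D, symmetric] cat_id_left Fvu x y obs W D)
  qed (simp_all add: obs)
qed

section \<open>Products and powers in a Lawvere theory\<close>

lemma lawvere_theoryD:
  assumes "lawvere_theory T"
  shows "category T" "Ob T = range (pw T)" "inj (pw T)" "pw T n \<in> Ob T"
    "is_product T n (\<lambda>_. pw T 1) (pw T n) (pr T n)" "pr T 1 0 = Idn T (pw T 1)"
  using assms by (auto simp: lawvere_theory_def)

text \<open>Each \<open>A i\<close> is a power of the generator, so composing projections exhibits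
  \<open>P\<close> as a product of copies of the generator, isomorphic to some \<open>X^K\<close>,
  where \<open>pow\<close> applies. Functoriality splits the resulting projections again, and
  \<open>prod_on_Sigma_cancel\<close> removes the inner ones.\<close>

lemma law_preserves_finite_products:
  assumes T: "lawvere_theory T" and D: "category D" and F: "is_functor T D F"
    and pow: "\<And>n. is_product D n (\<lambda>_. fob F (pw T 1)) (fob F (pw T n)) (\<lambda>i. far F (pw T n) (pw T 1) (pr T n i))"
  shows "preserves_finite_products T D F"
  unfolding preserves_finite_products_def is_product_iff
proof (intro allI impI)
  fix n :: nat and A P p assume P: "prod_on T {..<n} A P p"
  note TD = lawvere_theoryD[OF T]
  note PD = prod_onD[OF P]
  let ?X = "pw T 1"
  have "\<forall>i. i \<in> {..<n} \<longrightarrow> (\<exists>k. A i = pw T k)" using PD(2) unfolding TD(2) by blast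
  then obtain k where k: "\<And>i. i \<in> {..<n} \<Longrightarrow> A i = pw T (k i)" by metis
  let ?J = "\<lambda>i. {..<k i}"
  let ?q = "\<lambda>i. pr T (k i)"
  let ?S = "Sigma {..<n} ?J"
  have "finite ?S" by simp
  then obtain h where "bij_betw h {0..<card ?S} ?S"
    using ex_bij_betw_nat_finite by blast
  then have h: "bij_betw (inv_into {0..<card ?S} h) ?S {..<card ?S}"
    by (auto simp: atLeast0LessThan intro: bij_betw_inv_into)
  \<comment> \<open>Any enumeration of the pairs \<open>(i, j)\<close> will do: it only names the
    copies of the generator that make up \<open>P\<close>.\<close>
  define g where "g = inv_into {0..<card ?S} h"
  define K where "K = card ?S"
  have h: "bij_betw g ?S {..<K}" using h by (simp add: g_def K_def)
  have A: "prod_on T (?J i) (\<lambda>_. ?X) (A i) (?q i)" if "i \<in> {..<n}" for i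
    using TD(5)[of "k i"] k[OF that] by (simp add: is_product_iff)
  have FA: "prod_on D (?J i) (\<lambda>_. fob F ?X) (fob F (A i)) (\<lambda>j. far F (A i) ?X (?q i j))" if "i \<in> {..<n}" for i
    using pow[of "k i"] k[OF that] by (simp add: is_product_iff)
  have PS: "prod_on T ?S (\<lambda>_. ?X) P (\<lambda>(i, j). Cmp T P (A i) ?X (?q i j) (p i))"
    using prod_on_Sigma[OF TD(1), where B = "\<lambda>_ _. ?X", OF A P] by (simp add: split_beta')
  have QS: "prod_on T ?S (\<lambda>_. ?X) (pw T K) (\<lambda>s. pr T K (g s))"
    using prod_on_reindex[OF TD(1) h, of "\<lambda>_. ?X"] TD(5)[of K] by (simp add: is_product_iff)
  have FQS: "prod_on D ?S (\<lambda>_. fob F ?X) (fob F (pw T K)) (\<lambda>s. far F (pw T K) ?X (pr T K (g s)))"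
    using prod_on_reindex[OF D h, of "\<lambda>_. fob F ?X"] pow[of K] by (simp add: is_product_iff)
  have FPS: "prod_on D ?S (\<lambda>_. fob F ?X) (fob F P) (\<lambda>s. far F P ?X (case s of (i, j) \<Rightarrow> Cmp T P (A i) ?X (?q i j) (p i)))"
    by (rule functor_preserves_prod_on_iso[OF TD(1) D F PS QS FQS])
  have "prod_on D ?S (\<lambda>(i, j). fob F ?X) (fob F P)
      (\<lambda>(i, j). Cmp D (fob F P) (fob F (A i)) (fob F ?X) (far F (A i) ?X (?q i j)) (far F P (A i) (p i)))"
    by (rule iffD1[OF prod_on_cong FPS])
      (auto simp: functor_comp[OF F] PD prod_onD[OF A] TD(4))
  then show "prod_on D {..<n} (\<lambda>i. fob F (A i)) (fob F P) (\<lambda>i. far F P (A i) (p i))"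
    by (intro prod_on_Sigma_cancel[OF D FA]) (simp_all add: functor_ob[OF F] functor_ar[OF F] PD)
qed

lemma tuple_props:
  assumes "is_product C n A P p" "W \<in> Ob C" "\<And>i. i < n \<Longrightarrow> f i \<in> Hom C W (A i)"
  shows tuple_hom: "tuple C n A P p W f \<in> Hom C W P"
    and tuple_prj: "i < n \<Longrightarrow> Cmp C W P (A i) (p i) (tuple C n A P p W f) = f i"
proof -
  have "\<exists>!u. u \<in> Hom C W P \<and> (\<forall>i<n. Cmp C W P (A i) (p i) u = f i)"
    using assms unfolding is_product_def by simp
  from theI'[OF this] show "tuple C n A P p W f \<in> Hom C W P"
    "i < n \<Longrightarrow> Cmp C W P (A i) (p i) (tuple C n A P p W f) = f i"
    by (auto simp: tuple_def)
qed

lemma product_eqI: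
  assumes "category C" "is_product C n A P p" "W \<in> Ob C" "u \<in> Hom C W P" "v \<in> Hom C W P"
    and "\<And>i. i < n \<Longrightarrow> Cmp C W P (A i) (p i) u = Cmp C W P (A i) (p i) v"
  shows "u = v"
  using prod_on_eqI[OF assms(1) assms(2)[unfolded is_product_iff] assms(3-5)] assms(6) by simp

lemma tuple_eqI:
  assumes "category C" "is_product C n A P p" "W \<in> Ob C" "u \<in> Hom C W P"
    and "\<And>i. i < n \<Longrightarrow> Cmp C W P (A i) (p i) u = f i"
    and "\<And>i. i < n \<Longrightarrow> f i \<in> Hom C W (A i)"
  shows "tuple C n A P p W f = u"
  by (rule product_eqI[OF assms(1-3)])
    (simp_all add: tuple_hom[OF assms(2,3,6)] tuple_prj[OF assms(2,3,6)] assms(4,5))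

lemma tuple_cong:
  assumes "\<And>i. i < n \<Longrightarrow> f i = g i" shows "tuple C n A P p W f = tuple C n A P p W g"
  using assms by (simp add: tuple_def)

lemma law_powers_simps [simp]:
  "Ob (law_powers T) = Ob T" "Hom (law_powers T) = Hom T" "Idn (law_powers T) = Idn T"
  "Cmp (law_powers T) = Cmp T"
  by (simp_all add: law_powers_def)

lemma Pwr_law_powers: "Pwr (law_powers T) A n = pw T (law_exponent T A * n)"
  by (simp add: law_powers_def)

lemma category_law_powers [simp]: "category (law_powers T) = category T"
  by (simp add: category_def)

lemma is_functor_law_powers [simp]:
  "is_functor (law_powers T) D F = is_functor T D F" "is_functor D (law_powers T) F' = is_functor D T F'"
  by (simp_all add: is_functor_def)

lemma is_product_law_powers [simp]: "is_product (law_powers T) = is_product T"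
  by (simp add: is_product_def fun_eq_iff)

lemma preserves_law_powers [simp]:
  "preserves_finite_products (law_powers T) D F = preserves_finite_products T D F"
  "preserves_finite_products D (law_powers T) F' = preserves_finite_products D T F'"
  by (simp_all add: preserves_finite_products_def)

lemma law_exponent_pw [simp]: "lawvere_theory T \<Longrightarrow> law_exponent T (pw T k) = k"
  using lawvere_theoryD(3)[of T] by (simp add: law_exponent_def)

text \<open>Entry \<open>j\<close> of block \<open>i\<close>, for blocks of width \<open>k\<close>;
  the inverse is division with remainder. For \<open>k = 0\<close> both sides are empty.\<close>

lemma bij_betw_blocks: "bij_betw (\<lambda>(i, j). i * k + j) ({..<n} \<times> {..<k}) {..<k * n :: nat}"
proof (rule bij_betwI[where g = "\<lambda>m. (m div k, m mod k)"])
  show "(\<lambda>(i, j). i * k + j) \<in> {..<n} \<times> {..<k} \<rightarrow> {..<k * n}"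
  proof clarsimp
    fix i j assume "i < n" "j < k"
    then have "Suc i * k \<le> n * k" by (intro mult_le_mono1) simp
    then show "i * k + j < k * n" using \<open>j < k\<close> by (simp add: algebra_simps)
  qed
  show "(\<lambda>m. (m div k, m mod k)) \<in> {..<k * n} \<rightarrow> {..<n} \<times> {..<k}"
    by (cases "k = 0") (auto simp: less_mult_imp_div_less mult.commute)
qed auto

text \<open>Followed by the coordinates of \<open>A\<close>, the block projections run exactly once
  through all \<open>k * n\<close> coordinates (\<open>bij_betw_blocks\<close>), so they form a
  product cone by \<open>prod_on_Sigma_cancel\<close>.\<close>

lemma finite_powers_law_powers:
  assumes T: "lawvere_theory T" shows "finite_powers (law_powers T)"
  unfolding finite_powers_def
proof (intro conjI ballI allI)
  note TD = lawvere_theoryD[OF T]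
  let ?X = "pw T 1"
  show "category (law_powers T)" using TD(1) by simp
  fix A assume "A \<in> Ob (law_powers T)"
  then obtain k where A: "A = pw T k" using TD(2) by auto
  have Ak: "is_product T k (\<lambda>_. ?X) A (pr T k)" using TD(5) A by simp
  define P where "P n = Prj (law_powers T) A n" for n
  have P_eq: "P n i = tuple T k (\<lambda>_. ?X) A (pr T k) (pw T (k * n)) (\<lambda>j. pr T (k * n) (i * k + j))" for n i
    by (simp add: P_def law_powers_def T A)
  have lt: "i * k + j < k * n" if "i < n" "j < k" for i j n
    using bij_betwE[OF bij_betw_blocks[of k n], rule_format, of "(i, j)"] that by simp
  have prH: "pr T n i \<in> Hom T (pw T n) ?X" if "i < n" for n i
    using TD(5)[of n] that by (simp add: is_product_def)
  have PH: "P n i \<in> Hom T (pw T (k * n)) A" if "i < n" for n i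
    unfolding P_eq by (rule tuple_hom[OF Ak TD(4)]) (rule prH[OF lt[OF that]])
  have PP: "Cmp T (pw T (k * n)) A ?X (pr T k j) (P n i) = pr T (k * n) (i * k + j)" if "i < n" "j < k" for n i j
    unfolding P_eq by (rule tuple_prj[OF Ak TD(4) _ that(2)]) (rule prH[OF lt[OF that(1)]])
  show "is_product (law_powers T) n (\<lambda>_. A) (Pwr (law_powers T) A n) (Prj (law_powers T) A n)" for n
  proof -
    have "prod_on T ({..<n} \<times> {..<k}) (\<lambda>_. ?X) (pw T (k * n)) (\<lambda>s. pr T (k * n) ((\<lambda>(i, j). i * k + j) s))"
      using prod_on_reindex[OF TD(1) bij_betw_blocks, of "k" "n" "\<lambda>_. ?X"] TD(5)[of "k * n"]
      by (simp add: is_product_iff)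
    then have "prod_on T ({..<n} \<times> {..<k}) (\<lambda>(i, j). ?X) (pw T (k * n))
        (\<lambda>(i, j). Cmp T (pw T (k * n)) A ?X (pr T k j) (P n i))"
      by (rule iffD1[OF prod_on_cong, rotated -1]) (auto simp: PP)
    then have "prod_on T {..<n} (\<lambda>_. A) (pw T (k * n)) (P n)"
      by (intro prod_on_Sigma_cancel[OF TD(1) _ TD(4) PH]) (use Ak in \<open>simp_all add: is_product_iff\<close>)
    then have "is_product T n (\<lambda>_. A) (pw T (k * n)) (P n)" by (simp add: is_product_iff)
    then show ?thesis by (simp add: P_def Pwr_law_powers T A)
  qed
  show "Pwr (law_powers T) A 1 = A" by (simp add: law_powers_def T A)
  \<comment> \<open>With one factor, block 0 consists of all \<open>k\<close> coordinates, and these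
    are the components of the identity.\<close>
  have "P 1 0 = Idn T A"
    unfolding P_eq by (rule tuple_eqI[OF TD(1) Ak])
      (simp_all add: TD(4) cat_id[OF TD(1)] prH cat_id_right[OF TD(1)] A)
  then show "Prj (law_powers T) A 1 0 = Idn (law_powers T) A" by (simp add: P_def)
qed

section \<open>The category of sets and its powers\<close>

lemma SetC_simps [simp]:
  "Ob SetC = UNIV" "Hom SetC X Y = X \<rightarrow>\<^sub>E Y" "Idn SetC X = (\<lambda>x\<in>X. x)" "Cmp SetC X Y Z g f = compose X g f"
  by (simp_all add: SetC_def)

lemma category_SetC: "category SetC"
proof (rule categoryI)
  fix W X Y Z :: "'a set" and f g h
  assume "f \<in> Hom SetC W X"
  then show "Cmp SetC W Y Z h (Cmp SetC W X Y g f) = Cmp SetC W X Z (Cmp SetC X Y Z h g) f"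
    by (auto simp: compose_def fun_eq_iff)
qed (auto simp: compose_def fun_eq_iff PiE_def extensional_def)

text \<open>An infinite type absorbs its own square, so lists of a fixed length are coded by
  iterated pairing, and one more pair records the length.\<close>

lemma ex_inj_list: "\<exists>e :: 'u::infinite list \<Rightarrow> 'u. inj e"
proof -
  have inf: "infinite (UNIV :: 'u set)" by (rule infinite_UNIV)
  obtain p where "bij_betw p (UNIV \<times> UNIV :: ('u \<times> 'u) set) (UNIV :: 'u set)"
    using card_of_Times_same_infinite[OF inf] unfolding card_of_ordIso[symmetric] by blast
  then have "inj p" by (simp add: bij_betw_def)
  then have p: "p (a, b) = p (c, d) \<longleftrightarrow> a = c \<and> b = d" for a b c d
    by (simp add: inj_eq)
  obtain e :: "nat \<Rightarrow> 'u" where e: "inj e"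
    using infinite_countable_subset[OF inf] by blast
  \<comment> \<open>Since \<open>p\<close> is onto, the end marker \<open>e 0\<close> is itself the
    code of a pair. Injectivity of \<open>c\<close> is therefore claimed only among lists of equal
    length.\<close>
  define c where "c xs = rec_list (e 0) (\<lambda>x _ y. p (x, y)) xs" for xs :: "'u list"
  have c: "length xs = length ys \<Longrightarrow> c xs = c ys \<Longrightarrow> xs = ys" for xs ys
    by (induction xs ys rule: list_induct2) (simp_all add: c_def p)
  have "inj (\<lambda>xs. p (e (length xs), c xs))"
    by (rule injI) (use c inj_eq[OF e] in \<open>simp add: p\<close>)
  then show ?thesis by blast
qed

lemma inj_list_code: "inj list_code"
  unfolding list_code_def by (rule someI_ex[OF ex_inj_list])

lemma SetP_simps [simp]:
  "Ob SetP = UNIV" "Hom SetP = Hom SetC" "Idn SetP = Idn SetC" "Cmp SetP = Cmp SetC" "Pwr SetP = set_power"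
  by (simp_all add: SetP_def)

lemma category_SetP [simp]: "category SetP"
  using category_SetC by (simp add: category_def)

lemma is_functor_SetP [simp]: "is_functor C SetP F = is_functor C SetC F"
  by (simp add: is_functor_def)

lemma is_product_SetP [simp]: "is_product SetP = is_product SetC"
  by (simp add: is_product_def fun_eq_iff)

lemma preserves_SetP [simp]: "preserves_finite_products C SetP F = preserves_finite_products C SetC F"
  by (simp add: preserves_finite_products_def)

lemma is_product_1:
  assumes C: "category C" and X: "X \<in> Ob C" and p: "p 0 = Idn C X"
  shows "is_product C 1 (\<lambda>_. X) X p"
  unfolding is_product_iff
proof (rule prod_onI)
  fix W and f :: "nat \<Rightarrow> _" assume "W \<in> Ob C" and f: "\<And>i. i \<in> {..<1} \<Longrightarrow> f i \<in> Hom C W X"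
  then show "\<exists>u\<in>Hom C W X. \<forall>i\<in>{..<1}. Cmp C W X X (p i) u = f i"
    using C X f[of 0] by (auto simp: p cat_rules intro!: bexI[of _ "f 0"])
next
  fix W u v assume "W \<in> Ob C" "u \<in> Hom C W X" "v \<in> Hom C W X"
    and eq: "\<And>i. i \<in> {..<1} \<Longrightarrow> Cmp C W X X (p i) u = Cmp C W X X (p i) v"
  then show "u = v" using C X eq[of 0] by (simp add: p cat_rules)
qed (simp_all add: C X p cat_rules)

text \<open>Away from \<open>n = 1\<close> the elements of the power are codes of lists, and an
  arrow into it codes the list of its component values; injectivity of \<open>list_code\<close>
  gives the projection equations and uniqueness. Arity 1 is separate because there the power is
  \<open>X\<close>, uncoded.\<close>

lemma finite_powers_SetP: "finite_powers SetP"
  unfolding finite_powers_def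
proof (intro conjI ballI allI)
  show "category SetP" by simp
  fix X :: "'a set"
  show one: "Pwr SetP X 1 = X" by (simp add: set_power_def)
  then show prj1: "Prj SetP X 1 0 = Idn SetP X" by (simp add: SetP_def)
  show "is_product SetP n (\<lambda>_. X) (Pwr SetP X n) (Prj SetP X n)" for n
  proof (cases "n = 1")
    case True
    have "is_product SetP 1 (\<lambda>_. X) X (Prj SetP X 1)"
      by (rule is_product_1) (simp_all add: prj1 del: SetC_simps(3))
    then show ?thesis using True one by simp
  next
    case False
    let ?L = "{xs. length xs = n \<and> set xs \<subseteq> X}"
    have P: "Pwr SetP X n = list_code ` ?L" using False by (simp add: set_power_def)
    have prj: "Prj SetP X n i (list_code xs) = xs ! i" if "xs \<in> ?L" for i xs
      using that False P by (simp add: SetP_def inj_list_code)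
    have prj_ext: "Prj SetP X n i \<in> extensional (Pwr SetP X n)" for i
      by (simp add: SetP_def)
    have "prod_on SetP {..<n} (\<lambda>_. X) (Pwr SetP X n) (Prj SetP X n)"
    proof (rule prod_onI)
      show "Prj SetP X n i \<in> Hom SetP (Pwr SetP X n) X" if "i \<in> {..<n}" for i
      proof -
        have "Prj SetP X n i y \<in> X" if y: "y \<in> Pwr SetP X n" for y
        proof -
          obtain xs where xs: "xs \<in> ?L" "y = list_code xs" using y unfolding P by blast
          have "xs ! i \<in> set xs" using xs(1) \<open>i \<in> {..<n}\<close> by auto
          then show ?thesis using xs prj[OF xs(1)] by auto
        qed
        then show ?thesis using prj_ext[of i] by (auto simp: PiE_def)
      qed
      fix W :: "'a set"
      { fix f :: "nat \<Rightarrow> 'a \<Rightarrow> 'a" assume f: "\<And>i. i \<in> {..<n} \<Longrightarrow> f i \<in> Hom SetP W X"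
        define l where "l w = map (\<lambda>i. f i w) [0..<n]" for w
        have l: "l w \<in> ?L" if "w \<in> W" for w
          using f that by (fastforce simp: l_def)
        define u where "u = (\<lambda>w\<in>W. list_code (l w))"
        have u: "u \<in> Hom SetP W (Pwr SetP X n)"
          unfolding P using l by (auto simp: u_def)
        have "Cmp SetP W (Pwr SetP X n) X (Prj SetP X n i) u = f i" if i: "i \<in> {..<n}" for i
        proof
          fix w show "Cmp SetP W (Pwr SetP X n) X (Prj SetP X n i) u w = f i w"
          proof (cases "w \<in> W")
            case True
            then show ?thesis using prj[OF l[OF True]] i by (simp add: u_def compose_def) (simp add: l_def)
          next
            case False
            then show ?thesis using f[OF i] by (auto simp: compose_def)
          qed
        qed
        with u show "\<exists>u\<in>Hom SetP W (Pwr SetP X n). \<forall>i\<in>{..<n}. Cmp SetP W (Pwr SetP X n) X (Prj SetP X n i) u = f i"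
          by blast }
      fix u v assume u: "u \<in> Hom SetP W (Pwr SetP X n)" and v: "v \<in> Hom SetP W (Pwr SetP X n)"
        and eq: "\<And>i. i \<in> {..<n} \<Longrightarrow> Cmp SetP W (Pwr SetP X n) X (Prj SetP X n i) u =
          Cmp SetP W (Pwr SetP X n) X (Prj SetP X n i) v"
      show "u = v"
      proof (rule extensionalityI)
        show "u \<in> extensional W" "v \<in> extensional W" using u v by (auto simp: PiE_def)
        fix w assume w: "w \<in> W"
        have "u w \<in> list_code ` ?L" "v w \<in> list_code ` ?L"
          using u v w unfolding P by auto
        then obtain xs ys where xs: "xs \<in> ?L" "u w = list_code xs" and ys: "ys \<in> ?L" "v w = list_code ys"
          by blast
        have "xs ! i = ys ! i" if "i < n" for i
          using fun_cong[OF eq[of i], of w] that w xs ys by (simp add: compose_def prj)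
        then have "xs = ys" using xs(1) ys(1) by (simp add: list_eq_iff_nth_eq)
        then show "u w = v w" using xs ys by simp
      qed
    qed simp_all
    then show ?thesis unfolding is_product_iff .
  qed
qed

section \<open>Tuples into chosen powers, and substitution\<close>

lemma finite_powersD:
  assumes "finite_powers C"
  shows fp_cat: "category C"
    and fp_product: "X \<in> Ob C \<Longrightarrow> is_product C n (\<lambda>_. X) (Pwr C X n) (Prj C X n)"
    and Pwr_ob: "X \<in> Ob C \<Longrightarrow> Pwr C X n \<in> Ob C"
    and Prj_hom: "X \<in> Ob C \<Longrightarrow> i < n \<Longrightarrow> Prj C X n i \<in> Hom C (Pwr C X n) X"
    and Pwr_1: "X \<in> Ob C \<Longrightarrow> Pwr C X 1 = X"
    and Prj_1: "X \<in> Ob C \<Longrightarrow> Prj C X 1 0 = Idn C X"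
  using assms by (auto simp: finite_powers_def is_product_def)

lemma pow_tuple_hom:
  "finite_powers C \<Longrightarrow> Y \<in> Ob C \<Longrightarrow> W \<in> Ob C \<Longrightarrow> (\<And>i. i < n \<Longrightarrow> f i \<in> Hom C W Y) \<Longrightarrow>
   pow_tuple C n Y W f \<in> Hom C W (Pwr C Y n)"
  unfolding pow_tuple_def by (rule tuple_hom[OF fp_product])

lemma pow_tuple_prj:
  "finite_powers C \<Longrightarrow> Y \<in> Ob C \<Longrightarrow> W \<in> Ob C \<Longrightarrow> (\<And>i. i < n \<Longrightarrow> f i \<in> Hom C W Y) \<Longrightarrow> i < n \<Longrightarrow>
   Cmp C W (Pwr C Y n) Y (Prj C Y n i) (pow_tuple C n Y W f) = f i"
  unfolding pow_tuple_def by (rule tuple_prj[OF fp_product])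

lemma pow_tuple_eqI:
  assumes C: "finite_powers C" and Y: "Y \<in> Ob C" and W: "W \<in> Ob C" and u: "u \<in> Hom C W (Pwr C Y n)"
    and eq: "\<And>i. i < n \<Longrightarrow> Cmp C W (Pwr C Y n) Y (Prj C Y n i) u = f i"
  shows "pow_tuple C n Y W f = u"
  unfolding pow_tuple_def
proof (rule tuple_eqI[OF fp_cat[OF C] fp_product[OF C Y] W u eq])
  fix i assume "i < n"
  then show "f i \<in> Hom C W Y"
    unfolding eq[symmetric, OF \<open>i < n\<close>] by (simp add: cat_comp fp_cat C Y W u Pwr_ob Prj_hom)
qed

lemma pow_tuple_cong: "(\<And>i. i < n \<Longrightarrow> f i = g i) \<Longrightarrow> pow_tuple C n Y W f = pow_tuple C n Y W g"
  unfolding pow_tuple_def by (rule tuple_cong)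

lemma pow_tuple_comp:
  assumes C: "finite_powers C" and ob: "Y \<in> Ob C" "W \<in> Ob C" "V \<in> Ob C"
    and h: "h \<in> Hom C V W" and f: "\<And>i. i < n \<Longrightarrow> f i \<in> Hom C W Y"
  shows "Cmp C V W (Pwr C Y n) (pow_tuple C n Y W f) h = pow_tuple C n Y V (\<lambda>i. Cmp C V W Y (f i) h)"
  by (rule sym, rule pow_tuple_eqI[OF C ob(1,3)])
    (simp_all add: cat_comp fp_cat Pwr_ob ob C h f pow_tuple_hom pow_tuple_prj Prj_hom cat_assoc[OF fp_cat[OF C], symmetric])

lemma pow_tuple_Prj:
  assumes "finite_powers C" "X \<in> Ob C"
  shows "pow_tuple C n X (Pwr C X n) (Prj C X n) = Idn C (Pwr C X n)"
  by (rule pow_tuple_eqI) (simp_all add: assms Pwr_ob Prj_hom fp_cat cat_rules)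

lemma pow_tuple_1:
  assumes "finite_powers C" "Y \<in> Ob C" "W \<in> Ob C" "f 0 \<in> Hom C W Y"
  shows "pow_tuple C 1 Y W f = f 0"
  by (rule pow_tuple_eqI) (simp_all add: assms Pwr_1 Prj_1 fp_cat cat_rules)

text \<open>Substitution in the sense of abstract clones. Calculating with this operation on plain
  families keeps the coend out of the equations.\<close>

definition mcomp ::
  "('o, 'a, 'z) pcat_scheme \<Rightarrow> 'o \<Rightarrow> 'o \<Rightarrow> 'o \<Rightarrow> nat \<Rightarrow> nat \<Rightarrow> 'a \<Rightarrow> (nat \<Rightarrow> 'a) \<Rightarrow> 'a" where
  "mcomp C X Y Z n m g f = Cmp C (Pwr C X n) (Pwr C Y m) Z g (pow_tuple C m Y (Pwr C X n) f)"

lemma mcomp_cong: "(\<And>i. i < m \<Longrightarrow> f i = f' i) \<Longrightarrow> mcomp C X Y Z n m g f = mcomp C X Y Z n m g f'"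
  unfolding mcomp_def by (subst pow_tuple_cong[of m f f']) auto

lemma mcomp_hom:
  "finite_powers C \<Longrightarrow> X \<in> Ob C \<Longrightarrow> Y \<in> Ob C \<Longrightarrow> Z \<in> Ob C \<Longrightarrow> g \<in> Hom C (Pwr C Y m) Z \<Longrightarrow>
   (\<And>i. i < m \<Longrightarrow> f i \<in> Hom C (Pwr C X n) Y) \<Longrightarrow> mcomp C X Y Z n m g f \<in> Hom C (Pwr C X n) Z"
  unfolding mcomp_def by (simp add: cat_comp fp_cat Pwr_ob pow_tuple_hom)

text \<open>Both sides are \<open>g\<close> after the tuple of \<open>f\<close> after the tuple of
  \<open>h\<close>, because tupling commutes with precomposition
  (\<open>pow_tuple_comp\<close>).\<close>

lemma mcomp_assoc:
  assumes C: "finite_powers C" and ob: "W \<in> Ob C" "X \<in> Ob C" "Y \<in> Ob C" "Z \<in> Ob C"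
    and g: "g \<in> Hom C (Pwr C Y m) Z" and f: "\<And>i. i < m \<Longrightarrow> f i \<in> Hom C (Pwr C X k) Y"
    and h: "\<And>j. j < k \<Longrightarrow> h j \<in> Hom C (Pwr C W n) X"
  shows "mcomp C W X Z n k (mcomp C X Y Z k m g f) h = mcomp C W Y Z n m g (\<lambda>i. mcomp C W X Y n k (f i) h)"
  unfolding mcomp_def
  by (simp add: cat_assoc[OF fp_cat[OF C]] pow_tuple_comp C Pwr_ob ob g f h pow_tuple_hom)

lemma mcomp_Prj_left:
  "finite_powers C \<Longrightarrow> X \<in> Ob C \<Longrightarrow> Y \<in> Ob C \<Longrightarrow> (\<And>i. i < m \<Longrightarrow> f i \<in> Hom C (Pwr C X n) Y) \<Longrightarrow> i < m \<Longrightarrow>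
   mcomp C X Y Y n m (Prj C Y m i) f = f i"
  unfolding mcomp_def by (simp add: pow_tuple_prj Pwr_ob)

lemma mcomp_Prj_right:
  "finite_powers C \<Longrightarrow> X \<in> Ob C \<Longrightarrow> Y \<in> Ob C \<Longrightarrow> g \<in> Hom C (Pwr C X n) Y \<Longrightarrow>
   mcomp C X X Y n n g (Prj C X n) = g"
  unfolding mcomp_def by (simp add: pow_tuple_Prj Pwr_ob cat_rules fp_cat)

lemma mcomp_1:
  "finite_powers C \<Longrightarrow> X \<in> Ob C \<Longrightarrow> Y \<in> Ob C \<Longrightarrow> f 0 \<in> Hom C (Pwr C X n) Y \<Longrightarrow>
   mcomp C X Y Z n 1 g f = Cmp C (Pwr C X n) Y Z g (f 0)"
  unfolding mcomp_def by (simp add: pow_tuple_1 Pwr_1 Pwr_ob)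

section \<open>The tensor product\<close>

lemma Fcat_simps [simp]:
  "Ob Fcat = UNIV" "Hom Fcat m n = {..<m} \<rightarrow>\<^sub>E {..<n}" "Idn Fcat n = (\<lambda>i\<in>{..<n}. i)"
  "Cmp Fcat l m n t s = compose {..<l} t s"
  by (simp_all add: Fcat_def)

lemma coend_class_step:
  assumes "(x, y) \<in> coend_step A B n"
  shows "coend_class A B n x = coend_class A B n y"
proof -
  let ?r = "coend_step A B n \<union> (coend_step A B n)\<inverse>"
  have "(x, y) \<in> ?r" "(y, x) \<in> ?r" using assms by auto
  then show ?thesis
    unfolding coend_class_def by (auto intro: converse_rtrancl_into_rtrancl)
qed

lemma coend_class_glide:
  assumes "s \<in> {..<m} \<rightarrow>\<^sub>E {..<m'}" "a \<in> fob A m" "b \<in> {..<m'} \<rightarrow>\<^sub>E fob B n"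
  shows "coend_class A B n (m', far A m m' s a, b) = coend_class A B n (m, a, compose {..<m} b s)"
proof (rule coend_class_step)
  show "((m', far A m m' s a, b), (m, a, compose {..<m} b s)) \<in> coend_step A B n"
    unfolding coend_step_def using assms Fcat_simps(2)[of m m'] by blast
qed

lemma coend_class_in [simp]:
  "a \<in> fob A m \<Longrightarrow> b \<in> {..<m} \<rightarrow>\<^sub>E fob B n \<Longrightarrow> coend_class A B n (m, a, b) \<in> coend A B n"
  by (auto simp: coend_def coend_points_def)

lemma coendE:
  assumes "x \<in> coend A B n"
  obtains m a b where "x = coend_class A B n (m, a, b)" "a \<in> fob A m" "b \<in> {..<m} \<rightarrow>\<^sub>E fob B n"
  using assms by (auto simp: coend_def coend_points_def)

text \<open>A function that is constant along generating steps is constant on the equivalence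
  relation they generate, so its image of a class is a singleton, which \<open>the_elem\<close>
  reads off.\<close>

lemma coend_lift_class:
  assumes f: "\<And>m m' s a b. s \<in> {..<m} \<rightarrow>\<^sub>E {..<m'} \<Longrightarrow> a \<in> fob A m \<Longrightarrow> b \<in> {..<m'} \<rightarrow>\<^sub>E fob B n \<Longrightarrow>
      f m' (far A m m' s a) b = f m a (compose {..<m} b s)"
    and a: "a \<in> fob A m" and b: "b \<in> {..<m} \<rightarrow>\<^sub>E fob B n"
  shows "coend_lift A B n f (coend_class A B n (m, a, b)) = f m a b"
proof -
  let ?g = "\<lambda>(m, a, b). f m a b"
  let ?r = "coend_step A B n \<union> (coend_step A B n)\<inverse>"
  have step: "?g x = ?g y" if "(x, y) \<in> coend_step A B n" for x y
    using that f by (auto simp: coend_step_def)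
  have "?g y = ?g x" if "(x, y) \<in> ?r\<^sup>*" for x y
    using that by induction (auto dest: step)
  then have "?g ` coend_class A B n (m, a, b) = {f m a b}"
    unfolding coend_class_def by (force simp: image_iff)
  then show ?thesis using a b by (simp add: coend_lift_def)
qed

lemma FS_homD:
  assumes "t \<in> FS_hom A B"
  shows "x \<in> fob A n \<Longrightarrow> t n x \<in> fob B n" "t n \<in> extensional (fob A n)"
    "s \<in> {..<m} \<rightarrow>\<^sub>E {..<n} \<Longrightarrow> x \<in> fob A m \<Longrightarrow> t n (far A m n s x) = far B m n s (t m x)"
  using assms by (auto simp: FS_hom_def PiE_def)

lemma FS_homI:
  assumes "\<And>n x. x \<in> fob A n \<Longrightarrow> t n x \<in> fob B n" "\<And>n. t n \<in> extensional (fob A n)"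
    "\<And>m n s x. s \<in> {..<m} \<rightarrow>\<^sub>E {..<n} \<Longrightarrow> x \<in> fob A m \<Longrightarrow> t n (far A m n s x) = far B m n s (t m x)"
  shows "t \<in> FS_hom A B"
  using assms by (auto simp: FS_hom_def PiE_def)

lemma fset_far_in:
  assumes "is_functor Fcat SetC A" "s \<in> {..<m} \<rightarrow>\<^sub>E {..<n}" "x \<in> fob A m"
  shows "far A m n s x \<in> fob A n"
  using functor_ar[OF assms(1), of m n s] assms(2,3) by (auto simp del: PiE_empty_domain)

lemma FS_id_hom: "is_functor Fcat SetC A \<Longrightarrow> FS_id A \<in> FS_hom A A"
  by (rule FS_homI) (simp_all add: FS_id_def fset_far_in)

lemma compose_restrict [simp]: "compose S f (restrict g S) = compose S f g"
  by (simp add: compose_def cong: restrict_cong)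

lemma compose_comp_PiE [simp]: "(\<And>x. x \<in> S \<Longrightarrow> g x \<in> B) \<Longrightarrow> (\<And>x. x \<in> B \<Longrightarrow> f x \<in> E) \<Longrightarrow> compose S f g \<in> S \<rightarrow>\<^sub>E E"
  by (auto simp: compose_def)

lemma FS_tensor_simps [simp]: "fob (FS_tensor A B) = coend A B"
  by (simp add: FS_tensor_def)

lemma FS_unit_simps [simp]:
  "fob FS_unit n = {..<n}" "s \<in> {..<m} \<rightarrow>\<^sub>E {..<n} \<Longrightarrow> far FS_unit m n s = s"
  by (simp_all add: FS_unit_def)

text \<open>Independence of the representative holds because \<open>t\<close> commutes with
  reindexing, while \<open>u n\<close> acts entrywise and so commutes with precomposition by
  \<open>s\<close>.\<close>

lemma FS_tensor_map_class:
  assumes t: "t \<in> FS_hom A A'" and u: "u \<in> FS_hom B B'"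
    and a: "a \<in> fob A m" and b: "b \<in> {..<m} \<rightarrow>\<^sub>E fob B n"
  shows "FS_tensor_map A B A' B' t u n (coend_class A B n (m, a, b)) =
    coend_class A' B' n (m, t m a, compose {..<m} (u n) b)"
  unfolding FS_tensor_map_def
proof (rule coend_lift_class[OF _ a b])
  fix m m' :: nat and s a b assume s: "s \<in> {..<m} \<rightarrow>\<^sub>E {..<m'}" and a: "a \<in> fob A m" and b: "b \<in> {..<m'} \<rightarrow>\<^sub>E fob B n"
  have "coend_class A' B' n (m', far A' m m' s (t m a), compose {..<m'} (u n) b) =
      coend_class A' B' n (m, t m a, compose {..<m} (compose {..<m'} (u n) b) s)"
    using b FS_homD(1)[OF u] by (intro coend_class_glide s FS_homD(1)[OF t] a) (auto simp: compose_def)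
  also have "compose {..<m} (compose {..<m'} (u n) b) s = compose {..<m} (u n) (compose {..<m} b s)"
    using s by (auto simp: compose_def fun_eq_iff)
  finally show "coend_class A' B' n (m', t m' (far A m m' s a), compose {..<m'} (u n) b) =
     coend_class A' B' n (m, t m a, compose {..<m} (u n) (compose {..<m} b s))"
    by (simp add: FS_homD(3)[OF t s a])
qed

lemma FS_tensor_far_class:
  assumes B: "is_functor Fcat SetC B" and s: "s \<in> {..<n} \<rightarrow>\<^sub>E {..<n'}"
    and a: "a \<in> fob A m" and b: "b \<in> {..<m} \<rightarrow>\<^sub>E fob B n"
  shows "far (FS_tensor A B) n n' s (coend_class A B n (m, a, b)) =
    coend_class A B n' (m, a, compose {..<m} (far B n n' s) b)"
proof -
  have u: "far B n n' s x \<in> fob B n'" if "x \<in> fob B n" for x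
    using fset_far_in[OF B s that] .
  have "coend_lift A B n (\<lambda>m a b. coend_class A B n' (m, a, compose {..<m} (far B n n' s) b))
      (coend_class A B n (m, a, b)) = coend_class A B n' (m, a, compose {..<m} (far B n n' s) b)"
  proof (rule coend_lift_class[OF _ a b])
    fix m m' :: nat and r a b assume r: "r \<in> {..<m} \<rightarrow>\<^sub>E {..<m'}" and a: "a \<in> fob A m" and b: "b \<in> {..<m'} \<rightarrow>\<^sub>E fob B n"
    have "coend_class A B n' (m', far A m m' r a, compose {..<m'} (far B n n' s) b) =
        coend_class A B n' (m, a, compose {..<m} (compose {..<m'} (far B n n' s) b) r)"
      by (intro coend_class_glide r a compose_comp_PiE u) (rule PiE_mem[OF b])
    also have "compose {..<m} (compose {..<m'} (far B n n' s) b) r =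
        compose {..<m} (far B n n' s) (compose {..<m} b r)"
      using r by (auto simp: compose_def fun_eq_iff)
    finally show "coend_class A B n' (m', far A m m' r a, compose {..<m'} (far B n n' s) b) =
        coend_class A B n' (m, a, compose {..<m} (far B n n' s) (compose {..<m} b r))" .
  qed
  then show ?thesis using s by (simp add: FS_tensor_def)
qed

text \<open>The associator is a lift of lifts, so independence of representatives arises twice. A
  change of the inner arity \<open>k\<close> slides across the outer coend over \<open>A\<close>; a
  change of the middle arity \<open>m\<close> slides inside every component class over
  \<open>B\<close> and \<open>C\<close>.\<close>

lemma FS_assoc_class:
  assumes B: "is_functor Fcat SetC B"
    and a: "a \<in> fob A k" and b: "b \<in> {..<k} \<rightarrow>\<^sub>E fob B m" and c: "c \<in> {..<m} \<rightarrow>\<^sub>E fob C n"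
  shows "FS_assoc A B C n (coend_class (FS_tensor A B) C n (m, coend_class A B m (k, a, b), c)) =
    coend_class A (FS_tensor B C) n (k, a, \<lambda>i\<in>{..<k}. coend_class B C n (m, b i, c))"
proof -
  let ?h = "\<lambda>m c k a b. coend_class A (FS_tensor B C) n (k, a, \<lambda>i\<in>{..<k}. coend_class B C n (m, b i, c))"
  have inner: "coend_lift A B m (?h m c) (coend_class A B m (k, a, b)) = ?h m c k a b"
    if a: "a \<in> fob A k" and b: "b \<in> {..<k} \<rightarrow>\<^sub>E fob B m" and c: "c \<in> {..<m} \<rightarrow>\<^sub>E fob C n" for m c k a b
  proof (rule coend_lift_class[OF _ a b])
    fix k k' :: nat and s a b assume s: "s \<in> {..<k} \<rightarrow>\<^sub>E {..<k'}" and a: "a \<in> fob A k" and b: "b \<in> {..<k'} \<rightarrow>\<^sub>E fob B m"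
    have "?h m c k' (far A k k' s a) b =
        coend_class A (FS_tensor B C) n (k, a, compose {..<k} (\<lambda>i\<in>{..<k'}. coend_class B C n (m, b i, c)) s)"
      using c by (intro coend_class_glide s a) (auto simp: PiE_mem[OF b])
    also have "compose {..<k} (\<lambda>i\<in>{..<k'}. coend_class B C n (m, b i, c)) s =
        (\<lambda>i\<in>{..<k}. coend_class B C n (m, compose {..<k} b s i, c))"
      using s by (auto simp: compose_def fun_eq_iff)
    finally show "?h m c k' (far A k k' s a) b = ?h m c k a (compose {..<k} b s)" .
  qed
  have "FS_assoc A B C n (coend_class (FS_tensor A B) C n (m, coend_class A B m (k, a, b), c)) =
     coend_lift A B m (?h m c) (coend_class A B m (k, a, b))"
    unfolding FS_assoc_def
  proof (rule coend_lift_class[OF _ _ c])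
    show "coend_class A B m (k, a, b) \<in> fob (FS_tensor A B) m" using a b by simp
    fix m m' :: nat and s x c assume s: "s \<in> {..<m} \<rightarrow>\<^sub>E {..<m'}" and x: "x \<in> fob (FS_tensor A B) m"
      and c: "c \<in> {..<m'} \<rightarrow>\<^sub>E fob C n"
    from x obtain k a b where x: "x = coend_class A B m (k, a, b)" and a: "a \<in> fob A k"
      and b: "b \<in> {..<k} \<rightarrow>\<^sub>E fob B m" by (auto elim: coendE)
    have sb: "compose {..<k} (far B m m' s) b \<in> {..<k} \<rightarrow>\<^sub>E fob B m'"
      by (intro compose_comp_PiE fset_far_in[OF B s]) (rule PiE_mem[OF b])
    have cs: "compose {..<m} c s \<in> {..<m} \<rightarrow>\<^sub>E fob C n"
      by (intro compose_comp_PiE PiE_mem[OF c]) (rule PiE_mem[OF s])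
    \<comment> \<open>The middle index map leaves \<open>B\<close> and precomposes \<open>c\<close>,
      separately in each component \<open>i\<close>; here the coend relation for \<open>B\<close>
      and \<open>C\<close> does the work, not the one for \<open>A\<close>.\<close>
    have "(\<lambda>i\<in>{..<k}. coend_class B C n (m', compose {..<k} (far B m m' s) b i, c)) =
        (\<lambda>i\<in>{..<k}. coend_class B C n (m, b i, compose {..<m} c s))"
      using b by (intro restrict_ext) (auto simp: compose_def intro!: coend_class_glide[OF s _ c, unfolded compose_def])
    then have "?h m' c k a (compose {..<k} (far B m m' s) b) = ?h m (compose {..<m} c s) k a b" by simp
    then show "coend_lift A B m' (?h m' c) (far (FS_tensor A B) m m' s x) =
        coend_lift A B m (?h m (compose {..<m} c s)) x"
      unfolding x FS_tensor_far_class[OF B s a b] inner[OF a sb c] inner[OF a b cs] .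
  qed
  then show ?thesis using inner[OF a b c] by simp
qed

lemma FS_lunit_class:
  assumes "i < m" "b \<in> {..<m} \<rightarrow>\<^sub>E fob A n"
  shows "FS_lunit A n (coend_class FS_unit A n (m, i, b)) = b i"
  unfolding FS_lunit_def
  by (rule coend_lift_class) (use assms in \<open>auto simp: compose_def\<close>)

lemma FS_runit_class:
  assumes A: "is_functor Fcat SetC A" and a: "a \<in> fob A m" and s: "s \<in> {..<m} \<rightarrow>\<^sub>E {..<n}"
  shows "FS_runit A n (coend_class A FS_unit n (m, a, s)) = far A m n s a"
  unfolding FS_runit_def
proof (rule coend_lift_class)
  fix m m' :: nat and s a b assume "s \<in> {..<m} \<rightarrow>\<^sub>E {..<m'}" "a \<in> fob A m" "b \<in> {..<m'} \<rightarrow>\<^sub>E fob FS_unit n"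
  then show "far A m' n b (far A m m' s a) = far A m n (compose {..<m} b s) a"
    using functor_comp[OF A, of m m' n b s] by (simp add: compose_def)
qed (use a s in auto)

section \<open>The enriched category of a category with finite powers\<close>

lemma R_hom_simps [simp]:
  "fob (R_hom C X Y) n = Hom C (Pwr C X n) Y"
  "s \<in> {..<m} \<rightarrow>\<^sub>E {..<n} \<Longrightarrow> f \<in> Hom C (Pwr C X m) Y \<Longrightarrow>
   far (R_hom C X Y) m n s f = mcomp C X X Y n m f (\<lambda>i. Prj C X n (s i))"
  by (simp_all add: R_hom_def mcomp_def)

lemma R_simps [simp]:
  "EOb (R C) = Ob C" "EHom (R C) = R_hom C" "i < n \<Longrightarrow> EId (R C) X n i = Prj C X n i"
  by (simp_all add: R_def)

lemma EId_R: "EId (R C) X n = (\<lambda>i\<in>{..<n}. Prj C X n i)"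
  by (simp add: R_def)

text \<open>Reindexing along \<open>s\<close> is substitution of the projections selected by
  \<open>s\<close>, so functoriality in the arity is associativity of substitution together with its
  two projection laws.\<close>

lemma R_hom_functor:
  assumes C: "finite_powers C" and X: "X \<in> Ob C" and Y: "Y \<in> Ob C"
  shows "is_functor Fcat SetC (R_hom C X Y)"
proof (rule functorI)
  let ?H = "R_hom C X Y"
  have hom: "mcomp C X X Y n m f (\<lambda>i. Prj C X n (s i)) \<in> Hom C (Pwr C X n) Y"
    if "s \<in> {..<m} \<rightarrow>\<^sub>E {..<n}" "f \<in> Hom C (Pwr C X m) Y" for s m n f
    by (rule mcomp_hom[OF C X X Y that(2)]) (use PiE_mem[OF that(1)] Prj_hom[OF C X] in auto)
  fix l m n s t
  show "far (?H) m n \<in> extensional (Hom Fcat m n)"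
    by (simp add: R_hom_def)
  show "far (?H) m n s \<in> Hom SetC (fob (?H) m) (fob (?H) n)"
    if s: "s \<in> Hom Fcat m n"
  proof -
    have "far (?H) m n s f \<in> Hom C (Pwr C X n) Y" if "f \<in> Hom C (Pwr C X m) Y" for f
      using s that hom by simp
    moreover have "far (?H) m n s \<in> extensional (Hom C (Pwr C X m) Y)"
      using s by (simp add: R_hom_def)
    ultimately show ?thesis by (simp add: PiE_iff)
  qed
  show "far (?H) n n (Idn Fcat n) = Idn SetC (fob (?H) n)"
  proof -
    have "mcomp C X X Y n n f (\<lambda>i. Prj C X n (restrict (\<lambda>i. i) {..<n} i)) = f" if "f \<in> Hom C (Pwr C X n) Y" for f
    proof -
      have "mcomp C X X Y n n f (\<lambda>i. Prj C X n (restrict (\<lambda>i. i) {..<n} i)) = mcomp C X X Y n n f (Prj C X n)"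
        by (rule mcomp_cong) simp
      then show ?thesis using mcomp_Prj_right[OF C X Y that] by simp
    qed
    then show ?thesis
      by (simp add: R_hom_def mcomp_def[symmetric] cong: restrict_cong)
  qed
  assume t: "t \<in> Hom Fcat m n" and s: "s \<in> Hom Fcat l m"
  have st: "compose {..<l} t s \<in> {..<l} \<rightarrow>\<^sub>E {..<n}"
    by (rule compose_comp_PiE[of _ _ "{..<m}"]) (use s t in \<open>auto dest: PiE_mem\<close>)
  show "far (?H) l n (Cmp Fcat l m n t s) =
     Cmp SetC (fob (?H) l) (fob (?H) m) (fob (?H) n)
       (far (?H) m n t) (far (?H) l m s)"
  proof (rule extensionalityI)
    show "far (?H) l n (Cmp Fcat l m n t s) \<in> extensional (Hom C (Pwr C X l) Y)"
      using st by (simp add: R_hom_def)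
    show "Cmp SetC (fob (?H) l) (fob (?H) m) (fob (?H) n)
       (far (?H) m n t) (far (?H) l m s) \<in> extensional (Hom C (Pwr C X l) Y)"
      by (simp add: compose_def)
    fix f assume f: "f \<in> Hom C (Pwr C X l) Y"
    have ti: "t i < n" if "i < m" for i using t that by (auto dest: PiE_mem)
    have si: "s i < m" if "i < l" for i using s that by (auto dest: PiE_mem)
    have "mcomp C X X Y n m (mcomp C X X Y m l f (\<lambda>i. Prj C X m (s i))) (\<lambda>i. Prj C X n (t i)) =
        mcomp C X X Y n l f (\<lambda>i. mcomp C X X X n m (Prj C X m (s i)) (\<lambda>i. Prj C X n (t i)))"
      by (rule mcomp_assoc[OF C X X X Y f]) (simp_all add: Prj_hom[OF C X] si ti)
    also have "\<dots> = mcomp C X X Y n l f (\<lambda>i. Prj C X n (compose {..<l} t s i))"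
      by (rule mcomp_cong) (simp add: mcomp_Prj_left C X Prj_hom si ti compose_def)
    finally show "far (?H) l n (Cmp Fcat l m n t s) f =
      Cmp SetC (fob (?H) l) (fob (?H) m) (fob (?H) n)
       (far (?H) m n t) (far (?H) l m s) f"
      using s t st f hom[of s l m f] by (simp add: compose_eq)
  qed
qed (simp_all add: R_hom_def)

text \<open>Enriched composition evaluated on a representative. Points of the coend require families
  that are \<open>undefined\<close> outside \<open>{..<m}\<close>; the \<open>restrict\<close>
  allows arbitrary functions as arguments and makes only their values below \<open>m\<close>
  count.\<close>

definition ecomp :: "('o, 'a) ecat \<Rightarrow> 'o \<Rightarrow> 'o \<Rightarrow> 'o \<Rightarrow> nat \<Rightarrow> nat \<Rightarrow> 'a \<Rightarrow> (nat \<Rightarrow> 'a) \<Rightarrow> 'a" where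
  "ecomp M X Y Z n m g f =
     EComp M X Y Z n (coend_class (EHom M Y Z) (EHom M X Y) n (m, g, restrict f {..<m}))"

lemma EComp_class:
  "f \<in> {..<m} \<rightarrow>\<^sub>E A \<Longrightarrow>
   EComp M X Y Z n (coend_class (EHom M Y Z) (EHom M X Y) n (m, g, f)) = ecomp M X Y Z n m g f"
  by (simp add: ecomp_def PiE_restrict)

text \<open>Substitution respects the coend relation: putting \<open>f\<close> into the projections
  selected by \<open>s\<close> gives back the family \<open>f\<close> reindexed by
  \<open>s\<close>.\<close>

lemma EComp_R_class:
  assumes C: "finite_powers C" and ob: "X \<in> Ob C" "Y \<in> Ob C" "Z \<in> Ob C"
    and g: "g \<in> Hom C (Pwr C Y m) Z" and f: "f \<in> {..<m} \<rightarrow>\<^sub>E Hom C (Pwr C X n) Y"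
  shows "EComp (R C) X Y Z n (coend_class (R_hom C Y Z) (R_hom C X Y) n (m, g, f)) = mcomp C X Y Z n m g f"
proof -
  let ?H = "R_hom C"
  have "coend_lift (?H Y Z) (?H X Y) n (mcomp C X Y Z n)
      (coend_class (?H Y Z) (?H X Y) n (m, g, f)) = mcomp C X Y Z n m g f"
  proof (rule coend_lift_class)
    fix m m' :: nat and s g f
    assume s: "s \<in> {..<m} \<rightarrow>\<^sub>E {..<m'}" and "g \<in> fob (?H Y Z) m" "f \<in> {..<m'} \<rightarrow>\<^sub>E fob (?H X Y) n"
    then have g: "g \<in> Hom C (Pwr C Y m) Z" and f: "f \<in> {..<m'} \<rightarrow>\<^sub>E Hom C (Pwr C X n) Y" by simp_all
    have si: "s i < m'" if "i < m" for i using PiE_mem[OF s] that by simp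
    have fi: "f i \<in> Hom C (Pwr C X n) Y" if "i < m'" for i using PiE_mem[OF f] that by simp
    have "mcomp C X Y Z n m' (mcomp C Y Y Z m' m g (\<lambda>i. Prj C Y m' (s i))) f =
        mcomp C X Y Z n m g (\<lambda>i. mcomp C X Y Y n m' (Prj C Y m' (s i)) f)"
      by (rule mcomp_assoc[OF C ob(1,2,2,3) g]) (simp_all add: Prj_hom C ob si fi)
    also have "\<dots> = mcomp C X Y Z n m g (compose {..<m} f s)"
      by (rule mcomp_cong) (simp add: compose_eq mcomp_Prj_left C ob si fi)
    finally show "mcomp C X Y Z n m' (far (?H Y Z) m m' s g) f = mcomp C X Y Z n m g (compose {..<m} f s)"
      using s g by simp
  qed (use f g in simp_all)
  then show ?thesis by (simp add: R_def mcomp_def[abs_def])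
qed

lemma ecomp_R:
  assumes C: "finite_powers C" and ob: "X \<in> Ob C" "Y \<in> Ob C" "Z \<in> Ob C"
    and g: "g \<in> Hom C (Pwr C Y m) Z" and f: "\<And>i. i < m \<Longrightarrow> f i \<in> Hom C (Pwr C X n) Y"
  shows "ecomp (R C) X Y Z n m g f = mcomp C X Y Z n m g f"
proof -
  have "ecomp (R C) X Y Z n m g f = mcomp C X Y Z n m g (restrict f {..<m})"
    unfolding ecomp_def R_simps by (rule EComp_R_class[OF C ob g]) (simp add: f)
  also have "\<dots> = mcomp C X Y Z n m g f" by (rule mcomp_cong) simp
  finally show ?thesis .
qed

lemma EId_R_hom:
  assumes C: "finite_powers C" and X: "X \<in> Ob C"
  shows "EId (R C) X \<in> FS_hom FS_unit (EHom (R C) X X)"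
proof (rule FS_homI)
  fix m n :: nat and s x assume s: "s \<in> {..<m} \<rightarrow>\<^sub>E {..<n}" and "x \<in> fob FS_unit m"
  then have x: "x < m" by simp
  have si: "s i < n" if "i < m" for i using PiE_mem[OF s] that by simp
  show "EId (R C) X n (far FS_unit m n s x) = far (EHom (R C) X X) m n s (EId (R C) X m x)"
    using s x by (simp add: si Prj_hom C X mcomp_Prj_left)
qed (simp_all add: Prj_hom C X EId_R)

text \<open>Naturality in the arity \<open>n\<close> is again associativity of substitution, now
  with projections as the innermost arguments.\<close>

lemma EComp_R_hom:
  assumes C: "finite_powers C" and ob: "X \<in> Ob C" "Y \<in> Ob C" "Z \<in> Ob C"
  shows "EComp (R C) X Y Z \<in> FS_hom (FS_tensor (R_hom C Y Z) (R_hom C X Y)) (R_hom C X Z)"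
proof (rule FS_homI)
  let ?H = "R_hom C"
  show "EComp (R C) X Y Z n \<in> extensional (fob (FS_tensor (?H Y Z) (?H X Y)) n)" for n
    by (simp add: R_def coend_lift_def)
  show "EComp (R C) X Y Z n x \<in> fob (?H X Z) n"
    if "x \<in> fob (FS_tensor (?H Y Z) (?H X Y)) n" for n x
  proof -
    from that obtain m g f where x: "x = coend_class (?H Y Z) (?H X Y) n (m, g, f)"
      and g: "g \<in> Hom C (Pwr C Y m) Z" and f: "f \<in> {..<m} \<rightarrow>\<^sub>E Hom C (Pwr C X n) Y"
      by (auto elim: coendE)
    show ?thesis unfolding x EComp_R_class[OF C ob g f] R_hom_simps
      by (rule mcomp_hom[OF C ob g]) (rule PiE_mem[OF f], simp)
  qed
  fix n n' :: nat and s x assume s: "s \<in> {..<n} \<rightarrow>\<^sub>E {..<n'}"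
    and "x \<in> fob (FS_tensor (?H Y Z) (?H X Y)) n"
  then obtain m g f where x: "x = coend_class (?H Y Z) (?H X Y) n (m, g, f)"
    and g: "g \<in> Hom C (Pwr C Y m) Z" and f: "f \<in> {..<m} \<rightarrow>\<^sub>E Hom C (Pwr C X n) Y"
    by (auto elim: coendE)
  have si: "s i < n'" if "i < n" for i using PiE_mem[OF s] that by simp
  have fi: "f i \<in> Hom C (Pwr C X n) Y" if "i < m" for i using PiE_mem[OF f] that by simp
  have gf: "mcomp C X Y Z n m g f \<in> Hom C (Pwr C X n) Z" by (rule mcomp_hom[OF C ob g fi])
  let ?sf = "compose {..<m} (far (?H X Y) n n' s) f"
  have sf: "?sf \<in> {..<m} \<rightarrow>\<^sub>E Hom C (Pwr C X n') Y"
    using fset_far_in[OF R_hom_functor[OF C ob(1,2)] s] fi by (intro compose_comp_PiE[of _ _ "Hom C (Pwr C X n) Y"]) auto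
  have "EComp (R C) X Y Z n' (far (FS_tensor (?H Y Z) (?H X Y)) n n' s x) =
      EComp (R C) X Y Z n' (coend_class (?H Y Z) (?H X Y) n' (m, g, ?sf))"
    unfolding x using g f by (subst FS_tensor_far_class[OF R_hom_functor[OF C ob(1,2)] s]) simp_all
  also have "\<dots> = mcomp C X Y Z n' m g ?sf"
    by (rule EComp_R_class[OF C ob g sf])
  also have "\<dots> = mcomp C X Y Z n' m g (\<lambda>i. mcomp C X X Y n' n (f i) (\<lambda>i. Prj C X n' (s i)))"
    by (rule mcomp_cong) (simp add: compose_eq s fi)
  also have "\<dots> = mcomp C X X Z n' n (mcomp C X Y Z n m g f) (\<lambda>i. Prj C X n' (s i))"
    by (rule mcomp_assoc[OF C ob(1,1,2,3) g, symmetric]) (simp_all add: fi si Prj_hom C ob)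
  also have "\<dots> = far (?H X Z) n n' s (EComp (R C) X Y Z n x)"
    unfolding x EComp_R_class[OF C ob g f] using s gf by simp
  finally show "EComp (R C) X Y Z n' (far (FS_tensor (?H Y Z) (?H X Y)) n n' s x) =
    far (?H X Z) n n' s (EComp (R C) X Y Z n x)" .
qed

lemma compose_FS_id: "f \<in> S \<rightarrow>\<^sub>E fob A n \<Longrightarrow> compose S (FS_id A n) f = f"
  by (rule extensionalityI[of _ S]) (auto simp: compose_def FS_id_def PiE_iff)

lemma FS_id_apply: "x \<in> fob A n \<Longrightarrow> FS_id A n x = x"
  by (simp add: FS_id_def)

text \<open>On representatives the diagrams become clone laws: associativity is
  \<open>mcomp_assoc\<close>, the left unit law says that a projection selects an argument, and the
  right unit law is the description of reindexing as substitution of projections.\<close>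

lemma enriched_category_R:
  assumes C: "finite_powers C" shows "enriched_category (R C)"
  unfolding enriched_category_def R_simps
proof (intro conjI ballI allI)
  let ?H = "R_hom C" and ?comp = "EComp (R C)"
  note Rf = R_hom_functor[OF C]
  note Id_hom = FS_id_hom[OF Rf]
  note Comp_hom = EComp_R_hom[OF C]
  fix X Y assume X: "X \<in> Ob C" and Y: "Y \<in> Ob C"
  show "is_functor Fcat SetC (?H X Y)" by (rule Rf[OF X Y])
  show "EId (R C) X \<in> FS_hom FS_unit (?H X X)" using EId_R_hom[OF C X] by simp
  have EId_hom: "EId (R C) X \<in> FS_hom FS_unit (?H X X)" if "X \<in> Ob C" for X
    using EId_R_hom[OF C that] by simp
  { fix n x assume "x \<in> fob (FS_tensor FS_unit (?H X Y)) n"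
    then obtain m i f where x: "x = coend_class FS_unit (?H X Y) n (m, i, f)"
      and i: "i < m" and f: "f \<in> {..<m} \<rightarrow>\<^sub>E Hom C (Pwr C X n) Y"
      by (auto elim: coendE)
    have fi: "f i \<in> Hom C (Pwr C X n) Y" if "i < m" for i using PiE_mem[OF f] that by simp
    have "FS_tensor_map FS_unit (?H X Y) (?H Y Y) (?H X Y) (EId (R C) Y) (FS_id (?H X Y)) n x =
        coend_class (?H Y Y) (?H X Y) n (m, Prj C Y m i, f)"
      unfolding x using i f by (simp add: FS_tensor_map_class[OF EId_hom[OF Y] Id_hom[OF X Y]] compose_FS_id)
    moreover have "FS_lunit (?H X Y) n x = f i"
      unfolding x using i f by (intro FS_lunit_class) simp_all
    ultimately show "?comp X Y Y n (FS_tensor_map FS_unit (?H X Y) (?H Y Y) (?H X Y)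
        (EId (R C) Y) (FS_id (?H X Y)) n x) = FS_lunit (?H X Y) n x"
      using i fi by (simp add: EComp_R_class[OF C X Y Y _ f] Prj_hom C X Y mcomp_Prj_left) }
  { fix n x assume "x \<in> fob (FS_tensor (?H X Y) FS_unit) n"
    then obtain m f s where x: "x = coend_class (?H X Y) FS_unit n (m, f, s)"
      and f: "f \<in> Hom C (Pwr C X m) Y" and s: "s \<in> {..<m} \<rightarrow>\<^sub>E {..<n}"
      by (auto elim: coendE)
    have si: "s i < n" if "i < m" for i using PiE_mem[OF s] that by simp
    let ?p = "compose {..<m} (EId (R C) X n) s"
    have p: "?p i = Prj C X n (s i)" if "i < m" for i using that si by (simp add: compose_eq)
    have pP: "?p \<in> {..<m} \<rightarrow>\<^sub>E Hom C (Pwr C X n) X"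
      by (rule compose_comp_PiE[of _ _ "{..<n}"]) (simp_all add: si Prj_hom C X)
    have "FS_tensor_map (?H X Y) FS_unit (?H X Y) (?H X X) (FS_id (?H X Y)) (EId (R C) X) n x =
        coend_class (?H X Y) (?H X X) n (m, f, ?p)"
      unfolding x using f s by (simp add: FS_tensor_map_class[OF Id_hom[OF X Y] EId_hom[OF X]] FS_id_apply)
    moreover have "FS_runit (?H X Y) n x = far (?H X Y) m n s f"
      unfolding x using f s by (intro FS_runit_class[OF Rf[OF X Y]]) simp_all
    moreover have "mcomp C X X Y n m f ?p = mcomp C X X Y n m f (\<lambda>i. Prj C X n (s i))"
      by (rule mcomp_cong) (rule p)
    ultimately show "?comp X X Y n (FS_tensor_map (?H X Y) FS_unit (?H X Y) (?H X X)
        (FS_id (?H X Y)) (EId (R C) X) n x) = FS_runit (?H X Y) n x"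
      using s f by (simp add: EComp_R_class[OF C X X Y f pP]) }
  fix Z assume Z: "Z \<in> Ob C"
  show "?comp X Y Z \<in> FS_hom (FS_tensor (?H Y Z) (?H X Y)) (?H X Z)"
    by (rule Comp_hom[OF X Y Z])
next
  let ?H = "R_hom C" and ?comp = "EComp (R C)"
  note Rf = R_hom_functor[OF C]
  note Id_hom = FS_id_hom[OF Rf]
  note Comp_hom = EComp_R_hom[OF C]
  fix W X Y Z n x assume W: "W \<in> Ob C" and X: "X \<in> Ob C" and Y: "Y \<in> Ob C" and Z: "Z \<in> Ob C"
    and "x \<in> fob (FS_tensor (FS_tensor (?H Y Z) (?H X Y)) (?H W X)) n"
  then obtain m y h where x: "x = coend_class (FS_tensor (?H Y Z) (?H X Y)) (?H W X) n (m, y, h)"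
    and y0: "y \<in> coend (?H Y Z) (?H X Y) m" and h: "h \<in> {..<m} \<rightarrow>\<^sub>E Hom C (Pwr C W n) X"
    by (auto elim: coendE)
  from y0 obtain k g f where y: "y = coend_class (?H Y Z) (?H X Y) m (k, g, f)"
    and g: "g \<in> Hom C (Pwr C Y k) Z" and f: "f \<in> {..<k} \<rightarrow>\<^sub>E Hom C (Pwr C X m) Y"
    by (auto elim: coendE)
  have hi: "h i \<in> Hom C (Pwr C W n) X" if "i < m" for i using PiE_mem[OF h] that by simp
  have fi: "f i \<in> Hom C (Pwr C X m) Y" if "i < k" for i using PiE_mem[OF f] that by simp
  have gf: "mcomp C X Y Z m k g f \<in> Hom C (Pwr C X m) Z" by (rule mcomp_hom[OF C X Y Z g fi])
  have "?comp W X Z n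
      (FS_tensor_map (FS_tensor (?H Y Z) (?H X Y)) (?H W X) (?H X Z) (?H W X)
         (?comp X Y Z) (FS_id (?H W X)) n x) =
      ?comp W X Z n (coend_class (?H X Z) (?H W X) n (m, mcomp C X Y Z m k g f, h))"
    unfolding x using y0 h
    by (simp add: FS_tensor_map_class[OF Comp_hom[OF X Y Z] Id_hom[OF W X]] compose_FS_id)
      (simp add: y EComp_R_class[OF C X Y Z g f])
  also have "\<dots> = mcomp C W X Z n m (mcomp C X Y Z m k g f) h"
    by (rule EComp_R_class[OF C W X Z gf h])
  also have "\<dots> = mcomp C W Y Z n k g (\<lambda>i. mcomp C W X Y n m (f i) h)"
    by (rule mcomp_assoc[OF C W X Y Z g fi hi])
  finally have lhs: "?comp W X Z n
      (FS_tensor_map (FS_tensor (?H Y Z) (?H X Y)) (?H W X) (?H X Z) (?H W X)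
         (?comp X Y Z) (FS_id (?H W X)) n x) = mcomp C W Y Z n k g (\<lambda>i. mcomp C W X Y n m (f i) h)" .
  let ?fh = "\<lambda>i\<in>{..<k}. coend_class (?H X Y) (?H W X) n (m, f i, h)"
  have fh: "?fh \<in> {..<k} \<rightarrow>\<^sub>E coend (?H X Y) (?H W X) n"
    using h by (simp add: fi)
  let ?c = "compose {..<k} (?comp W X Y n) ?fh"
  have ci: "?c i = mcomp C W X Y n m (f i) h" if "i < k" for i
    using that by (simp add: compose_eq EComp_R_class[OF C W X Y fi h])
  have c: "?c \<in> {..<k} \<rightarrow>\<^sub>E Hom C (Pwr C W n) Y"
  proof (rule PiE_I)
    show "?c i \<in> Hom C (Pwr C W n) Y" if "i \<in> {..<k}" for i
      using that mcomp_hom[OF C W X Y fi hi, of i] by (simp add: ci del: compose_restrict)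
  qed (simp add: compose_def)
  \<comment> \<open>The associator hands the common family \<open>h\<close> to every component of
    \<open>f\<close>, which is the shape of the right-hand side of
    \<open>mcomp_assoc\<close>.\<close>
  have "FS_assoc (?H Y Z) (?H X Y) (?H W X) n x =
      coend_class (?H Y Z) (FS_tensor (?H X Y) (?H W X)) n (k, g, ?fh)"
    unfolding x y using g f h by (intro FS_assoc_class[OF Rf[OF X Y]]) simp_all
  then have "FS_tensor_map (?H Y Z) (FS_tensor (?H X Y) (?H W X)) (?H Y Z) (?H W Y)
         (FS_id (?H Y Z)) (?comp W X Y) n (FS_assoc (?H Y Z) (?H X Y) (?H W X) n x) =
      coend_class (?H Y Z) (?H W Y) n (k, g, ?c)"
    using g fh by (simp add: FS_tensor_map_class[OF Id_hom[OF Y Z] Comp_hom[OF W X Y]] FS_id_apply del: compose_restrict)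
  then have "?comp W Y Z n (FS_tensor_map (?H Y Z) (FS_tensor (?H X Y) (?H W X)) (?H Y Z) (?H W Y)
         (FS_id (?H Y Z)) (?comp W X Y) n (FS_assoc (?H Y Z) (?H X Y) (?H W X) n x)) =
      mcomp C W Y Z n k g ?c"
    using EComp_R_class[OF C W Y Z g c] by simp
  also have "\<dots> = mcomp C W Y Z n k g (\<lambda>i. mcomp C W X Y n m (f i) h)"
    by (rule mcomp_cong) (rule ci)
  finally show "?comp W X Z n
      (FS_tensor_map (FS_tensor (?H Y Z) (?H X Y)) (?H W X) (?H X Z) (?H W X)
         (?comp X Y Z) (FS_id (?H W X)) n x) =
    ?comp W Y Z n (FS_tensor_map (?H Y Z) (FS_tensor (?H X Y) (?H W X)) (?H Y Z) (?H W Y)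
         (FS_id (?H Y Z)) (?comp W X Y) n (FS_assoc (?H Y Z) (?H X Y) (?H W X) n x))"
    unfolding lhs by (rule sym)
qed

section \<open>Enriched functors and transformations\<close>

lemma efunc_eqI: "eob G = eob H \<Longrightarrow> ear G = ear H \<Longrightarrow> G = (H :: ('o, 'a, 'p, 'b) efunc)"
  by simp

lemma enriched_functorD:
  assumes "enriched_functor M N G"
  shows efunctor_ob: "X \<in> EOb M \<Longrightarrow> eob G X \<in> EOb N"
    and efunctor_hom: "X \<in> EOb M \<Longrightarrow> Y \<in> EOb M \<Longrightarrow> ear G X Y \<in> FS_hom (EHom M X Y) (EHom N (eob G X) (eob G Y))"
    and efunctor_id: "X \<in> EOb M \<Longrightarrow> i < n \<Longrightarrow> ear G X X n (EId M X n i) = EId N (eob G X) n i"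
  using assms unfolding enriched_functor_def by (auto simp: PiE_iff)

lemma efunctor_ar:
  "enriched_functor M N G \<Longrightarrow> X \<in> EOb M \<Longrightarrow> Y \<in> EOb M \<Longrightarrow> f \<in> fob (EHom M X Y) n \<Longrightarrow>
   ear G X Y n f \<in> fob (EHom N (eob G X) (eob G Y)) n"
  by (rule FS_homD(1)[OF efunctor_hom])

lemma efunctor_ext:
  assumes "enriched_functor M N G"
  shows "eob G \<in> extensional (EOb M)" "ear G \<in> extensional (EOb M)"
    "X \<in> EOb M \<Longrightarrow> ear G X \<in> extensional (EOb M)"
  using assms unfolding enriched_functor_def by (auto simp: PiE_iff)

lemma efunctor_eqI:
  assumes G: "enriched_functor M N G" and H: "enriched_functor M N' H"
    and ob: "\<And>X. X \<in> EOb M \<Longrightarrow> eob G X = eob H X"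
    and ar: "\<And>X Y n f. X \<in> EOb M \<Longrightarrow> Y \<in> EOb M \<Longrightarrow> f \<in> fob (EHom M X Y) n \<Longrightarrow> ear G X Y n f = ear H X Y n f"
  shows "G = H"
proof (rule efunc_eqI)
  show "eob G = eob H"
    using efunctor_ext(1)[OF G] efunctor_ext(1)[OF H] ob by (rule extensionalityI)
  show "ear G = ear H"
  proof (rule extensionalityI[OF efunctor_ext(2)[OF G] efunctor_ext(2)[OF H]])
    fix X assume X: "X \<in> EOb M"
    show "ear G X = ear H X"
    proof (rule extensionalityI[OF efunctor_ext(3)[OF G X] efunctor_ext(3)[OF H X]])
      fix Y assume Y: "Y \<in> EOb M"
      show "ear G X Y = ear H X Y"
      proof
        fix n show "ear G X Y n = ear H X Y n"
          by (rule extensionalityI[OF FS_homD(2)[OF efunctor_hom[OF G X Y]] FS_homD(2)[OF efunctor_hom[OF H X Y]]])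
            (rule ar[OF X Y])
      qed
    qed
  qed
qed

lemma efunctor_tensor_map:
  assumes "ear G Y Z \<in> FS_hom (EHom M Y Z) (EHom N (eob G Y) (eob G Z))"
    and "ear G X Y \<in> FS_hom (EHom M X Y) (EHom N (eob G X) (eob G Y))"
    and "g \<in> fob (EHom M Y Z) m" "\<And>i. i < m \<Longrightarrow> f i \<in> fob (EHom M X Y) n"
  shows "EComp N (eob G X) (eob G Y) (eob G Z) n
     (FS_tensor_map (EHom M Y Z) (EHom M X Y) (EHom N (eob G Y) (eob G Z)) (EHom N (eob G X) (eob G Y))
       (ear G Y Z) (ear G X Y) n (coend_class (EHom M Y Z) (EHom M X Y) n (m, g, restrict f {..<m}))) =
     ecomp N (eob G X) (eob G Y) (eob G Z) n m (ear G Y Z m g) (\<lambda>i. ear G X Y n (f i))"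
proof -
  have "restrict f {..<m} \<in> {..<m} \<rightarrow>\<^sub>E fob (EHom M X Y) n" using assms(4) by simp
  then show ?thesis
    by (subst FS_tensor_map_class[OF assms(1-3)]) (simp_all add: ecomp_def compose_def cong: restrict_cong)
qed

lemma efunctor_comp:
  assumes G: "enriched_functor M N G" and ob: "X \<in> EOb M" "Y \<in> EOb M" "Z \<in> EOb M"
    and g: "g \<in> fob (EHom M Y Z) m" and f: "\<And>i. i < m \<Longrightarrow> f i \<in> fob (EHom M X Y) n"
  shows "ear G X Z n (ecomp M X Y Z n m g f) =
    ecomp N (eob G X) (eob G Y) (eob G Z) n m (ear G Y Z m g) (\<lambda>i. ear G X Y n (f i))"
proof -
  have "coend_class (EHom M Y Z) (EHom M X Y) n (m, g, restrict f {..<m}) \<in> fob (FS_tensor (EHom M Y Z) (EHom M X Y)) n"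
    using g f by simp
  then have "ear G X Z n (ecomp M X Y Z n m g f) = EComp N (eob G X) (eob G Y) (eob G Z) n
     (FS_tensor_map (EHom M Y Z) (EHom M X Y) (EHom N (eob G Y) (eob G Z)) (EHom N (eob G X) (eob G Y))
       (ear G Y Z) (ear G X Y) n (coend_class (EHom M Y Z) (EHom M X Y) n (m, g, restrict f {..<m})))"
    using G ob unfolding ecomp_def enriched_functor_def by simp
  then show ?thesis
    by (simp add: efunctor_tensor_map[OF efunctor_hom[OF G ob(2,3)] efunctor_hom[OF G ob(1,2)] g f])
qed

text \<open>Every element of the tensor is the class of some triple, so preservation of composition
  has to be tested only on the operations \<open>ecomp\<close>.\<close>

lemma enriched_functorI:
  assumes "eob G \<in> extensional (EOb M)" "ear G \<in> extensional (EOb M)"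
    and "\<And>X. X \<in> EOb M \<Longrightarrow> ear G X \<in> extensional (EOb M)"
    and "\<And>X. X \<in> EOb M \<Longrightarrow> eob G X \<in> EOb N"
    and hom: "\<And>X Y. X \<in> EOb M \<Longrightarrow> Y \<in> EOb M \<Longrightarrow> ear G X Y \<in> FS_hom (EHom M X Y) (EHom N (eob G X) (eob G Y))"
    and "\<And>X n i. X \<in> EOb M \<Longrightarrow> i < n \<Longrightarrow> ear G X X n (EId M X n i) = EId N (eob G X) n i"
    and comp: "\<And>X Y Z n m g f. X \<in> EOb M \<Longrightarrow> Y \<in> EOb M \<Longrightarrow> Z \<in> EOb M \<Longrightarrow>
      g \<in> fob (EHom M Y Z) m \<Longrightarrow> (\<And>i. i < m \<Longrightarrow> f i \<in> fob (EHom M X Y) n) \<Longrightarrow>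
      ear G X Z n (ecomp M X Y Z n m g f) =
      ecomp N (eob G X) (eob G Y) (eob G Z) n m (ear G Y Z m g) (\<lambda>i. ear G X Y n (f i))"
  shows "enriched_functor M N G"
  unfolding enriched_functor_def
proof (intro conjI ballI allI impI)
  show "eob G \<in> EOb M \<rightarrow>\<^sub>E EOb N" using assms by (simp add: PiE_iff)
  show "ear G \<in> (\<Pi>\<^sub>E X\<in>EOb M. \<Pi>\<^sub>E Y\<in>EOb M. FS_hom (EHom M X Y) (EHom N (eob G X) (eob G Y)))"
    using assms by (simp add: PiE_iff)
  fix X Y Z n x assume ob: "X \<in> EOb M" "Y \<in> EOb M" "Z \<in> EOb M"
    and "x \<in> fob (FS_tensor (EHom M Y Z) (EHom M X Y)) n"
  then obtain m g f where x: "x = coend_class (EHom M Y Z) (EHom M X Y) n (m, g, f)"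
    and g: "g \<in> fob (EHom M Y Z) m" and f: "f \<in> {..<m} \<rightarrow>\<^sub>E fob (EHom M X Y) n"
    by (auto elim: coendE)
  have fi: "f i \<in> fob (EHom M X Y) n" if "i < m" for i using PiE_mem[OF f] that by simp
  have "EComp N (eob G X) (eob G Y) (eob G Z) n
     (FS_tensor_map (EHom M Y Z) (EHom M X Y) (EHom N (eob G Y) (eob G Z)) (EHom N (eob G X) (eob G Y))
       (ear G Y Z) (ear G X Y) n (coend_class (EHom M Y Z) (EHom M X Y) n (m, g, restrict f {..<m}))) =
     ecomp N (eob G X) (eob G Y) (eob G Z) n m (ear G Y Z m g) (\<lambda>i. ear G X Y n (f i))"
    by (rule efunctor_tensor_map[OF hom[OF ob(2,3)] hom[OF ob(1,2)] g fi])
  also have "\<dots> = ear G X Z n (ecomp M X Y Z n m g f)" by (rule comp[OF ob g fi, symmetric])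
  finally show "ear G X Z n (EComp M X Y Z n x) = EComp N (eob G X) (eob G Y) (eob G Z) n
     (FS_tensor_map (EHom M Y Z) (EHom M X Y) (EHom N (eob G Y) (eob G Z)) (EHom N (eob G X) (eob G Y))
       (ear G Y Z) (ear G X Y) n x)"
    unfolding x EComp_class[OF f] using PiE_restrict[OF f] by simp
qed (use assms in auto)

lemma comp_efunc_simps [simp]:
  "X \<in> EOb M \<Longrightarrow> eob (comp_efunc M H G) X = eob H (eob G X)"
  "X \<in> EOb M \<Longrightarrow> Y \<in> EOb M \<Longrightarrow> f \<in> fob (EHom M X Y) n \<Longrightarrow>
   ear (comp_efunc M H G) X Y n f = ear H (eob G X) (eob G Y) n (ear G X Y n f)"
  by (simp_all add: comp_efunc_def)

lemma id_efunc_simps [simp]: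
  "X \<in> EOb M \<Longrightarrow> eob (id_efunc M) X = X"
  "X \<in> EOb M \<Longrightarrow> Y \<in> EOb M \<Longrightarrow> f \<in> fob (EHom M X Y) n \<Longrightarrow> ear (id_efunc M) X Y n f = f"
  by (simp_all add: id_efunc_def FS_id_def)

lemma ecomp_cong:
  assumes "X = X'" "Y = Y'" "Z = Z'" "g = g'" "\<And>i. i < m \<Longrightarrow> f i = f' i"
  shows "ecomp M X Y Z n m g f = ecomp M X' Y' Z' n m g' f'"
proof -
  have "restrict f {..<m} = restrict f' {..<m}" using assms(5) by (intro restrict_ext) simp
  then show ?thesis using assms(1-4) by (simp add: ecomp_def)
qed

lemma enriched_categoryD:
  assumes "enriched_category M"
  shows EHom_functor: "X \<in> EOb M \<Longrightarrow> Y \<in> EOb M \<Longrightarrow> is_functor Fcat SetC (EHom M X Y)"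
    and EId_hom: "X \<in> EOb M \<Longrightarrow> EId M X \<in> FS_hom FS_unit (EHom M X X)"
    and EComp_hom: "X \<in> EOb M \<Longrightarrow> Y \<in> EOb M \<Longrightarrow> Z \<in> EOb M \<Longrightarrow>
      EComp M X Y Z \<in> FS_hom (FS_tensor (EHom M Y Z) (EHom M X Y)) (EHom M X Z)"
  using assms unfolding enriched_category_def by simp_all

lemma EId_in: "enriched_category M \<Longrightarrow> X \<in> EOb M \<Longrightarrow> i < n \<Longrightarrow> EId M X n i \<in> fob (EHom M X X) n"
  using FS_homD(1)[OF EId_hom] by simp

lemma ecomp_in:
  assumes "enriched_category M" "X \<in> EOb M" "Y \<in> EOb M" "Z \<in> EOb M"
    and "g \<in> fob (EHom M Y Z) m" "\<And>i. i < m \<Longrightarrow> f i \<in> fob (EHom M X Y) n"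
  shows "ecomp M X Y Z n m g f \<in> fob (EHom M X Z) n"
  unfolding ecomp_def by (rule FS_homD(1)[OF EComp_hom[OF assms(1-4)]]) (simp add: assms(5,6))

lemma enriched_functor_id:
  assumes M: "enriched_category M" shows "enriched_functor M M (id_efunc M)"
proof (rule enriched_functorI)
  show "ear (id_efunc M) X Y \<in> FS_hom (EHom M X Y) (EHom M (eob (id_efunc M) X) (eob (id_efunc M) Y))"
    if "X \<in> EOb M" "Y \<in> EOb M" for X Y
    using that FS_id_hom[OF EHom_functor[OF M that]] by (simp add: id_efunc_def)
  fix X Y Z n m g f assume "X \<in> EOb M" "Y \<in> EOb M" "Z \<in> EOb M" "g \<in> fob (EHom M Y Z) m"
    "\<And>i. i < m \<Longrightarrow> f i \<in> fob (EHom M X Y) n"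
  then show "ear (id_efunc M) X Z n (ecomp M X Y Z n m g f) =
    ecomp M (eob (id_efunc M) X) (eob (id_efunc M) Y) (eob (id_efunc M) Z) n m
     (ear (id_efunc M) Y Z m g) (\<lambda>i. ear (id_efunc M) X Y n (f i))"
    by (simp add: ecomp_in[OF M] cong: ecomp_cong)
qed (simp_all add: EId_in[OF M], simp_all add: id_efunc_def)

lemma enriched_functor_comp:
  assumes L: "enriched_category L" and G: "enriched_functor L M G" and H: "enriched_functor M N H"
  shows "enriched_functor L N (comp_efunc L H G)"
proof (rule enriched_functorI)
  note Gob = efunctor_ob[OF G] and Gar = efunctor_ar[OF G]
  show "ear (comp_efunc L H G) X Y \<in>
      FS_hom (EHom L X Y) (EHom N (eob (comp_efunc L H G) X) (eob (comp_efunc L H G) Y))"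
    if X: "X \<in> EOb L" and Y: "Y \<in> EOb L" for X Y
  proof (rule FS_homI)
    fix m n :: nat and s f assume s: "s \<in> {..<m} \<rightarrow>\<^sub>E {..<n}" and f: "f \<in> fob (EHom L X Y) m"
    show "ear (comp_efunc L H G) X Y n (far (EHom L X Y) m n s f) =
      far (EHom N (eob (comp_efunc L H G) X) (eob (comp_efunc L H G) Y)) m n s (ear (comp_efunc L H G) X Y m f)"
      using s f X Y by (simp add: fset_far_in[OF EHom_functor[OF L X Y]] FS_homD(3)[OF efunctor_hom[OF G X Y]]
        FS_homD(3)[OF efunctor_hom[OF H Gob[OF X] Gob[OF Y]]] Gar)
  qed (simp_all add: X Y efunctor_ar[OF H] Gob Gar, simp add: comp_efunc_def X Y)
  fix X Y Z n m g f assume "X \<in> EOb L" "Y \<in> EOb L" "Z \<in> EOb L" "g \<in> fob (EHom L Y Z) m"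
    "\<And>i. i < m \<Longrightarrow> f i \<in> fob (EHom L X Y) n"
  then show "ear (comp_efunc L H G) X Z n (ecomp L X Y Z n m g f) =
    ecomp N (eob (comp_efunc L H G) X) (eob (comp_efunc L H G) Y) (eob (comp_efunc L H G) Z) n m
     (ear (comp_efunc L H G) Y Z m g) (\<lambda>i. ear (comp_efunc L H G) X Y n (f i))"
    by (simp add: ecomp_in[OF L] efunctor_comp[OF G] efunctor_comp[OF H] Gob Gar cong: ecomp_cong)
qed (simp_all add: EId_in[OF L] efunctor_ob[OF G] efunctor_ob[OF H] efunctor_id[OF G] efunctor_id[OF H],
    simp_all add: comp_efunc_def)

lemma comp_efunc_assoc:
  assumes G: "enriched_functor K L G"
  shows "comp_efunc K I (comp_efunc K H G) = comp_efunc K (comp_efunc L I H) G"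
  by (simp add: comp_efunc_def efunctor_ob[OF G] efunctor_ar[OF G] cong: restrict_cong)

lemma comp_efunc_id:
  assumes M: "enriched_category M" and G: "enriched_functor M N G"
  shows "comp_efunc M G (id_efunc M) = G"
  by (rule efunctor_eqI[OF enriched_functor_comp[OF M enriched_functor_id[OF M] G] G]) simp_all

section \<open>Enriched transformations and their unary components\<close>

lemma FS_lunit_inv_map:
  assumes t: "t \<in> FS_hom FS_unit B" and u: "u \<in> FS_hom A A'" and f: "f \<in> fob A n"
  shows "FS_tensor_map FS_unit A B A' t u n (FS_lunit_inv A n f) =
    coend_class B A' n (1, t 1 0, \<lambda>i\<in>{..<1}. u n f)"
  using f unfolding FS_lunit_inv_def
  by (simp add: FS_tensor_map_class[OF t u] compose_def cong: restrict_cong)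

lemma FS_runit_inv_map:
  assumes t: "t \<in> FS_hom FS_unit B" and u: "u \<in> FS_hom A A'" and f: "f \<in> fob A n"
  shows "FS_tensor_map A FS_unit A' B u t n (FS_runit_inv A n f) =
    coend_class A' B n (n, u n f, restrict (t n) {..<n})"
  using f unfolding FS_runit_inv_def
  by (simp add: FS_tensor_map_class[OF u t] compose_def cong: restrict_cong)

text \<open>The inverse unit constraints send \<open>f\<close> to explicit triples, of arity 1 on
  the left and of arity \<open>n\<close> with the identity family on the right, so both legs of the
  hexagon can be evaluated directly.\<close>

lemma enriched_trans_iff:
  assumes G: "enriched_functor M N G" and H: "enriched_functor M N H"
  shows "t \<in> enriched_trans M N G H \<longleftrightarrow>
    t \<in> (\<Pi>\<^sub>E X\<in>EOb M. FS_hom FS_unit (EHom N (eob G X) (eob H X))) \<and>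
    (\<forall>X\<in>EOb M. \<forall>Y\<in>EOb M. \<forall>n. \<forall>f\<in>fob (EHom M X Y) n.
       ecomp N (eob G X) (eob G Y) (eob H Y) n 1 (t Y 1 0) (\<lambda>_. ear G X Y n f) =
       ecomp N (eob G X) (eob H X) (eob H Y) n n (ear H X Y n f) (t X n))"
  (is "_ \<longleftrightarrow> t \<in> ?P \<and> ?Q")
proof -
  have "EComp N (eob G X) (eob G Y) (eob H Y) n
       (FS_tensor_map FS_unit (EHom M X Y) (EHom N (eob G Y) (eob H Y)) (EHom N (eob G X) (eob G Y))
          (t Y) (ear G X Y) n (FS_lunit_inv (EHom M X Y) n f)) =
      ecomp N (eob G X) (eob G Y) (eob H Y) n 1 (t Y 1 0) (\<lambda>_. ear G X Y n f)"
    "EComp N (eob G X) (eob H X) (eob H Y) n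
       (FS_tensor_map (EHom M X Y) FS_unit (EHom N (eob H X) (eob H Y)) (EHom N (eob G X) (eob H X))
          (ear H X Y) (t X) n (FS_runit_inv (EHom M X Y) n f)) =
     ecomp N (eob G X) (eob H X) (eob H Y) n n (ear H X Y n f) (t X n)"
    if t: "t \<in> ?P" and X: "X \<in> EOb M" and Y: "Y \<in> EOb M" and f: "f \<in> fob (EHom M X Y) n" for X Y n f
    by (simp_all add: FS_lunit_inv_map[OF PiE_mem[OF t Y] efunctor_hom[OF G X Y] f]
        FS_runit_inv_map[OF PiE_mem[OF t X] efunctor_hom[OF H X Y] f] ecomp_def)
  then show ?thesis unfolding enriched_trans_def by (auto simp del: PiE_empty_domain)
qed

lemma unit_hom_R:
  assumes D: "finite_powers D" and ob: "A \<in> Ob D" "B \<in> Ob D" and t: "t \<in> FS_hom FS_unit (R_hom D A B)"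
  shows "t 1 0 \<in> Hom D A B"
    and "i < n \<Longrightarrow> t n i = Cmp D (Pwr D A n) A B (t 1 0) (Prj D A n i)"
proof -
  have t0: "t 1 0 \<in> Hom D (Pwr D A 1) B" using FS_homD(1)[OF t, of 0 1] by simp
  then show "t 1 0 \<in> Hom D A B" by (simp add: Pwr_1 D ob)
  assume i: "i < n"
  \<comment> \<open>The map from 1 to \<open>n\<close> that picks \<open>i\<close> carries 0 to
    \<open>i\<close>; naturality of \<open>t\<close> at this map is the Yoneda argument.\<close>
  let ?s = "\<lambda>_\<in>{..<1}. i"
  have s: "?s \<in> {..<1} \<rightarrow>\<^sub>E {..<n}" using i by simp
  have "t n i = far (R_hom D A B) 1 n ?s (t 1 0)"
    using FS_homD(3)[OF t s, of 0] by (simp add: FS_unit_simps(2)[OF s])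
  then show "t n i = Cmp D (Pwr D A n) A B (t 1 0) (Prj D A n i)"
    using t0 i by (simp add: R_hom_simps(2)[OF s] mcomp_1 D ob Prj_hom)
qed

lemma unit_hom_R_I:
  assumes D: "finite_powers D" and ob: "A \<in> Ob D" "B \<in> Ob D" and t: "\<tau> \<in> Hom D A B"
  shows "(\<lambda>n. \<lambda>i\<in>{..<n}. Cmp D (Pwr D A n) A B \<tau> (Prj D A n i)) \<in> FS_hom FS_unit (R_hom D A B)"
proof (rule FS_homI)
  fix m n :: nat and s x assume s: "s \<in> {..<m} \<rightarrow>\<^sub>E {..<n}" and x: "x \<in> fob FS_unit m"
  have si: "s i < n" if "i < m" for i using PiE_mem[OF s] that by simp
  show "(\<lambda>i\<in>{..<n}. Cmp D (Pwr D A n) A B \<tau> (Prj D A n i)) (far FS_unit m n s x) =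
    far (R_hom D A B) m n s ((\<lambda>i\<in>{..<m}. Cmp D (Pwr D A m) A B \<tau> (Prj D A m i)) x)"
    using s x by (simp add: si cat_comp fp_cat D ob Pwr_ob Prj_hom t mcomp_def cat_assoc pow_tuple_hom pow_tuple_prj)
qed (simp_all add: cat_comp fp_cat D ob Pwr_ob Prj_hom t)

text \<open>The Yoneda extension of a family of unary components to all arities, inverse to reading
  off \<open>t X 1 0\<close> (\<open>etrans_1\<close>, \<open>etrans_eta\<close>).\<close>

definition etrans ::
  "('o, 'a) ecat \<Rightarrow> ('p, 'b) pcat \<Rightarrow> ('o, 'a, 'p, 'b) efunc \<Rightarrow> ('o, 'a, 'p, 'b) efunc \<Rightarrow>
   ('o \<Rightarrow> 'b) \<Rightarrow> 'o \<Rightarrow> nat \<Rightarrow> nat \<Rightarrow> 'b" where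
  "etrans M D G H \<tau> = (\<lambda>X\<in>EOb M. \<lambda>n. \<lambda>i\<in>{..<n}.
     Cmp D (Pwr D (eob G X) n) (eob G X) (eob H X) (\<tau> X) (Prj D (eob G X) n i))"

lemma etrans_cong: "(\<And>X. X \<in> EOb M \<Longrightarrow> \<tau> X = \<tau>' X) \<Longrightarrow> etrans M D G H \<tau> = etrans M D G H \<tau>'"
  unfolding etrans_def by (rule restrict_ext) simp

lemma etrans_1:
  assumes "finite_powers D" "X \<in> EOb M" "eob G X \<in> Ob D" "eob H X \<in> Ob D" "\<tau> X \<in> Hom D (eob G X) (eob H X)"
  shows "etrans M D G H \<tau> X 1 0 = \<tau> X"
  using assms by (simp add: etrans_def Pwr_1 Prj_1 cat_rules fp_cat)

text \<open>Naturality must hold against operations of every arity. The family substituted on the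
  right is the \<open>n\<close>-th power of \<open>\<tau> X\<close>, so the condition is the
  familiar square for homomorphisms of algebras.\<close>

lemma etransI:
  assumes D: "finite_powers D" and G: "enriched_functor M (R D) G" and H: "enriched_functor M (R D) H"
    and \<tau>: "\<And>X. X \<in> EOb M \<Longrightarrow> \<tau> X \<in> Hom D (eob G X) (eob H X)"
    and nat: "\<And>X Y n f. X \<in> EOb M \<Longrightarrow> Y \<in> EOb M \<Longrightarrow> f \<in> fob (EHom M X Y) n \<Longrightarrow>
      Cmp D (Pwr D (eob G X) n) (eob G Y) (eob H Y) (\<tau> Y) (ear G X Y n f) =
      mcomp D (eob G X) (eob H X) (eob H Y) n n (ear H X Y n f)
        (\<lambda>i. Cmp D (Pwr D (eob G X) n) (eob G X) (eob H X) (\<tau> X) (Prj D (eob G X) n i))"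
  shows "etrans M D G H \<tau> \<in> enriched_trans M (R D) G H"
  unfolding enriched_trans_iff[OF G H]
proof (intro conjI ballI allI)
  note Gob = efunctor_ob[OF G, simplified] and Hob = efunctor_ob[OF H, simplified]
  note Gar = efunctor_ar[OF G, simplified] and Har = efunctor_ar[OF H, simplified]
  show "etrans M D G H \<tau> \<in> (\<Pi>\<^sub>E X\<in>EOb M. FS_hom FS_unit (EHom (R D) (eob G X) (eob H X)))"
    by (simp add: etrans_def unit_hom_R_I D Gob Hob \<tau>)
  fix X Y n f assume X: "X \<in> EOb M" and Y: "Y \<in> EOb M" and f: "f \<in> fob (EHom M X Y) n"
  let ?t = "\<lambda>i. Cmp D (Pwr D (eob G X) n) (eob G X) (eob H X) (\<tau> X) (Prj D (eob G X) n i)"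
  have "ecomp (R D) (eob G X) (eob G Y) (eob H Y) n 1 (etrans M D G H \<tau> Y 1 0) (\<lambda>_. ear G X Y n f) =
     Cmp D (Pwr D (eob G X) n) (eob G Y) (eob H Y) (\<tau> Y) (ear G X Y n f)"
    by (simp add: etrans_1 D Gob Hob X Y \<tau> ecomp_R Gar f Pwr_1 mcomp_1)
  also have "\<dots> = mcomp D (eob G X) (eob H X) (eob H Y) n n (ear H X Y n f) ?t"
    by (rule nat[OF X Y f])
  also have "\<dots> = ecomp (R D) (eob G X) (eob H X) (eob H Y) n n (ear H X Y n f) ?t"
    by (rule ecomp_R[symmetric]) (simp_all add: D X Y Gob Hob Har f cat_comp fp_cat \<tau> Prj_hom Pwr_ob)
  also have "\<dots> = ecomp (R D) (eob G X) (eob H X) (eob H Y) n n (ear H X Y n f) (etrans M D G H \<tau> X n)"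
    by (rule ecomp_cong) (simp_all add: etrans_def X)
  finally show "ecomp (R D) (eob G X) (eob G Y) (eob H Y) n 1 (etrans M D G H \<tau> Y 1 0) (\<lambda>_. ear G X Y n f) =
    ecomp (R D) (eob G X) (eob H X) (eob H Y) n n (ear H X Y n f) (etrans M D G H \<tau> X n)" .
qed

text \<open>Converse to \<open>etransI\<close>. Since \<open>t\<close> is the extension of its unary
  components, later equations between transformations are checked at arity 1 only.\<close>

lemma etransD:
  assumes D: "finite_powers D" and G: "enriched_functor M (R D) G" and H: "enriched_functor M (R D) H"
    and t: "t \<in> enriched_trans M (R D) G H"
  shows etrans_hom: "X \<in> EOb M \<Longrightarrow> t X 1 0 \<in> Hom D (eob G X) (eob H X)"
    and etrans_component: "X \<in> EOb M \<Longrightarrow> i < n \<Longrightarrow>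
      t X n i = Cmp D (Pwr D (eob G X) n) (eob G X) (eob H X) (t X 1 0) (Prj D (eob G X) n i)"
    and etrans_natural: "X \<in> EOb M \<Longrightarrow> Y \<in> EOb M \<Longrightarrow> f \<in> fob (EHom M X Y) n \<Longrightarrow>
      Cmp D (Pwr D (eob G X) n) (eob G Y) (eob H Y) (t Y 1 0) (ear G X Y n f) =
      mcomp D (eob G X) (eob H X) (eob H Y) n n (ear H X Y n f)
        (\<lambda>i. Cmp D (Pwr D (eob G X) n) (eob G X) (eob H X) (t X 1 0) (Prj D (eob G X) n i))"
    and etrans_eta: "etrans M D G H (\<lambda>X. t X 1 0) = t"
proof -
  note Gob = efunctor_ob[OF G, simplified] and Hob = efunctor_ob[OF H, simplified]
  note Gar = efunctor_ar[OF G, simplified] and Har = efunctor_ar[OF H, simplified]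
  have tP: "t \<in> (\<Pi>\<^sub>E X\<in>EOb M. FS_hom FS_unit (R_hom D (eob G X) (eob H X)))"
    using t unfolding enriched_trans_iff[OF G H] by simp
  have natural: "\<forall>X\<in>EOb M. \<forall>Y\<in>EOb M. \<forall>n. \<forall>f\<in>fob (EHom M X Y) n.
       ecomp (R D) (eob G X) (eob G Y) (eob H Y) n 1 (t Y 1 0) (\<lambda>_. ear G X Y n f) =
       ecomp (R D) (eob G X) (eob H X) (eob H Y) n n (ear H X Y n f) (t X n)"
    using t unfolding enriched_trans_iff[OF G H] by (rule conjunct2)
  have th: "t X \<in> FS_hom FS_unit (R_hom D (eob G X) (eob H X))" if "X \<in> EOb M" for X
    using PiE_mem[OF tP that] .
  show hom: "t X 1 0 \<in> Hom D (eob G X) (eob H X)" if "X \<in> EOb M" for X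
    by (rule unit_hom_R(1)[OF D Gob[OF that] Hob[OF that] th[OF that]])
  show comp: "t X n i = Cmp D (Pwr D (eob G X) n) (eob G X) (eob H X) (t X 1 0) (Prj D (eob G X) n i)"
    if "X \<in> EOb M" "i < n" for X n i
    by (rule unit_hom_R(2)[OF D Gob Hob th]) (simp_all add: that)
  show "Cmp D (Pwr D (eob G X) n) (eob G Y) (eob H Y) (t Y 1 0) (ear G X Y n f) =
      mcomp D (eob G X) (eob H X) (eob H Y) n n (ear H X Y n f)
        (\<lambda>i. Cmp D (Pwr D (eob G X) n) (eob G X) (eob H X) (t X 1 0) (Prj D (eob G X) n i))"
    if X: "X \<in> EOb M" and Y: "Y \<in> EOb M" and f: "f \<in> fob (EHom M X Y) n" for X Y n f
  proof -
    have "Cmp D (Pwr D (eob G X) n) (eob G Y) (eob H Y) (t Y 1 0) (ear G X Y n f) =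
        ecomp (R D) (eob G X) (eob G Y) (eob H Y) n 1 (t Y 1 0) (\<lambda>_. ear G X Y n f)"
      by (simp add: D Gob Hob X Y hom ecomp_R Gar f Pwr_1 mcomp_1)
    also have "\<dots> = ecomp (R D) (eob G X) (eob H X) (eob H Y) n n (ear H X Y n f) (t X n)"
      using natural X Y f by blast
    also have "\<dots> = ecomp (R D) (eob G X) (eob H X) (eob H Y) n n (ear H X Y n f)
        (\<lambda>i. Cmp D (Pwr D (eob G X) n) (eob G X) (eob H X) (t X 1 0) (Prj D (eob G X) n i))"
      by (rule ecomp_cong) (simp_all add: comp[OF X, of _ n])
    also have "\<dots> = mcomp D (eob G X) (eob H X) (eob H Y) n n (ear H X Y n f)
        (\<lambda>i. Cmp D (Pwr D (eob G X) n) (eob G X) (eob H X) (t X 1 0) (Prj D (eob G X) n i))"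
      by (rule ecomp_R) (simp_all add: D X Y Gob Hob Har f cat_comp fp_cat hom Prj_hom Pwr_ob)
    finally show ?thesis .
  qed
  show "etrans M D G H (\<lambda>X. t X 1 0) = t"
  proof (rule extensionalityI[of _ "EOb M"])
    show "t \<in> extensional (EOb M)" using tP by (simp add: PiE_iff)
    fix X assume X: "X \<in> EOb M"
    show "etrans M D G H (\<lambda>X. t X 1 0) X = t X"
    proof
      fix n show "etrans M D G H (\<lambda>X. t X 1 0) X n = t X n"
      proof (rule extensionalityI[of _ "{..<n}"])
        show "t X n \<in> extensional {..<n}" using FS_homD(2)[OF th[OF X], of n] by simp
      qed (simp_all add: etrans_def X comp[of X _ n, symmetric])
    qed
  qed (simp add: etrans_def)
qed

lemma etrans_eqI:
  assumes D: "finite_powers D" and G: "enriched_functor M (R D) G" and H: "enriched_functor M (R D) H"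
    and t: "t \<in> enriched_trans M (R D) G H" and u: "u \<in> enriched_trans M (R D) G H"
    and eq: "\<And>X. X \<in> EOb M \<Longrightarrow> t X 1 0 = u X 1 0"
  shows "t = u"
proof -
  have "etrans M D G H (\<lambda>X. t X 1 0) = etrans M D G H (\<lambda>X. u X 1 0)"
    by (rule etrans_cong) (rule eq)
  then show ?thesis using etrans_eta[OF D G H t] etrans_eta[OF D G H u] by simp
qed

section \<open>The category of enriched functors into \<open>R D\<close>\<close>

lemma enriched_functor_cat_simps [simp]:
  "Ob (enriched_functor_cat M N) = {G. enriched_functor M N G}"
  "Hom (enriched_functor_cat M N) G H = enriched_trans M N G H"
  by (simp_all add: enriched_functor_cat_def)

lemma enriched_functor_cat_Idn:
  assumes D: "finite_powers D" and G: "enriched_functor M (R D) G"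
  shows "Idn (enriched_functor_cat M (R D)) G = etrans M D G G (\<lambda>X. Idn D (eob G X))"
proof -
  have "EId (R D) (eob G X) n = (\<lambda>i\<in>{..<n}. Cmp D (Pwr D (eob G X) n) (eob G X) (eob G X)
      (Idn D (eob G X)) (Prj D (eob G X) n i))" if "X \<in> EOb M" for X n
    unfolding EId_R using efunctor_ob[OF G that]
    by (intro restrict_ext) (simp add: cat_rules fp_cat D Pwr_ob Prj_hom)
  then show ?thesis
    unfolding enriched_functor_cat_def etrans_def by (auto intro!: restrict_ext)
qed

text \<open>At arity \<open>n\<close> and argument \<open>i\<close> the unit isomorphism produces a
  triple of arity 1, so the composite is \<open>u X 1 0\<close> after \<open>t X n i\<close>. Yoneda
  for \<open>t\<close> turns this into the composite of the unary components after the
  projection.\<close>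

lemma enriched_functor_cat_Cmp:
  assumes D: "finite_powers D" and G: "enriched_functor M (R D) G" and H: "enriched_functor M (R D) H"
    and K: "enriched_functor M (R D) K"
    and t: "t \<in> enriched_trans M (R D) G H" and u: "u \<in> enriched_trans M (R D) H K"
  shows "Cmp (enriched_functor_cat M (R D)) G H K u t =
    etrans M D G K (\<lambda>X. Cmp D (eob G X) (eob H X) (eob K X) (u X 1 0) (t X 1 0))"
proof -
  note Gob = efunctor_ob[OF G, simplified] and Hob = efunctor_ob[OF H, simplified]
    and Kob = efunctor_ob[OF K, simplified]
  have uh: "u X \<in> FS_hom FS_unit (R_hom D (eob H X) (eob K X))" if "X \<in> EOb M" for X
    using u that unfolding enriched_trans_iff[OF H K] by (auto simp: PiE_iff)
  have th: "t X \<in> FS_hom FS_unit (R_hom D (eob G X) (eob H X))" if "X \<in> EOb M" for X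
    using t that unfolding enriched_trans_iff[OF G H] by (auto simp: PiE_iff)
  have "EComp (R D) (eob G X) (eob H X) (eob K X) n
      (FS_tensor_map FS_unit FS_unit (R_hom D (eob H X) (eob K X)) (R_hom D (eob G X) (eob H X))
        (u X) (t X) n (FS_lunit_inv FS_unit n i)) =
      Cmp D (Pwr D (eob G X) n) (eob G X) (eob K X)
        (Cmp D (eob G X) (eob H X) (eob K X) (u X 1 0) (t X 1 0)) (Prj D (eob G X) n i)"
    if X: "X \<in> EOb M" and i: "i < n" for X n i
  proof -
    note obs = Gob[OF X] Hob[OF X] Kob[OF X]
    have uX: "u X 1 0 \<in> Hom D (eob H X) (eob K X)" by (rule etrans_hom[OF D H K u X])
    have tX: "t X 1 0 \<in> Hom D (eob G X) (eob H X)" by (rule etrans_hom[OF D G H t X])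
    have tXi: "t X n i \<in> Hom D (Pwr D (eob G X) n) (eob H X)"
      using FS_homD(1)[OF th[OF X], of i n] i by simp
    have "EComp (R D) (eob G X) (eob H X) (eob K X) n
      (FS_tensor_map FS_unit FS_unit (R_hom D (eob H X) (eob K X)) (R_hom D (eob G X) (eob H X))
        (u X) (t X) n (FS_lunit_inv FS_unit n i)) =
      ecomp (R D) (eob G X) (eob H X) (eob K X) n 1 (u X 1 0) (\<lambda>_. t X n i)"
      using i by (simp add: FS_lunit_inv_map[OF uh[OF X] th[OF X]] ecomp_def)
    also have "\<dots> = Cmp D (Pwr D (eob G X) n) (eob H X) (eob K X) (u X 1 0) (t X n i)"
      by (simp add: D obs uX tXi ecomp_R Pwr_1 mcomp_1)
    finally show ?thesis
      by (simp add: etrans_component[OF D G H t X i] cat_assoc fp_cat D obs uX tX Pwr_ob Prj_hom i)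
  qed
  then show ?thesis
    unfolding enriched_functor_cat_def etrans_def by (auto intro!: restrict_ext)
qed

lemma enriched_functor_cat_Idn_in:
  assumes D: "finite_powers D" and G: "enriched_functor M (R D) G"
  shows "Idn (enriched_functor_cat M (R D)) G \<in> enriched_trans M (R D) G G"
  unfolding enriched_functor_cat_Idn[OF D G]
proof (rule etransI[OF D G G])
  note Gob = efunctor_ob[OF G, simplified] and Gar = efunctor_ar[OF G, simplified]
  fix X Y n f assume X: "X \<in> EOb M" and Y: "Y \<in> EOb M" and f: "f \<in> fob (EHom M X Y) n"
  have "mcomp D (eob G X) (eob G X) (eob G Y) n n (ear G X Y n f)
     (\<lambda>i. Cmp D (Pwr D (eob G X) n) (eob G X) (eob G X) (Idn D (eob G X)) (Prj D (eob G X) n i)) =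
     mcomp D (eob G X) (eob G X) (eob G Y) n n (ear G X Y n f) (Prj D (eob G X) n)"
    by (rule mcomp_cong) (simp add: cat_rules fp_cat D Gob X Pwr_ob Prj_hom)
  then show "Cmp D (Pwr D (eob G X) n) (eob G Y) (eob G Y) (Idn D (eob G Y)) (ear G X Y n f) =
    mcomp D (eob G X) (eob G X) (eob G Y) n n (ear G X Y n f)
     (\<lambda>i. Cmp D (Pwr D (eob G X) n) (eob G X) (eob G X) (Idn D (eob G X)) (Prj D (eob G X) n i))"
    by (simp add: mcomp_Prj_right cat_rules fp_cat D Gob X Y Gar f Pwr_ob)
qed (use efunctor_ob[OF G] D in \<open>simp add: cat_id fp_cat\<close>)

text \<open>The two naturality squares are pasted along \<open>H\<close>; what remains is that the
  powers of \<open>t X 1 0\<close> and \<open>u X 1 0\<close> compose componentwise.\<close>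

lemma enriched_functor_cat_Cmp_in:
  assumes D: "finite_powers D" and G: "enriched_functor M (R D) G" and H: "enriched_functor M (R D) H"
    and K: "enriched_functor M (R D) K"
    and t: "t \<in> enriched_trans M (R D) G H" and u: "u \<in> enriched_trans M (R D) H K"
  shows "Cmp (enriched_functor_cat M (R D)) G H K u t \<in> enriched_trans M (R D) G K"
  unfolding enriched_functor_cat_Cmp[OF assms]
proof (rule etransI[OF D G K])
  note Gob = efunctor_ob[OF G, simplified] and Gar = efunctor_ar[OF G, simplified]
  note Hob = efunctor_ob[OF H, simplified] and Har = efunctor_ar[OF H, simplified]
  note Kob = efunctor_ob[OF K, simplified] and Kar = efunctor_ar[OF K, simplified]
  note th = etrans_hom[OF D G H t] and uh = etrans_hom[OF D H K u]
  show "X \<in> EOb M \<Longrightarrow> Cmp D (eob G X) (eob H X) (eob K X) (u X 1 0) (t X 1 0) \<in> Hom D (eob G X) (eob K X)" for X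
    by (simp add: cat_comp fp_cat D Gob Hob Kob th uh)
  fix X Y n f assume X: "X \<in> EOb M" and Y: "Y \<in> EOb M" and f: "f \<in> fob (EHom M X Y) n"
  let ?P = "\<lambda>A. Pwr D A n"
  let ?ti = "\<lambda>i. Cmp D (?P (eob G X)) (eob G X) (eob H X) (t X 1 0) (Prj D (eob G X) n i)"
  let ?ui = "\<lambda>i. Cmp D (?P (eob H X)) (eob H X) (eob K X) (u X 1 0) (Prj D (eob H X) n i)"
  note rules = fp_cat D X Y f Gob Hob Kob Gar Har Kar th uh Pwr_ob Prj_hom cat_comp
  have "Cmp D (?P (eob G X)) (eob G Y) (eob K Y)
      (Cmp D (eob G Y) (eob H Y) (eob K Y) (u Y 1 0) (t Y 1 0)) (ear G X Y n f) =
      Cmp D (?P (eob G X)) (eob H Y) (eob K Y) (u Y 1 0)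
        (Cmp D (?P (eob G X)) (eob G Y) (eob H Y) (t Y 1 0) (ear G X Y n f))"
    by (simp add: cat_assoc rules)
  also have "\<dots> = Cmp D (?P (eob G X)) (eob H Y) (eob K Y) (u Y 1 0)
        (mcomp D (eob G X) (eob H X) (eob H Y) n n (ear H X Y n f) ?ti)"
    by (simp add: etrans_natural[OF D G H t X Y f])
  also have "\<dots> = mcomp D (eob G X) (eob H X) (eob K Y) n n
      (Cmp D (?P (eob H X)) (eob H Y) (eob K Y) (u Y 1 0) (ear H X Y n f)) ?ti"
    unfolding mcomp_def by (simp add: cat_assoc rules pow_tuple_hom)
  also have "\<dots> = mcomp D (eob G X) (eob H X) (eob K Y) n n
      (mcomp D (eob H X) (eob K X) (eob K Y) n n (ear K X Y n f) ?ui) ?ti"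
    by (simp add: etrans_natural[OF D H K u X Y f])
  also have "\<dots> = mcomp D (eob G X) (eob K X) (eob K Y) n n (ear K X Y n f)
      (\<lambda>i. mcomp D (eob G X) (eob H X) (eob K X) n n (?ui i) ?ti)"
    by (rule mcomp_assoc) (simp_all add: rules)
  also have "\<dots> = mcomp D (eob G X) (eob K X) (eob K Y) n n (ear K X Y n f)
     (\<lambda>i. Cmp D (?P (eob G X)) (eob G X) (eob K X)
        (Cmp D (eob G X) (eob H X) (eob K X) (u X 1 0) (t X 1 0)) (Prj D (eob G X) n i))"
    by (rule mcomp_cong) (simp add: mcomp_def cat_assoc rules pow_tuple_hom pow_tuple_prj)
  finally show "Cmp D (?P (eob G X)) (eob G Y) (eob K Y)
      (Cmp D (eob G Y) (eob H Y) (eob K Y) (u Y 1 0) (t Y 1 0)) (ear G X Y n f) =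
    mcomp D (eob G X) (eob K X) (eob K Y) n n (ear K X Y n f)
     (\<lambda>i. Cmp D (?P (eob G X)) (eob G X) (eob K X)
        (Cmp D (eob G X) (eob H X) (eob K X) (u X 1 0) (t X 1 0)) (Prj D (eob G X) n i))" .
qed

lemma enriched_functor_cat_components:
  assumes D: "finite_powers D" and G: "enriched_functor M (R D) G" and X: "X \<in> EOb M"
  shows enriched_functor_cat_Idn_1: "Idn (enriched_functor_cat M (R D)) G X 1 0 = Idn D (eob G X)"
    and enriched_functor_cat_Cmp_1: "enriched_functor M (R D) H \<Longrightarrow> enriched_functor M (R D) K \<Longrightarrow>
     t \<in> enriched_trans M (R D) G H \<Longrightarrow> u \<in> enriched_trans M (R D) H K \<Longrightarrow>
     Cmp (enriched_functor_cat M (R D)) G H K u t X 1 0 =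
     Cmp D (eob G X) (eob H X) (eob K X) (u X 1 0) (t X 1 0)"
proof -
  note Gob = efunctor_ob[OF G X, simplified]
  show "Idn (enriched_functor_cat M (R D)) G X 1 0 = Idn D (eob G X)"
    by (simp add: enriched_functor_cat_Idn[OF D G] etrans_1 D X Gob cat_id fp_cat)
  assume H: "enriched_functor M (R D) H" and K: "enriched_functor M (R D) K"
    and t: "t \<in> enriched_trans M (R D) G H" and u: "u \<in> enriched_trans M (R D) H K"
  note Hob = efunctor_ob[OF H X, simplified]
  note Kob = efunctor_ob[OF K X, simplified]
  show "Cmp (enriched_functor_cat M (R D)) G H K u t X 1 0 =
     Cmp D (eob G X) (eob H X) (eob K X) (u X 1 0) (t X 1 0)"
    by (simp add: enriched_functor_cat_Cmp[OF D G H K t u] etrans_1 D X Gob Hob Kob cat_comp fp_cat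
        etrans_hom[OF D G H t X] etrans_hom[OF D H K u X])
qed

text \<open>By \<open>etrans_eqI\<close> each equation is checked on unary components, where it is
  the corresponding law of \<open>D\<close>.\<close>

lemma category_enriched_functor_cat:
  assumes D: "finite_powers D" shows "category (enriched_functor_cat M (R D))"
proof (rule categoryI)
  let ?C = "enriched_functor_cat M (R D)"
  fix F G H K t u v
  assume F: "F \<in> Ob ?C" and G: "G \<in> Ob ?C" and t: "t \<in> Hom ?C F G"
  then have F': "enriched_functor M (R D) F" and G': "enriched_functor M (R D) G"
    and t': "t \<in> enriched_trans M (R D) F G" by simp_all
  note obs = efunctor_ob[OF F', simplified] efunctor_ob[OF G', simplified]
  note th = etrans_hom[OF D F' G' t']
  show "Cmp ?C F F G t (Idn ?C F) = t"
    by (rule etrans_eqI[OF D F' G' _ t'])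
      (simp_all add: enriched_functor_cat_Cmp_in enriched_functor_cat_Idn_in D F' G' t'
        enriched_functor_cat_Cmp_1 enriched_functor_cat_Idn_1 cat_id_right fp_cat obs th)
  show "Cmp ?C F G G (Idn ?C G) t = t"
    by (rule etrans_eqI[OF D F' G' _ t'])
      (simp_all add: enriched_functor_cat_Cmp_in enriched_functor_cat_Idn_in D F' G' t'
        enriched_functor_cat_Cmp_1 enriched_functor_cat_Idn_1 cat_id_left fp_cat obs th)
  assume H: "H \<in> Ob ?C" and u: "u \<in> Hom ?C G H"
  then have H': "enriched_functor M (R D) H" and u': "u \<in> enriched_trans M (R D) G H" by simp_all
  show "Cmp ?C F G H u t \<in> Hom ?C F H"
    by (simp add: enriched_functor_cat_Cmp_in D F' G' H' t' u')
  assume K: "K \<in> Ob ?C" and v: "v \<in> Hom ?C H K"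
  then have K': "enriched_functor M (R D) K" and v': "v \<in> enriched_trans M (R D) H K" by simp_all
  note obs = obs efunctor_ob[OF H', simplified] efunctor_ob[OF K', simplified]
  note uh = etrans_hom[OF D G' H' u'] and vh = etrans_hom[OF D H' K' v']
  show "Cmp ?C F H K v (Cmp ?C F G H u t) = Cmp ?C F G K (Cmp ?C G H K v u) t"
    by (rule etrans_eqI[OF D F' K'])
      (simp_all add: enriched_functor_cat_Cmp_in D F' G' H' K' t' u' v'
        enriched_functor_cat_Cmp_1 cat_assoc fp_cat obs th uh vh)
qed (simp add: enriched_functor_cat_Idn_in[OF D])

section \<open>Power-preserving functors as enriched functors\<close>

text \<open>Only the images of the chosen power cones are tested, and as cones:
  \<open>fob F (Pwr C X n)\<close> may differ from the chosen power of \<open>fob F X\<close>. This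
  is the property that an enriched functor gives back.\<close>

definition preserves_powers ::
  "('o, 'a) pcat \<Rightarrow> ('p, 'b) pcat \<Rightarrow> ('o, 'a, 'p, 'b) func \<Rightarrow> bool" where
  "preserves_powers C D F \<longleftrightarrow> (\<forall>X\<in>Ob C. \<forall>n.
     is_product D n (\<lambda>_. fob F X) (fob F (Pwr C X n)) (\<lambda>i. far F (Pwr C X n) X (Prj C X n i)))"

lemma preserves_powersD:
  "preserves_powers C D F \<Longrightarrow> X \<in> Ob C \<Longrightarrow>
   is_product D n (\<lambda>_. fob F X) (fob F (Pwr C X n)) (\<lambda>i. far F (Pwr C X n) X (Prj C X n i))"
  by (simp add: preserves_powers_def)

lemma preserves_powersI:
  "finite_powers C \<Longrightarrow> preserves_finite_products C D F \<Longrightarrow> preserves_powers C D F"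
  unfolding preserves_powers_def preserves_finite_products_def using fp_product by fast

text \<open>The canonical comparison from \<open>(F X)^n\<close> to \<open>F (X^n)\<close> that
  occurs inside \<open>R_func\<close>.\<close>

definition power_iso :: "('o, 'a) pcat \<Rightarrow> ('p, 'b) pcat \<Rightarrow> ('o, 'a, 'p, 'b) func \<Rightarrow> 'o \<Rightarrow> nat \<Rightarrow> 'b" where
  "power_iso C D F X n = tuple D n (\<lambda>_. fob F X) (fob F (Pwr C X n))
     (\<lambda>i. far F (Pwr C X n) X (Prj C X n i)) (Pwr D (fob F X) n) (Prj D (fob F X) n)"

locale power_functor =
  fixes C :: "('o, 'a) pcat" and D :: "('p, 'b) pcat" and F :: "('o, 'a, 'p, 'b) func"
  assumes C: "finite_powers C" and D: "finite_powers D" and F: "is_functor C D F"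
    and pres: "preserves_powers C D F"
begin

lemmas functor_rules = functor_ob[OF F] functor_ar[OF F]

lemma power_iso_hom: "X \<in> Ob C \<Longrightarrow> power_iso C D F X n \<in> Hom D (Pwr D (fob F X) n) (fob F (Pwr C X n))"
  unfolding power_iso_def
  by (rule tuple_hom[OF preserves_powersD[OF pres]]) (simp_all add: functor_rules Pwr_ob Prj_hom D)

lemma power_iso_prj:
  "X \<in> Ob C \<Longrightarrow> i < n \<Longrightarrow>
   Cmp D (Pwr D (fob F X) n) (fob F (Pwr C X n)) (fob F X) (far F (Pwr C X n) X (Prj C X n i))
     (power_iso C D F X n) = Prj D (fob F X) n i"
  unfolding power_iso_def
  by (rule tuple_prj[OF preserves_powersD[OF pres]]) (simp_all add: functor_rules Pwr_ob Prj_hom D)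

lemma power_iso_eqI:
  assumes X: "X \<in> Ob C" and u: "u \<in> Hom D (Pwr D (fob F X) n) (fob F (Pwr C X n))"
    and eq: "\<And>i. i < n \<Longrightarrow> Cmp D (Pwr D (fob F X) n) (fob F (Pwr C X n)) (fob F X)
      (far F (Pwr C X n) X (Prj C X n i)) u = Prj D (fob F X) n i"
  shows "power_iso C D F X n = u"
  unfolding power_iso_def
  by (rule tuple_eqI[OF fp_cat[OF D] preserves_powersD[OF pres X] _ u eq])
    (simp_all add: functor_rules Pwr_ob Prj_hom D X)

lemma power_iso_1: "X \<in> Ob C \<Longrightarrow> power_iso C D F X 1 = Idn D (fob F X)"
  by (rule power_iso_eqI)
    (simp_all add: Pwr_1 Prj_1 C D functor_rules cat_rules fp_cat functor_id[OF F])

text \<open>This trades the image of a tuple for the tuple of images, the point where preservation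
  of substitution by \<open>R_func\<close> is decided. The two composites agree after each image of
  a projection, and these images form a product cone.\<close>

lemma power_iso_tuple:
  assumes X: "X \<in> Ob C" and Y: "Y \<in> Ob C" and f: "\<And>i. i < m \<Longrightarrow> f i \<in> Hom C (Pwr C X n) Y"
  shows "Cmp D (Pwr D (fob F X) n) (fob F (Pwr C X n)) (fob F (Pwr C Y m))
      (far F (Pwr C X n) (Pwr C Y m) (pow_tuple C m Y (Pwr C X n) f)) (power_iso C D F X n) =
    Cmp D (Pwr D (fob F X) n) (Pwr D (fob F Y) m) (fob F (Pwr C Y m)) (power_iso C D F Y m)
      (pow_tuple D m (fob F Y) (Pwr D (fob F X) n)
        (\<lambda>i. Cmp D (Pwr D (fob F X) n) (fob F (Pwr C X n)) (fob F Y) (far F (Pwr C X n) Y (f i)) (power_iso C D F X n)))"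
    (is "?l = ?r")
proof (rule product_eqI[OF fp_cat[OF D] preserves_powersD[OF pres Y]])
  let ?P = "Pwr D (fob F X) n"
  note rules = functor_rules Pwr_ob Prj_hom C D fp_cat X Y f power_iso_hom pow_tuple_hom
  show "?P \<in> Ob D" by (simp add: rules)
  show "?l \<in> Hom D ?P (fob F (Pwr C Y m))" "?r \<in> Hom D ?P (fob F (Pwr C Y m))"
    by (simp_all add: rules cat_comp)
  fix i assume i: "i < m"
  have "Cmp D ?P (fob F (Pwr C Y m)) (fob F Y) (far F (Pwr C Y m) Y (Prj C Y m i)) ?l =
      Cmp D ?P (fob F (Pwr C X n)) (fob F Y) (far F (Pwr C X n) Y
        (Cmp C (Pwr C X n) (Pwr C Y m) Y (Prj C Y m i) (pow_tuple C m Y (Pwr C X n) f))) (power_iso C D F X n)"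
    by (simp add: functor_comp[OF F] cat_assoc rules i)
  also have "\<dots> = Cmp D ?P (fob F (Pwr C X n)) (fob F Y) (far F (Pwr C X n) Y (f i)) (power_iso C D F X n)"
    by (simp add: pow_tuple_prj rules i)
  also have "\<dots> = Cmp D ?P (Pwr D (fob F Y) m) (fob F Y) (Prj D (fob F Y) m i)
      (pow_tuple D m (fob F Y) ?P
        (\<lambda>i. Cmp D ?P (fob F (Pwr C X n)) (fob F Y) (far F (Pwr C X n) Y (f i)) (power_iso C D F X n)))"
    by (simp add: pow_tuple_prj rules i cat_comp)
  also have "\<dots> = Cmp D ?P (fob F (Pwr C Y m)) (fob F Y) (far F (Pwr C Y m) Y (Prj C Y m i)) ?r"
    by (simp add: cat_assoc[symmetric] rules i cat_comp power_iso_prj)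
  finally show "Cmp D ?P (fob F (Pwr C Y m)) (fob F Y) (far F (Pwr C Y m) Y (Prj C Y m i)) ?l =
    Cmp D ?P (fob F (Pwr C Y m)) (fob F Y) (far F (Pwr C Y m) Y (Prj C Y m i)) ?r" .
qed

abbreviation RF where "RF \<equiv> R_func C D F"

lemma R_func_simps:
  "X \<in> Ob C \<Longrightarrow> eob RF X = fob F X"
  "X \<in> Ob C \<Longrightarrow> Y \<in> Ob C \<Longrightarrow> f \<in> Hom C (Pwr C X n) Y \<Longrightarrow> ear RF X Y n f =
     Cmp D (Pwr D (fob F X) n) (fob F (Pwr C X n)) (fob F Y) (far F (Pwr C X n) Y f) (power_iso C D F X n)"
  by (simp_all add: R_func_def power_iso_def)

lemma R_func_hom:
  "X \<in> Ob C \<Longrightarrow> Y \<in> Ob C \<Longrightarrow> f \<in> Hom C (Pwr C X n) Y \<Longrightarrow>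
   ear RF X Y n f \<in> Hom D (Pwr D (fob F X) n) (fob F Y)"
  by (simp add: R_func_simps cat_comp fp_cat D C Pwr_ob functor_rules power_iso_hom)

lemma R_func_Prj:
  "X \<in> Ob C \<Longrightarrow> i < n \<Longrightarrow> ear RF X X n (Prj C X n i) = Prj D (fob F X) n i"
  by (simp add: R_func_simps C Prj_hom power_iso_prj)

lemma R_func_mcomp:
  assumes X: "X \<in> Ob C" and Y: "Y \<in> Ob C" and Z: "Z \<in> Ob C"
    and g: "g \<in> Hom C (Pwr C Y m) Z" and f: "\<And>i. i < m \<Longrightarrow> f i \<in> Hom C (Pwr C X n) Y"
  shows "ear RF X Z n (mcomp C X Y Z n m g f) =
    mcomp D (fob F X) (fob F Y) (fob F Z) n m (ear RF Y Z m g) (\<lambda>i. ear RF X Y n (f i))"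
proof -
  note rules = functor_rules Pwr_ob Prj_hom C D fp_cat X Y Z f g power_iso_hom pow_tuple_hom
  let ?P = "Pwr D (fob F X) n"
  let ?h = "\<lambda>i. Cmp D ?P (fob F (Pwr C X n)) (fob F Y) (far F (Pwr C X n) Y (f i)) (power_iso C D F X n)"
  have "ear RF X Z n (mcomp C X Y Z n m g f) =
      Cmp D ?P (fob F (Pwr C X n)) (fob F Z)
        (far F (Pwr C X n) Z (mcomp C X Y Z n m g f)) (power_iso C D F X n)"
    by (rule R_func_simps(2)[OF X Z mcomp_hom[OF C X Y Z g f]])
  also have "\<dots> = Cmp D ?P (fob F (Pwr C Y m)) (fob F Z) (far F (Pwr C Y m) Z g)
     (Cmp D ?P (fob F (Pwr C X n)) (fob F (Pwr C Y m))
      (far F (Pwr C X n) (Pwr C Y m) (pow_tuple C m Y (Pwr C X n) f)) (power_iso C D F X n))"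
    unfolding mcomp_def by (simp add: functor_comp[OF F] cat_assoc rules)
  also have "\<dots> = mcomp D (fob F X) (fob F Y) (fob F Z) n m (ear RF Y Z m g) ?h"
    unfolding mcomp_def by (simp add: power_iso_tuple R_func_simps cat_assoc rules cat_comp)
  also have "\<dots> = mcomp D (fob F X) (fob F Y) (fob F Z) n m (ear RF Y Z m g)
      (\<lambda>i. ear RF X Y n (f i))"
    by (rule mcomp_cong) (simp add: R_func_simps X Y f)
  finally show ?thesis .
qed

text \<open>Composition is \<open>R_func_mcomp\<close>. Naturality in the arity is the special case
  of it in which the substituted arguments are projections, which \<open>R_func_Prj\<close> sends to
  projections.\<close>

lemma enriched_functor_R_func: "enriched_functor (R C) (R D) RF"
proof (rule enriched_functorI)
  fix X Y assume "X \<in> EOb (R C)" and "Y \<in> EOb (R C)"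
  then have X: "X \<in> Ob C" and Y: "Y \<in> Ob C" by simp_all
  show "ear RF X Y \<in> FS_hom (EHom (R C) X Y) (EHom (R D) (eob RF X) (eob RF Y))"
  proof (rule FS_homI)
    fix m n :: nat and s f assume s: "s \<in> {..<m} \<rightarrow>\<^sub>E {..<n}" and "f \<in> fob (EHom (R C) X Y) m"
    then have f: "f \<in> Hom C (Pwr C X m) Y" by simp
    have si: "s i < n" if "i < m" for i using PiE_mem[OF s] that by simp
    have "mcomp D (fob F X) (fob F X) (fob F Y) n m (ear RF X Y m f)
         (\<lambda>i. ear RF X X n (Prj C X n (s i))) =
       mcomp D (fob F X) (fob F X) (fob F Y) n m (ear RF X Y m f) (\<lambda>i. Prj D (fob F X) n (s i))"
      by (rule mcomp_cong) (simp add: R_func_Prj X si)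
    then show "ear RF X Y n (far (EHom (R C) X Y) m n s f) =
      far (EHom (R D) (eob RF X) (eob RF Y)) m n s (ear RF X Y m f)"
      using s f by (simp add: R_func_mcomp R_func_hom X Y Prj_hom C si R_func_simps(1))
  qed (simp_all add: R_func_hom X Y R_func_simps(1), simp add: R_func_def X Y)
next
  fix X Y Z n m g and f :: "nat \<Rightarrow> 'a"
  assume "X \<in> EOb (R C)" "Y \<in> EOb (R C)" "Z \<in> EOb (R C)" "g \<in> fob (EHom (R C) Y Z) m"
    and "\<And>i. i < m \<Longrightarrow> f i \<in> fob (EHom (R C) X Y) n"
  then show "ear RF X Z n (ecomp (R C) X Y Z n m g f) =
     ecomp (R D) (eob RF X) (eob RF Y) (eob RF Z) n m
       (ear RF Y Z m g) (\<lambda>i. ear RF X Y n (f i))"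
    by (simp add: ecomp_R C D R_func_simps(1) functor_rules R_func_hom R_func_mcomp)
qed (simp_all add: R_func_Prj R_func_simps(1) functor_rules, simp_all add: R_func_def)

end

lemma R_func_id_func:
  assumes C: "finite_powers C" shows "R_func C C (id_func C) = id_efunc (R C)"
proof -
  have "is_product C n (\<lambda>_. fob (id_func C) X) (fob (id_func C) (Pwr C X n))
      (\<lambda>i. far (id_func C) (Pwr C X n) X (Prj C X n i))" if X: "X \<in> Ob C" for X n
    by (rule iffD2[OF is_product_cong fp_product[OF C X]]) (simp_all add: C X Pwr_ob Prj_hom)
  then interpret power_functor C C "id_func C"
    by unfold_locales (simp_all add: C is_functor_id_func fp_cat preserves_powers_def)
  have "power_iso C C (id_func C) X n = Idn C (Pwr C X n)" if X: "X \<in> Ob C" for X n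
    by (rule power_iso_eqI[OF X]) (simp_all add: X Pwr_ob Prj_hom C cat_rules fp_cat)
  then show ?thesis
    by (intro efunctor_eqI[OF enriched_functor_R_func enriched_functor_id[OF enriched_category_R[OF C]]])
      (simp_all add: R_func_simps Pwr_ob C cat_rules fp_cat)
qed

text \<open>The comparison for the composite is the image under \<open>G\<close> of the comparison
  for \<open>F\<close>, preceded by the comparison for \<open>G\<close>. By uniqueness this is an
  equality, so \<open>R\<close> preserves composition strictly although powers are preserved only up
  to isomorphism.\<close>

lemma R_func_comp_func:
  assumes "power_functor C D F" "power_functor D E G" "power_functor C E (comp_func C G F)"
  shows "R_func C E (comp_func C G F) = comp_efunc (R C) (R_func D E G) (R_func C D F)"
proof -
  interpret F: power_functor C D F by fact
  interpret G: power_functor D E G by fact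
  interpret GF: power_functor C E "comp_func C G F" by fact
  note rules = F.functor_rules G.functor_rules Pwr_ob Prj_hom F.C F.D G.D fp_cat F.power_iso_hom G.power_iso_hom
  have iso: "power_iso C E (comp_func C G F) X n =
      Cmp E (Pwr E (fob G (fob F X)) n) (fob G (Pwr D (fob F X) n)) (fob G (fob F (Pwr C X n)))
        (far G (Pwr D (fob F X) n) (fob F (Pwr C X n)) (power_iso C D F X n)) (power_iso D E G (fob F X) n)"
    if X: "X \<in> Ob C" for X n
  proof (rule GF.power_iso_eqI[OF X])
    fix i assume i: "i < n"
    have "Cmp E (fob G (Pwr D (fob F X) n)) (fob G (fob F (Pwr C X n))) (fob G (fob F X))
       (far G (fob F (Pwr C X n)) (fob F X) (far F (Pwr C X n) X (Prj C X n i)))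
       (far G (Pwr D (fob F X) n) (fob F (Pwr C X n)) (power_iso C D F X n)) =
       far G (Pwr D (fob F X) n) (fob F X) (Prj D (fob F X) n i)"
      by (simp add: functor_comp[OF G.F, symmetric] rules X i F.power_iso_prj)
    then show "Cmp E (Pwr E (fob (comp_func C G F) X) n) (fob (comp_func C G F) (Pwr C X n)) (fob (comp_func C G F) X)
        (far (comp_func C G F) (Pwr C X n) X (Prj C X n i))
        (Cmp E (Pwr E (fob G (fob F X)) n) (fob G (Pwr D (fob F X) n)) (fob G (fob F (Pwr C X n)))
        (far G (Pwr D (fob F X) n) (fob F (Pwr C X n)) (power_iso C D F X n)) (power_iso D E G (fob F X) n)) =
      Prj E (fob (comp_func C G F) X) n i"
      using G.power_iso_prj[of "fob F X" i n]
      by (simp add: rules X i cat_assoc[OF fp_cat[OF G.D], symmetric])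
  qed (simp add: rules X cat_comp)
  show ?thesis
  proof (rule efunctor_eqI[OF GF.enriched_functor_R_func
      enriched_functor_comp[OF enriched_category_R[OF F.C] F.enriched_functor_R_func G.enriched_functor_R_func]])
    fix X Y n f assume "X \<in> EOb (R C)" "Y \<in> EOb (R C)" "f \<in> fob (EHom (R C) X Y) n"
    then have X: "X \<in> Ob C" and Y: "Y \<in> Ob C" and f: "f \<in> Hom C (Pwr C X n) Y" by simp_all
    show "ear (R_func C E (comp_func C G F)) X Y n f =
      ear (comp_efunc (R C) (R_func D E G) (R_func C D F)) X Y n f"
      by (simp add: GF.R_func_simps F.R_func_simps G.R_func_simps iso X Y f rules cat_comp
          functor_comp[OF G.F] cat_assoc)
  qed (simp_all add: GF.R_func_simps F.R_func_simps G.R_func_simps rules)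
qed

section \<open>Recovering a functor from an enriched functor\<close>

definition underlying_func ::
  "('o, 'a) pcat \<Rightarrow> ('o, 'a, 'p, 'b) efunc \<Rightarrow> ('o, 'a, 'p, 'b) func" where
  "underlying_func C G = \<lparr>fob = (\<lambda>X\<in>Ob C. eob G X), far = (\<lambda>X\<in>Ob C. \<lambda>Y\<in>Ob C. \<lambda>f\<in>Hom C X Y. ear G X Y 1 f)\<rparr>"

lemma underlying_func_simps [simp]:
  "X \<in> Ob C \<Longrightarrow> fob (underlying_func C G) X = eob G X"
  "X \<in> Ob C \<Longrightarrow> Y \<in> Ob C \<Longrightarrow> f \<in> Hom C X Y \<Longrightarrow> far (underlying_func C G) X Y f = ear G X Y 1 f"
  by (simp_all add: underlying_func_def)

locale R_enriched_functor =
  fixes C :: "('o, 'a) pcat" and D :: "('p, 'b) pcat" and G :: "('o, 'a, 'p, 'b) efunc"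
  assumes C: "finite_powers C" and D: "finite_powers D" and G: "enriched_functor (R C) (R D) G"
begin

lemmas G_ob = efunctor_ob[OF G, simplified]
lemmas G_hom = efunctor_ar[OF G, simplified]

lemma G_Prj: "X \<in> Ob C \<Longrightarrow> i < n \<Longrightarrow> ear G X X n (Prj C X n i) = Prj D (eob G X) n i"
  using efunctor_id[OF G, of X i n] by simp

lemma G_mcomp:
  assumes "X \<in> Ob C" "Y \<in> Ob C" "Z \<in> Ob C" "g \<in> Hom C (Pwr C Y m) Z" "\<And>i. i < m \<Longrightarrow> f i \<in> Hom C (Pwr C X n) Y"
  shows "ear G X Z n (mcomp C X Y Z n m g f) =
    mcomp D (eob G X) (eob G Y) (eob G Z) n m (ear G Y Z m g) (\<lambda>i. ear G X Y n (f i))"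
  using efunctor_comp[OF G, of X Y Z g m f n] assms by (simp add: ecomp_R C D G_ob G_hom)

lemma G_comp:
  assumes ob: "X \<in> Ob C" "Y \<in> Ob C" "Z \<in> Ob C" and g: "g \<in> Hom C Y Z" and f: "f \<in> Hom C (Pwr C X n) Y"
  shows "ear G X Z n (Cmp C (Pwr C X n) Y Z g f) =
    Cmp D (Pwr D (eob G X) n) (eob G Y) (eob G Z) (ear G Y Z 1 g) (ear G X Y n f)"
  using G_mcomp[OF ob, of g 1 "\<lambda>_. f" n] by (simp add: mcomp_1 C D G_ob G_hom ob g f Pwr_1)

lemma G_hom_1: "X \<in> Ob C \<Longrightarrow> Y \<in> Ob C \<Longrightarrow> f \<in> Hom C X Y \<Longrightarrow> ear G X Y 1 f \<in> Hom D (eob G X) (eob G Y)"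
  using G_hom[of X Y f 1] by (simp add: Pwr_1 C D G_ob)

abbreviation U where "U \<equiv> underlying_func C G"

lemma is_functor_underlying: "is_functor C D U"
proof (rule functorI)
  fix X assume X: "X \<in> Ob C"
  show "far U X X (Idn C X) = Idn D (fob U X)"
    using G_Prj[OF X, of 0 1] by (simp add: X Prj_1 C D G_ob cat_id fp_cat)
  fix Y Z f g assume "Y \<in> Ob C" "Z \<in> Ob C" "g \<in> Hom C Y Z" "f \<in> Hom C X Y"
  then show "far U X Z (Cmp C X Y Z g f) =
     Cmp D (fob U X) (fob U Y) (fob U Z)
      (far U Y Z g) (far U X Y f)"
    using G_comp[OF X, of Y Z g f 1] by (simp add: X Pwr_1 C D G_ob cat_comp fp_cat)
qed (simp_all add: G_ob G_hom_1, simp_all add: underlying_func_def)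

lemma G_Idn_hom: "X \<in> Ob C \<Longrightarrow> ear G X (Pwr C X n) n (Idn C (Pwr C X n)) \<in> Hom D (Pwr D (eob G X) n) (eob G (Pwr C X n))"
  by (simp add: G_hom Pwr_ob C cat_id fp_cat)

text \<open>The identity of \<open>X^n\<close> is an \<open>n\<close>-ary operation from
  \<open>X\<close> to \<open>X^n\<close>. Followed by the unary operation \<open>Prj C X n i\<close>
  it is the \<open>i\<close>-th \<open>n\<close>-ary projection, whose image is prescribed by
  preservation of the enriched unit.\<close>

lemma G_prj_Idn:
  assumes X: "X \<in> Ob C" and i: "i < n"
  shows "Cmp D (Pwr D (eob G X) n) (eob G (Pwr C X n)) (eob G X)
    (ear G (Pwr C X n) X 1 (Prj C X n i)) (ear G X (Pwr C X n) n (Idn C (Pwr C X n))) = Prj D (eob G X) n i"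
  using G_comp[of X "Pwr C X n" X "Prj C X n i" "Idn C (Pwr C X n)" n]
  by (simp add: X i Pwr_ob Prj_hom C cat_rules fp_cat G_Prj)

text \<open>Substituting the projections, now read as unary maps out of \<open>X^n\<close>, into the
  \<open>n\<close>-ary operation given by the identity yields the identity of \<open>X^n\<close>.
  This is an equation between composites in \<open>R C\<close>, so \<open>G\<close> preserves
  it.\<close>

lemma G_Idn_prj:
  assumes X: "X \<in> Ob C"
  shows "Cmp D (eob G (Pwr C X n)) (Pwr D (eob G X) n) (eob G (Pwr C X n))
     (ear G X (Pwr C X n) n (Idn C (Pwr C X n)))
     (pow_tuple D n (eob G X) (eob G (Pwr C X n)) (\<lambda>i. ear G (Pwr C X n) X 1 (Prj C X n i))) =
     Idn D (eob G (Pwr C X n))"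
proof -
  let ?P = "Pwr C X n"
  have P: "?P \<in> Ob C" by (simp add: Pwr_ob C X)
  have "mcomp C ?P X ?P 1 n (Idn C ?P) (Prj C X n) = Idn C ?P"
    by (simp add: mcomp_def Pwr_1 P X C pow_tuple_Prj cat_rules fp_cat)
  moreover have "mcomp D (eob G ?P) (eob G X) (eob G ?P) 1 n (ear G X ?P n (Idn C ?P))
     (\<lambda>i. ear G ?P X 1 (Prj C X n i)) = ear G ?P ?P 1 (mcomp C ?P X ?P 1 n (Idn C ?P) (Prj C X n))"
    by (rule G_mcomp[symmetric]) (simp_all add: P X C Pwr_1 Prj_hom cat_id fp_cat)
  moreover have "ear G ?P ?P 1 (Idn C ?P) = Idn D (eob G ?P)"
    using functor_id[OF is_functor_underlying P] by (simp add: P cat_id fp_cat C)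
  ultimately show ?thesis by (simp add: mcomp_def Pwr_1 D G_ob P)
qed

text \<open>The image of the \<open>n\<close>-ary identity is a two-sided inverse to the tuple of
  images of projections: \<open>G_prj_Idn\<close> gives existence of factorisations and
  \<open>G_Idn_prj\<close> their uniqueness.\<close>

lemma preserves_powers_underlying: "preserves_powers C D U"
  unfolding preserves_powers_def
proof (intro ballI allI)
  fix X n assume X: "X \<in> Ob C"
  let ?P = "Pwr C X n"
  let ?e = "ear G X ?P n (Idn C ?P)"
  let ?p = "\<lambda>i. ear G ?P X 1 (Prj C X n i)"
  have P: "?P \<in> Ob C" by (simp add: Pwr_ob C X)
  note e = G_Idn_hom[OF X, of n]
  have p: "?p i \<in> Hom D (eob G ?P) (eob G X)" if "i < n" for i
    by (rule G_hom_1) (simp_all add: P X Prj_hom C that)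
  note rules = G_ob X P D fp_cat Pwr_ob Prj_hom e p
  have "prod_on D {..<n} (\<lambda>_. eob G X) (eob G ?P) ?p"
  proof (rule prod_onI)
    fix W assume W: "W \<in> Ob D"
    { fix f :: "nat \<Rightarrow> 'b" assume f: "\<And>i. i \<in> {..<n} \<Longrightarrow> f i \<in> Hom D W (eob G X)"
      let ?t = "pow_tuple D n (eob G X) W f"
      have t: "?t \<in> Hom D W (Pwr D (eob G X) n)" using f by (simp add: pow_tuple_hom rules W)
      have "Cmp D W (eob G ?P) (eob G X) (?p i) (Cmp D W (Pwr D (eob G X) n) (eob G ?P) ?e ?t) = f i" if "i < n" for i
        using that f G_prj_Idn[OF X that]
        by (simp add: cat_assoc[OF fp_cat[OF D], symmetric] rules W t pow_tuple_prj)
      then show "\<exists>u\<in>Hom D W (eob G ?P). \<forall>i\<in>{..<n}. Cmp D W (eob G ?P) (eob G X) (?p i) u = f i"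
        by (intro bexI[of _ "Cmp D W (Pwr D (eob G X) n) (eob G ?P) ?e ?t"]) (simp_all add: rules W t cat_comp) }
    fix u v assume u: "u \<in> Hom D W (eob G ?P)" and v: "v \<in> Hom D W (eob G ?P)"
      and eq: "\<And>i. i \<in> {..<n} \<Longrightarrow> Cmp D W (eob G ?P) (eob G X) (?p i) u = Cmp D W (eob G ?P) (eob G X) (?p i) v"
    \<comment> \<open>Every arrow into \<open>eob G ?P\<close> is rebuilt from its components, so
      equal components force equal arrows.\<close>
    have w: "w = Cmp D W (Pwr D (eob G X) n) (eob G ?P) ?e
        (pow_tuple D n (eob G X) W (\<lambda>i. Cmp D W (eob G ?P) (eob G X) (?p i) w))"
      if w: "w \<in> Hom D W (eob G ?P)" for w
    proof -
      have "w = Cmp D W (eob G ?P) (eob G ?P) (Idn D (eob G ?P)) w"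
        by (simp add: cat_id_left rules W w)
      also have "\<dots> = Cmp D W (Pwr D (eob G X) n) (eob G ?P) ?e
         (Cmp D W (eob G ?P) (Pwr D (eob G X) n) (pow_tuple D n (eob G X) (eob G ?P) ?p) w)"
        unfolding G_Idn_prj[OF X, symmetric] by (rule cat_assoc) (simp_all add: rules W w pow_tuple_hom)
      finally show ?thesis by (simp add: pow_tuple_comp rules W w)
    qed
    have "pow_tuple D n (eob G X) W (\<lambda>i. Cmp D W (eob G ?P) (eob G X) (?p i) u) =
        pow_tuple D n (eob G X) W (\<lambda>i. Cmp D W (eob G ?P) (eob G X) (?p i) v)"
      by (rule pow_tuple_cong) (simp add: eq)
    then show "u = v" using w[OF u] w[OF v] by simp
  qed (simp_all add: rules)
  then have "is_product D n (\<lambda>_. eob G X) (eob G ?P) ?p" by (simp add: is_product_iff)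
  then show "is_product D n (\<lambda>_. fob U X) (fob U ?P)
     (\<lambda>i. far U ?P X (Prj C X n i))"
    by (rule iffD2[OF is_product_cong, rotated -1]) (simp_all add: X P Prj_hom C)
qed

lemma power_functor_underlying: "power_functor C D U"
  by (simp add: power_functor_def C D is_functor_underlying preserves_powers_underlying)

text \<open>The comparison for \<open>U\<close> must be the image of the \<open>n\<close>-ary
  identity, since that has the required components by \<open>G_prj_Idn\<close>. An
  \<open>n\<close>-ary \<open>f\<close> is the unary map \<open>f\<close> out of \<open>X^n\<close>
  after this identity, so its two images coincide.\<close>

lemma R_func_underlying: "R_func C D U = G"
proof -
  interpret U: power_functor C D U by (rule power_functor_underlying)
  have iso: "power_iso C D U X n = ear G X (Pwr C X n) n (Idn C (Pwr C X n))" if X: "X \<in> Ob C" for X n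
    by (rule U.power_iso_eqI) (simp_all add: X Pwr_ob Prj_hom C G_Idn_hom G_prj_Idn)
  show ?thesis
  proof (rule efunctor_eqI[OF U.enriched_functor_R_func G])
    fix X Y n f assume "X \<in> EOb (R C)" "Y \<in> EOb (R C)" "f \<in> fob (EHom (R C) X Y) n"
    then have X: "X \<in> Ob C" and Y: "Y \<in> Ob C" and f: "f \<in> Hom C (Pwr C X n) Y" by simp_all
    show "ear (R_func C D U) X Y n f = ear G X Y n f"
      using G_comp[of X "Pwr C X n" Y f "Idn C (Pwr C X n)" n]
      by (simp add: U.R_func_simps X Y f iso Pwr_ob C cat_rules fp_cat)
  qed (simp add: U.R_func_simps)
qed

end

text \<open>At arity 1 the comparison is an identity (\<open>power_iso_1\<close>), so the unary
  operations of \<open>R_func C D F\<close> are the values of \<open>F\<close> itself.\<close>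

lemma (in power_functor) underlying_R_func: "underlying_func C (R_func C D F) = F"
proof -
  interpret U: R_enriched_functor C D "R_func C D F"
    by unfold_locales (simp_all add: C D enriched_functor_R_func)
  show ?thesis
  proof (rule functor_eqI[OF U.is_functor_underlying F])
    fix X Y f assume X: "X \<in> Ob C" and Y: "Y \<in> Ob C" and f: "f \<in> Hom C X Y"
    have "ear (R_func C D F) X Y 1 f = far F X Y f"
      using R_func_simps(2)[of X Y f 1]
      by (simp add: X Y f power_iso_1 Pwr_1 C D functor_rules cat_rules fp_cat)
    then show "far (underlying_func C (R_func C D F)) X Y f = far F X Y f" by (simp add: X Y f)
  qed (simp add: R_func_simps)
qed

section \<open>Strictly natural equivalences\<close>

lemma nat_transD:
  assumes "t \<in> nat_trans C D F G"
  shows "X \<in> Ob C \<Longrightarrow> t X \<in> Hom D (fob F X) (fob G X)" "t \<in> extensional (Ob C)"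
    "X \<in> Ob C \<Longrightarrow> Y \<in> Ob C \<Longrightarrow> f \<in> Hom C X Y \<Longrightarrow>
      Cmp D (fob F X) (fob F Y) (fob G Y) (t Y) (far F X Y f) =
      Cmp D (fob F X) (fob G X) (fob G Y) (far G X Y f) (t X)"
proof -
  have t: "t \<in> (\<Pi>\<^sub>E X\<in>Ob C. Hom D (fob F X) (fob G X))" using assms by (simp add: nat_trans_def)
  show "X \<in> Ob C \<Longrightarrow> t X \<in> Hom D (fob F X) (fob G X)" using t by (rule PiE_mem)
  show "t \<in> extensional (Ob C)" using t by (simp add: PiE_iff)
  show "X \<in> Ob C \<Longrightarrow> Y \<in> Ob C \<Longrightarrow> f \<in> Hom C X Y \<Longrightarrow>
      Cmp D (fob F X) (fob F Y) (fob G Y) (t Y) (far F X Y f) =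
      Cmp D (fob F X) (fob G X) (fob G Y) (far G X Y f) (t X)"
    using assms unfolding nat_trans_def by blast
qed

lemma nat_transI:
  assumes "t \<in> extensional (Ob C)" "\<And>X. X \<in> Ob C \<Longrightarrow> t X \<in> Hom D (fob F X) (fob G X)"
    "\<And>X Y f. X \<in> Ob C \<Longrightarrow> Y \<in> Ob C \<Longrightarrow> f \<in> Hom C X Y \<Longrightarrow>
      Cmp D (fob F X) (fob F Y) (fob G Y) (t Y) (far F X Y f) =
      Cmp D (fob F X) (fob G X) (fob G Y) (far G X Y f) (t X)"
  shows "t \<in> nat_trans C D F G"
  unfolding nat_trans_def using assms by (auto simp: PiE_iff)

lemma nat_trans_id:
  assumes D: "category D" and F: "is_functor C D F"
  shows "(\<lambda>X\<in>Ob C. Idn D (fob F X)) \<in> nat_trans C D F F"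
  by (rule nat_transI) (simp_all add: cat_rules D functor_ob[OF F] functor_ar[OF F])

lemma nat_trans_comp:
  assumes D: "category D" and F: "is_functor C D F" and G: "is_functor C D G" and H: "is_functor C D H"
    and t: "t \<in> nat_trans C D F G" and u: "u \<in> nat_trans C D G H"
  shows "(\<lambda>X\<in>Ob C. Cmp D (fob F X) (fob G X) (fob H X) (u X) (t X)) \<in> nat_trans C D F H"
proof (rule nat_transI)
  note rules = D functor_ob[OF F] functor_ob[OF G] functor_ob[OF H] functor_ar[OF F] functor_ar[OF G]
    functor_ar[OF H] nat_transD(1)[OF t] nat_transD(1)[OF u]
  show "X \<in> Ob C \<Longrightarrow> (\<lambda>X\<in>Ob C. Cmp D (fob F X) (fob G X) (fob H X) (u X) (t X)) X \<in> Hom D (fob F X) (fob H X)" for X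
    by (simp add: cat_comp rules)
  fix X Y f assume X: "X \<in> Ob C" and Y: "Y \<in> Ob C" and f: "f \<in> Hom C X Y"
  have "Cmp D (fob F X) (fob F Y) (fob H Y) (Cmp D (fob F Y) (fob G Y) (fob H Y) (u Y) (t Y)) (far F X Y f) =
      Cmp D (fob F X) (fob G Y) (fob H Y) (u Y) (Cmp D (fob F X) (fob G X) (fob G Y) (far G X Y f) (t X))"
    by (simp add: cat_assoc rules X Y f nat_transD(3)[OF t])
  also have "\<dots> = Cmp D (fob F X) (fob G X) (fob H Y) (Cmp D (fob G X) (fob G Y) (fob H Y) (u Y) (far G X Y f)) (t X)"
    by (simp add: cat_assoc rules X Y f)
  also have "\<dots> = Cmp D (fob F X) (fob G X) (fob H Y) (Cmp D (fob G X) (fob H X) (fob H Y) (far H X Y f) (u X)) (t X)"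
    by (simp only: nat_transD(3)[OF u X Y f])
  also have "\<dots> = Cmp D (fob F X) (fob H X) (fob H Y) (far H X Y f) (Cmp D (fob F X) (fob G X) (fob H X) (u X) (t X))"
    by (simp add: cat_assoc rules X Y f)
  finally show "Cmp D (fob F X) (fob F Y) (fob H Y) ((\<lambda>X\<in>Ob C. Cmp D (fob F X) (fob G X) (fob H X) (u X) (t X)) Y) (far F X Y f) =
    Cmp D (fob F X) (fob H X) (fob H Y) (far H X Y f) ((\<lambda>X\<in>Ob C. Cmp D (fob F X) (fob G X) (fob H X) (u X) (t X)) X)"
    by (simp add: X Y)
qed simp

lemma nat_iso_refl:
  assumes D: "category D" and F: "is_functor C D F"
  shows "nat_iso C D F F (\<lambda>X\<in>Ob C. Idn D (fob F X))"
  unfolding nat_iso_def is_iso_def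
  using nat_trans_id[OF D F] by (auto simp: cat_rules D functor_ob[OF F] intro!: bexI[of _ "Idn D (fob F _)"])

text \<open>For strict inverses the unit and the counit are identity transformations.\<close>

lemma equivalence_functorI:
  assumes "category C" "category D" and F: "is_functor C D F" and G: "is_functor D C G"
    and GF: "comp_func C G F = id_func C" and FG: "comp_func D F G = id_func D"
  shows "equivalence_functor C D F"
  unfolding equivalence_functor_def
proof (intro conjI exI)
  show "nat_iso C C (id_func C) (comp_func C G F) (\<lambda>X\<in>Ob C. Idn C (fob (id_func C) X))"
    unfolding GF by (intro nat_iso_refl is_functor_id_func assms(1))
  show "nat_iso D D (comp_func D F G) (id_func D) (\<lambda>X\<in>Ob D. Idn D (fob (id_func D) X))"
    unfolding FG by (intro nat_iso_refl is_functor_id_func assms(2))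
qed (rule F G)+

lemma CAT_simps [simp]:
  "Ob CAT = {C. category C}" "Hom CAT C D = {F. is_functor C D F}" "Idn CAT = id_func"
  "Cmp CAT C D E G F = comp_func C G F"
  by (simp_all add: CAT_def)

text \<open>All 2-cells are identities. The coherence condition for composites then says that an
  identity after the image of an identity is an identity.\<close>

lemma strictly_natural_imp_pseudonatural:
  assumes \<Phi>: "is_functor B CAT \<Phi>" and \<Psi>: "is_functor B CAT \<Psi>" and Id: "\<And>X. X \<in> Ob B \<Longrightarrow> Idn B X \<in> Hom B X X"
    and \<sigma>: "\<And>X. X \<in> Ob B \<Longrightarrow> is_functor (fob \<Phi> X) (fob \<Psi> X) (\<sigma> X)"
    and nat: "\<And>X Y f. X \<in> Ob B \<Longrightarrow> Y \<in> Ob B \<Longrightarrow> f \<in> Hom B X Y \<Longrightarrow>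
      comp_func (fob \<Phi> X) (far \<Psi> X Y f) (\<sigma> X) = comp_func (fob \<Phi> X) (\<sigma> Y) (far \<Phi> X Y f)"
  shows "pseudonatural_trans B \<Phi> \<Psi> \<sigma>
    (\<lambda>X Y f. \<lambda>M\<in>Ob (fob \<Phi> X). Idn (fob \<Psi> Y) (fob (\<sigma> Y) (fob (far \<Phi> X Y f) M)))"
proof -
  have cat\<Phi>: "category (fob \<Phi> X)" and cat\<Psi>: "category (fob \<Psi> X)" if "X \<in> Ob B" for X
    using functor_ob[OF \<Phi> that] functor_ob[OF \<Psi> that] by simp_all
  have natob: "fob (far \<Psi> X Y f) (fob (\<sigma> X) M) = fob (\<sigma> Y) (fob (far \<Phi> X Y f) M)"
    if "X \<in> Ob B" "Y \<in> Ob B" "f \<in> Hom B X Y" "M \<in> Ob (fob \<Phi> X)" for X Y f M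
    using arg_cong[OF nat[OF that(1-3)], of "\<lambda>F. fob F M"] that(4) by simp
  show ?thesis
    unfolding pseudonatural_trans_def
  proof (intro conjI ballI)
    fix X assume X: "X \<in> Ob B"
    show "is_functor (fob \<Phi> X) (fob \<Psi> X) (\<sigma> X)" by (rule \<sigma>[OF X])
    fix M assume M: "M \<in> Ob (fob \<Phi> X)"
    show "(\<lambda>M\<in>Ob (fob \<Phi> X). Idn (fob \<Psi> X) (fob (\<sigma> X) (fob (far \<Phi> X X (Idn B X)) M))) M =
        Idn (fob \<Psi> X) (fob (\<sigma> X) M)"
      using M functor_id[OF \<Phi> X] by simp
  next
    fix X Y f assume X: "X \<in> Ob B" and Y: "Y \<in> Ob B" and f: "f \<in> Hom B X Y"
    have "is_functor (fob \<Phi> X) (fob \<Psi> Y) (comp_func (fob \<Phi> X) (\<sigma> Y) (far \<Phi> X Y f))"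
      using functor_ar[OF \<Phi> X Y f] by (intro is_functor_comp_func[OF cat\<Phi>[OF X] _ \<sigma>[OF Y]]) simp
    from nat_iso_refl[OF cat\<Psi>[OF Y] this]
    show "nat_iso (fob \<Phi> X) (fob \<Psi> Y) (comp_func (fob \<Phi> X) (far \<Psi> X Y f) (\<sigma> X))
        (comp_func (fob \<Phi> X) (\<sigma> Y) (far \<Phi> X Y f))
        (\<lambda>M\<in>Ob (fob \<Phi> X). Idn (fob \<Psi> Y) (fob (\<sigma> Y) (fob (far \<Phi> X Y f) M)))"
      unfolding nat[OF X Y f] by (simp cong: restrict_cong)
  next
    fix X Y Z g f M
    assume X: "X \<in> Ob B" and Y: "Y \<in> Ob B" and Z: "Z \<in> Ob B" and g: "g \<in> Hom B Y Z" and f: "f \<in> Hom B X Y"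
      and M: "M \<in> Ob (fob \<Phi> X)"
    have \<Phi>f: "is_functor (fob \<Phi> X) (fob \<Phi> Y) (far \<Phi> X Y f)" using functor_ar[OF \<Phi> X Y f] by simp
    have \<Phi>g: "is_functor (fob \<Phi> Y) (fob \<Phi> Z) (far \<Phi> Y Z g)" using functor_ar[OF \<Phi> Y Z g] by simp
    have \<Psi>g: "is_functor (fob \<Psi> Y) (fob \<Psi> Z) (far \<Psi> Y Z g)" using functor_ar[OF \<Psi> Y Z g] by simp
    have gf: "far \<Phi> X Z (Cmp B X Y Z g f) = comp_func (fob \<Phi> X) (far \<Phi> Y Z g) (far \<Phi> X Y f)"
      using functor_comp[OF \<Phi> X Y Z g f] by simp
    have fM: "fob (far \<Phi> X Y f) M \<in> Ob (fob \<Phi> Y)" by (rule functor_ob[OF \<Phi>f M])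
    show "let P = fob (far \<Psi> Y Z g) (fob (far \<Psi> X Y f) (fob (\<sigma> X) M));
               Q = fob (far \<Psi> Y Z g) (fob (\<sigma> Y) (fob (far \<Phi> X Y f) M));
               R = fob (\<sigma> Z) (fob (far \<Phi> Y Z g) (fob (far \<Phi> X Y f) M))
           in (\<lambda>M\<in>Ob (fob \<Phi> X). Idn (fob \<Psi> Z) (fob (\<sigma> Z) (fob (far \<Phi> X Z (Cmp B X Y Z g f)) M))) M =
              Cmp (fob \<Psi> Z) P Q R
                ((\<lambda>M\<in>Ob (fob \<Phi> Y). Idn (fob \<Psi> Z) (fob (\<sigma> Z) (fob (far \<Phi> Y Z g) M))) (fob (far \<Phi> X Y f) M))
                (far (far \<Psi> Y Z g) (fob (far \<Psi> X Y f) (fob (\<sigma> X) M))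
                   (fob (\<sigma> Y) (fob (far \<Phi> X Y f) M))
                   ((\<lambda>M\<in>Ob (fob \<Phi> X). Idn (fob \<Psi> Y) (fob (\<sigma> Y) (fob (far \<Phi> X Y f) M))) M))"
      by (simp add: Let_def M gf fM natob[OF X Y f M] functor_id[OF \<Psi>g] functor_ob[OF \<sigma>[OF Y]] functor_ob[OF \<sigma>[OF Z]]
          natob[OF Y Z g fM] functor_ob[OF \<Phi>g] cat_id cat_id_left cat\<Psi>[OF Z])
  qed
qed

text \<open>Ordinary naturality at \<open>f\<close> from \<open>X^n\<close> to \<open>Y\<close>
  involves the component of \<open>t\<close> at \<open>X^n\<close>, enriched naturality the
  \<open>n\<close>-th power of the component at \<open>X\<close>. Naturality at the projections
  identifies the two through the comparisons.\<close>

lemma (in power_functor) etrans_R_func: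
  assumes H: "power_functor C D H" and t: "t \<in> nat_trans C D F H"
  shows "etrans (R C) D (R_func C D F) (R_func C D H) t \<in> enriched_trans (R C) (R D) (R_func C D F) (R_func C D H)"
proof (rule etransI[OF D enriched_functor_R_func power_functor.enriched_functor_R_func[OF H]])
  let ?RH = "R_func C D H"
  interpret H: power_functor C D H by fact
  fix X assume "X \<in> EOb (R C)"
  then have X: "X \<in> Ob C" by simp
  show "t X \<in> Hom D (eob RF X) (eob ?RH X)"
    using nat_transD(1)[OF t X] by (simp add: R_func_simps H.R_func_simps X)
  fix Y n f assume "Y \<in> EOb (R C)" "f \<in> fob (EHom (R C) X Y) n"
  then have Y: "Y \<in> Ob C" and f: "f \<in> Hom C (Pwr C X n) Y" by simp_all
  let ?P = "Pwr D (fob F X) n"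
  let ?XP = "Pwr C X n"
  let ?t = "\<lambda>i. Cmp D ?P (fob F X) (fob H X) (t X) (Prj D (fob F X) n i)"
  note rules = functor_rules H.functor_rules Pwr_ob Prj_hom C D fp_cat X Y f power_iso_hom H.power_iso_hom
    nat_transD(1)[OF t] pow_tuple_hom
  have XP: "?XP \<in> Ob C" by (simp add: rules)
  \<comment> \<open>Up to the comparisons for \<open>F\<close> and \<open>H\<close>, the component
    of \<open>t\<close> at \<open>X^n\<close> is the \<open>n\<close>-th power of its component at
    \<open>X\<close>.\<close>
  have iso: "Cmp D ?P (fob F ?XP) (fob H ?XP) (t ?XP) (power_iso C D F X n) =
      Cmp D ?P (Pwr D (fob H X) n) (fob H ?XP) (power_iso C D H X n) (pow_tuple D n (fob H X) ?P ?t)"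
      (is "?l = ?r")
  proof (rule product_eqI[OF fp_cat[OF D] preserves_powersD[OF H.pres X]])
    show "?P \<in> Ob D" "?l \<in> Hom D ?P (fob H ?XP)" "?r \<in> Hom D ?P (fob H ?XP)"
      by (simp_all add: rules cat_comp)
    fix i assume i: "i < n"
    have "Cmp D ?P (fob H ?XP) (fob H X) (far H ?XP X (Prj C X n i)) ?l =
        Cmp D ?P (fob F ?XP) (fob H X) (Cmp D (fob F ?XP) (fob H ?XP) (fob H X) (far H ?XP X (Prj C X n i)) (t ?XP))
          (power_iso C D F X n)"
      by (simp add: cat_assoc rules i)
    also have "\<dots> = Cmp D ?P (fob F ?XP) (fob H X)
        (Cmp D (fob F ?XP) (fob F X) (fob H X) (t X) (far F ?XP X (Prj C X n i))) (power_iso C D F X n)"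
      using nat_transD(3)[OF t XP X Prj_hom[OF C X i]] by simp
    also have "\<dots> = ?t i"
      by (simp add: cat_assoc rules i power_iso_prj)
    also have "\<dots> = Cmp D ?P (Pwr D (fob H X) n) (fob H X) (Prj D (fob H X) n i) (pow_tuple D n (fob H X) ?P ?t)"
      by (simp add: pow_tuple_prj rules i cat_comp)
    also have "\<dots> = Cmp D ?P (fob H ?XP) (fob H X) (far H ?XP X (Prj C X n i)) ?r"
      by (simp add: cat_assoc[symmetric] rules i cat_comp H.power_iso_prj)
    finally show "Cmp D ?P (fob H ?XP) (fob H X) (far H ?XP X (Prj C X n i)) ?l =
      Cmp D ?P (fob H ?XP) (fob H X) (far H ?XP X (Prj C X n i)) ?r" .
  qed
  have "Cmp D ?P (fob F Y) (fob H Y) (t Y) (Cmp D ?P (fob F ?XP) (fob F Y) (far F ?XP Y f) (power_iso C D F X n)) =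
      Cmp D ?P (fob F ?XP) (fob H Y) (Cmp D (fob F ?XP) (fob F Y) (fob H Y) (t Y) (far F ?XP Y f)) (power_iso C D F X n)"
    by (simp add: cat_assoc rules)
  also have "\<dots> = Cmp D ?P (fob H ?XP) (fob H Y) (far H ?XP Y f) ?l"
    unfolding nat_transD(3)[OF t XP Y f] by (simp add: cat_assoc rules)
  also have "\<dots> = mcomp D (fob F X) (fob H X) (fob H Y) n n
      (Cmp D (Pwr D (fob H X) n) (fob H ?XP) (fob H Y) (far H ?XP Y f) (power_iso C D H X n)) ?t"
    unfolding iso mcomp_def by (simp add: cat_assoc rules cat_comp)
  finally show "Cmp D (Pwr D (eob RF X) n) (eob RF Y) (eob ?RH Y) (t Y)
      (ear RF X Y n f) =
    mcomp D (eob RF X) (eob ?RH X) (eob ?RH Y) n n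
      (ear ?RH X Y n f)
      (\<lambda>i. Cmp D (Pwr D (eob RF X) n) (eob RF X) (eob ?RH X) (t X)
        (Prj D (eob RF X) n i))"
    by (simp add: R_func_simps H.R_func_simps X Y f)
qed

text \<open>Ordinary naturality is the case of arity 1 of \<open>etrans_natural\<close>, where the
  only projection is an identity.\<close>

lemma (in R_enriched_functor) underlying_trans:
  assumes H: "enriched_functor (R C) (R D) H" and t: "t \<in> enriched_trans (R C) (R D) G H"
  shows "(\<lambda>X\<in>Ob C. t X 1 0) \<in> nat_trans C D (underlying_func C G) (underlying_func C H)"
proof (rule nat_transI)
  interpret H: R_enriched_functor C D H by unfold_locales (simp_all add: C D H)
  note th = etrans_hom[OF D G H t, simplified]
  show "X \<in> Ob C \<Longrightarrow> (\<lambda>X\<in>Ob C. t X 1 0) X \<in> Hom D (fob (underlying_func C G) X) (fob (underlying_func C H) X)" for X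
    by (simp add: th)
  fix X Y f assume X: "X \<in> Ob C" and Y: "Y \<in> Ob C" and f: "f \<in> Hom C X Y"
  show "Cmp D (fob (underlying_func C G) X) (fob (underlying_func C G) Y) (fob (underlying_func C H) Y)
       ((\<lambda>X\<in>Ob C. t X 1 0) Y) (far (underlying_func C G) X Y f) =
     Cmp D (fob (underlying_func C G) X) (fob (underlying_func C H) X) (fob (underlying_func C H) Y)
       (far (underlying_func C H) X Y f) ((\<lambda>X\<in>Ob C. t X 1 0) X)"
    using etrans_natural[OF D G H t, of X Y f 1]
    by (simp add: X Y f Pwr_1 Prj_1 C D G_ob H.G_ob mcomp_1 cat_rules fp_cat th)
qed simp

section \<open>The categories of enriched categories, models and theories\<close>

lemma ECAT_simps [simp]:
  "Ob ECAT = {M. enriched_category M}" "Hom ECAT M N = {G. enriched_functor M N G}" "Idn ECAT = id_efunc"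
  "Cmp ECAT L M N H G = comp_efunc L H G"
  by (simp_all add: ECAT_def)

lemma enriched_precomp_simps [simp]:
  "enriched_functor M N G \<Longrightarrow> fob (enriched_precomp N L M K) G = comp_efunc L G K"
  "enriched_functor M N G \<Longrightarrow> enriched_functor M N H \<Longrightarrow> t \<in> enriched_trans M N G H \<Longrightarrow>
   far (enriched_precomp N L M K) G H t = (\<lambda>X\<in>EOb L. t (eob K X))"
  by (simp_all add: enriched_precomp_def)

lemma enriched_trans_whisker:
  assumes L: "enriched_category L" and K: "enriched_functor L M K"
    and G: "enriched_functor M N G" and H: "enriched_functor M N H" and t: "t \<in> enriched_trans M N G H"
  shows "(\<lambda>X\<in>EOb L. t (eob K X)) \<in> enriched_trans L N (comp_efunc L G K) (comp_efunc L H K)"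
proof -
  have 1: "t \<in> (\<Pi>\<^sub>E X\<in>EOb M. FS_hom FS_unit (EHom N (eob G X) (eob H X)))"
    and 2: "\<And>X Y n f. X \<in> EOb M \<Longrightarrow> Y \<in> EOb M \<Longrightarrow> f \<in> fob (EHom M X Y) n \<Longrightarrow>
       ecomp N (eob G X) (eob G Y) (eob H Y) n 1 (t Y 1 0) (\<lambda>_. ear G X Y n f) =
       ecomp N (eob G X) (eob H X) (eob H Y) n n (ear H X Y n f) (t X n)"
    using t unfolding enriched_trans_iff[OF G H] by blast+
  note Kob = efunctor_ob[OF K]
  have 3: "t (eob K X) \<in> FS_hom FS_unit (EHom N (eob G (eob K X)) (eob H (eob K X)))" if "X \<in> EOb L" for X
    by (rule PiE_mem[OF 1 Kob[OF that]])
  show ?thesis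
    unfolding enriched_trans_iff[OF enriched_functor_comp[OF L K G] enriched_functor_comp[OF L K H]]
  proof (intro conjI ballI allI)
    fix X Y n f assume "X \<in> EOb L" "Y \<in> EOb L" "f \<in> fob (EHom L X Y) n"
    then show "ecomp N (eob (comp_efunc L G K) X) (eob (comp_efunc L G K) Y) (eob (comp_efunc L H K) Y) n 1
         ((\<lambda>X\<in>EOb L. t (eob K X)) Y 1 0) (\<lambda>_. ear (comp_efunc L G K) X Y n f) =
       ecomp N (eob (comp_efunc L G K) X) (eob (comp_efunc L H K) X) (eob (comp_efunc L H K) Y) n n
         (ear (comp_efunc L H K) X Y n f) ((\<lambda>X\<in>EOb L. t (eob K X)) X n)"
      using 2[OF Kob Kob efunctor_ar[OF K], of X Y f n] by simp
  qed (simp add: 3)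
qed

lemma is_functor_enriched_precomp:
  assumes D: "finite_powers D" and L: "enriched_category L" and K: "enriched_functor L M K"
  shows "is_functor (enriched_functor_cat M (R D)) (enriched_functor_cat L (R D)) (enriched_precomp (R D) L M K)"
    (is "is_functor ?M ?L ?P")
proof (rule functorI)
  note comp = enriched_functor_comp[OF L K]
  note whisker = enriched_trans_whisker[OF L K]
  note Kob = efunctor_ob[OF K]
  show "far ?P G \<in> extensional (Ob ?M)" if "G \<in> Ob ?M" for G
    using that by (simp add: enriched_precomp_def)
  show "far ?P G H \<in> extensional (Hom ?M G H)" if "G \<in> Ob ?M" "H \<in> Ob ?M" for G H
    using that by (simp add: enriched_precomp_def)
  show "fob ?P G \<in> Ob ?L" if "G \<in> Ob ?M" for G
    using that by (simp add: comp)
  show "far ?P G H t \<in> Hom ?L (fob ?P G) (fob ?P H)"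
    if "G \<in> Ob ?M" "H \<in> Ob ?M" "t \<in> Hom ?M G H" for G H t
    using that by (simp add: whisker)
  show "far ?P G G (Idn ?M G) = Idn ?L (fob ?P G)" if "G \<in> Ob ?M" for G
    using that by (simp add: enriched_functor_cat_Idn_in[OF D]) (simp add: enriched_functor_cat_def Kob cong: restrict_cong)
  fix F G H u t assume F: "F \<in> Ob ?M" and G: "G \<in> Ob ?M" and H: "H \<in> Ob ?M" and u: "u \<in> Hom ?M G H" and t: "t \<in> Hom ?M F G"
  show "far ?P F H (Cmp ?M F G H u t) = Cmp ?L (fob ?P F) (fob ?P G) (fob ?P H) (far ?P G H u) (far ?P F G t)"
    using F G H u t by (simp add: enriched_functor_cat_Cmp_in[OF D]) (simp add: enriched_functor_cat_def Kob cong: restrict_cong)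
qed (simp_all add: enriched_precomp_def)

lemma is_functor_ECAT_into:
  assumes D: "finite_powers D"
  shows "is_functor (opcat ECAT) CAT (ECAT_into (R D) ::
    (('o, 'a) ecat, _, (('o, 'a, 'p, 'b) efunc, _) cat, _) func)"
    (is "is_functor _ _ ?E")
proof (rule functorI)
  let ?F = "\<lambda>M. enriched_functor_cat M (R D)"
  have ob: "fob ?E M = enriched_functor_cat M (R D)" if "enriched_category M" for M
    using that by (simp add: ECAT_into_def)
  have ar: "far ?E M L K = enriched_precomp (R D) L M K"
    if "enriched_category M" "enriched_category L" "enriched_functor L M K" for M L K
    using that by (simp add: ECAT_into_def)
  show "fob ?E M \<in> Ob CAT" if "M \<in> Ob (opcat ECAT)" for M
    using that by (simp add: ob category_enriched_functor_cat[OF D])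
  show "far ?E M L K \<in> Hom CAT (fob ?E M) (fob ?E L)"
    if "M \<in> Ob (opcat ECAT)" "L \<in> Ob (opcat ECAT)" "K \<in> Hom (opcat ECAT) M L" for M L K
    using that by (simp add: ob ar is_functor_enriched_precomp[OF D])
  show "far ?E M M (Idn (opcat ECAT) M) = Idn CAT (fob ?E M)" if "M \<in> Ob (opcat ECAT)" for M
  proof -
    have M: "enriched_category M" using that by simp
    have "enriched_precomp (R D) M M (id_efunc M) = id_func (?F M)"
    proof (rule functor_eqI[OF is_functor_enriched_precomp[OF D M enriched_functor_id[OF M]]
          is_functor_id_func[OF category_enriched_functor_cat[OF D]]])
      fix G H t assume "G \<in> Ob (?F M)" "H \<in> Ob (?F M)"
        and "t \<in> Hom (?F M) G H"
      then have G: "enriched_functor M (R D) G" and H: "enriched_functor M (R D) H"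
        and t: "t \<in> enriched_trans M (R D) G H" by simp_all
      have "t \<in> extensional (EOb M)" using t unfolding enriched_trans_iff[OF G H] by (simp add: PiE_iff)
      then have "(\<lambda>X\<in>EOb M. t (eob (id_efunc M) X)) = t"
        by (intro extensionalityI[of _ "EOb M"]) simp_all
      then show "far (enriched_precomp (R D) M M (id_efunc M)) G H t = far (id_func (?F M)) G H t"
        by (simp add: G H t)
    qed (simp add: comp_efunc_id[OF M])
    then show ?thesis using M by (simp add: ob ar enriched_functor_id)
  qed
  show "far ?E M K (Cmp (opcat ECAT) M L K B A) =
      Cmp CAT (fob ?E M) (fob ?E L) (fob ?E K) (far ?E L K B) (far ?E M L A)"
    if M0: "M \<in> Ob (opcat ECAT)" and L0: "L \<in> Ob (opcat ECAT)" and K0: "K \<in> Ob (opcat ECAT)"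
      and B0: "B \<in> Hom (opcat ECAT) L K" and A0: "A \<in> Hom (opcat ECAT) M L" for M L K A B
  proof -
    have M: "enriched_category M" and L: "enriched_category L" and K: "enriched_category K"
      and A: "enriched_functor L M A" and B: "enriched_functor K L B"
      using M0 L0 K0 A0 B0 by simp_all
    let ?A = "enriched_precomp (R D) L M A" and ?B = "enriched_precomp (R D) K L B"
      and ?AB = "enriched_precomp (R D) K M (comp_efunc K A B)"
    note AB = enriched_functor_comp[OF K B A]
    note Bob = efunctor_ob[OF B]
    have "?AB =
      comp_func (?F M) ?B ?A"
    proof (rule functor_eqI[OF is_functor_enriched_precomp[OF D K AB]
          is_functor_comp_func[OF category_enriched_functor_cat[OF D] is_functor_enriched_precomp[OF D L A]
            is_functor_enriched_precomp[OF D K B]]])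
      fix G assume "G \<in> Ob (?F M)"
      then show "fob ?AB G =
          fob (comp_func (?F M) ?B ?A) G"
        by (simp add: enriched_functor_comp[OF L A] comp_efunc_assoc[OF B])
      fix H t assume "H \<in> Ob (?F M)" "t \<in> Hom (?F M) G H"
      with \<open>G \<in> Ob (?F M)\<close>
      show "far ?AB G H t =
          far (comp_func (?F M) ?B ?A) G H t"
        by (simp add: enriched_functor_comp[OF L A] enriched_trans_whisker[OF L A] Bob cong: restrict_cong)
    qed
    then show ?thesis using M L K A B AB by (simp add: ob ar)
  qed
qed (simp_all add: ECAT_into_def)

section \<open>Models and morphisms of theories\<close>

lemma Mod_simps [simp]:
  "Ob (Mod T) = {M. is_functor T SetC M \<and> preserves_finite_products T SetC M}"
  "Hom (Mod T) M N = nat_trans T SetC M N"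
  by (simp_all add: Mod_def)

lemma Mod_Idn: "Idn (Mod T) M = (\<lambda>A\<in>Ob T. Idn SetC (fob M A))"
  and Mod_Cmp: "Cmp (Mod T) M N P t s = (\<lambda>A\<in>Ob T. Cmp SetC (fob M A) (fob N A) (fob P A) (t A) (s A))"
  by (simp_all add: Mod_def)

lemma category_Mod: "category (Mod T)"
proof (rule categoryI)
  note [simp del] = SetC_simps
  note C = category_SetC
  have SetC_ob: "A \<in> Ob SetC" for A :: "'u set" by (simp add: SetC_simps)
  fix M N P Q s t u
  assume M0: "M \<in> Ob (Mod T)" and N0: "N \<in> Ob (Mod T)" and s0: "s \<in> Hom (Mod T) M N"
  have M: "is_functor T SetC M" and N: "is_functor T SetC N" and s: "s \<in> nat_trans T SetC M N"
    using M0 N0 s0 by simp_all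
  show "Cmp (Mod T) M M N s (Idn (Mod T) M) = s" "Cmp (Mod T) M N N (Idn (Mod T) N) s = s"
    by (rule extensionalityI[OF _ nat_transD(2)[OF s]];
        simp add: Mod_Idn Mod_Cmp cat_rules[OF C] SetC_ob nat_transD(1)[OF s])+
  assume P0: "P \<in> Ob (Mod T)" and t0: "t \<in> Hom (Mod T) N P"
  have P: "is_functor T SetC P" and t: "t \<in> nat_trans T SetC N P"
    using P0 t0 by simp_all
  show "Cmp (Mod T) M N P t s \<in> Hom (Mod T) M P"
    using nat_trans_comp[OF C M N P s t] by (simp add: Mod_Cmp)
  assume Q0: "Q \<in> Ob (Mod T)" and u0: "u \<in> Hom (Mod T) P Q"
  have Q: "is_functor T SetC Q" and u: "u \<in> nat_trans T SetC P Q"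
    using Q0 u0 by simp_all
  show "Cmp (Mod T) M P Q u (Cmp (Mod T) M N P t s) = Cmp (Mod T) M N Q (Cmp (Mod T) N P Q u t) s"
    unfolding Mod_Cmp by (rule restrict_ext)
      (simp add: cat_assoc[OF C] SetC_ob nat_transD(1)[OF s] nat_transD(1)[OF t] nat_transD(1)[OF u])
next
  fix M :: "('a, 'b, 'c set, 'c \<Rightarrow> 'c) func" assume "M \<in> Ob (Mod T)"
  then show "Idn (Mod T) M \<in> Hom (Mod T) M M"
    using nat_trans_id[OF category_SetC, of T M] by (simp add: Mod_Idn)
qed

lemma law_morphismD:
  assumes "law_morphism S T F"
  shows "is_functor S T F" "fob F (pw S n) = pw T n" "i < n \<Longrightarrow> far F (pw S n) (pw S 1) (pr S n i) = pr T n i"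
  using assms by (simp_all add: law_morphism_def)

text \<open>The definition of a morphism speaks only about the cones \<open>X^n\<close>; as every
  object of \<open>S\<close> is a power of the generator, these decide all finite products.\<close>

lemma law_morphism_preserves:
  assumes S: "lawvere_theory S" and T: "lawvere_theory T" and F: "law_morphism S T F"
  shows "preserves_finite_products S T F"
proof (rule law_preserves_finite_products[OF S lawvere_theoryD(1)[OF T] law_morphismD(1)[OF F]])
  fix n show "is_product T n (\<lambda>_. fob F (pw S 1)) (fob F (pw S n)) (\<lambda>i. far F (pw S n) (pw S 1) (pr S n i))"
    by (rule iffD2[OF is_product_cong lawvere_theoryD(5)[OF T, of n]]) (simp_all add: law_morphismD[OF F])
qed

lemma law_pr_hom: "lawvere_theory T \<Longrightarrow> i < n \<Longrightarrow> pr T n i \<in> Hom T (pw T n) (pw T 1)"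
  using lawvere_theoryD(5)[of T n] by (simp add: is_product_def)

lemma law_morphism_id: "lawvere_theory T \<Longrightarrow> law_morphism T T (id_func T)"
  by (simp add: law_morphism_def is_functor_id_func lawvere_theoryD(1,4) law_pr_hom)

lemma law_morphism_comp:
  assumes S: "lawvere_theory S" and F: "law_morphism S T F" and G: "law_morphism T U G"
  shows "law_morphism S U (comp_func S G F)"
  unfolding law_morphism_def
  using is_functor_comp_func[OF lawvere_theoryD(1)[OF S] law_morphismD(1)[OF F] law_morphismD(1)[OF G]]
  by (simp add: lawvere_theoryD(4)[OF S] law_pr_hom[OF S] law_morphismD(2,3)[OF F] law_morphismD(2,3)[OF G])

lemma Law_simps [simp]:
  "Ob Law = {T. lawvere_theory T}" "Hom Law S T = {F. law_morphism S T F}" "Idn Law = id_func"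
  "Cmp Law S T U G F = comp_func S G F"
  by (simp_all add: Law_def)

lemma category_Law: "category Law"
proof (rule categoryI)
  fix S T F assume S: "S \<in> Ob Law" and T: "T \<in> Ob Law" and F: "F \<in> Hom Law S T"
  have C: "category S" and F': "is_functor S T F"
    using S F by (auto dest: lawvere_theoryD(1) law_morphismD(1))
  show "Cmp Law S S T F (Idn Law S) = F" using comp_func_id[OF C F'] by simp
  show "Cmp Law S T T (Idn Law T) F = F"
    using T by simp
      (intro functor_eqI[OF is_functor_comp_func[OF C F' is_functor_id_func] F'],
        simp_all add: lawvere_theoryD(1) functor_ob[OF F'] functor_ar[OF F'])
next
  fix S T U V H G F
  assume S: "S \<in> Ob Law" "F \<in> Hom Law S T" "G \<in> Hom Law T U" "H \<in> Hom Law U V"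
  then show "Cmp Law S U V H (Cmp Law S T U G F) = Cmp Law S T V (Cmp Law T U V H G) F"
    by (simp add: comp_func_assoc[OF lawvere_theoryD(1) law_morphismD(1) law_morphismD(1) law_morphismD(1)])
qed (simp_all add: law_morphism_id law_morphism_comp)

lemma Mod_precomp_simps [simp]:
  "M \<in> Ob (Mod T) \<Longrightarrow> fob (Mod_precomp S T F) M = comp_func S M F"
  "M \<in> Ob (Mod T) \<Longrightarrow> N \<in> Ob (Mod T) \<Longrightarrow> t \<in> nat_trans T SetC M N \<Longrightarrow>
   far (Mod_precomp S T F) M N t = (\<lambda>A\<in>Ob S. t (fob F A))"
  by (simp_all add: Mod_precomp_def)

lemma nat_trans_whisker:
  assumes F: "is_functor C D F" and t: "t \<in> nat_trans D E G H"
  shows "(\<lambda>X\<in>Ob C. t (fob F X)) \<in> nat_trans C E (comp_func C G F) (comp_func C H F)"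
  by (rule nat_transI) (simp_all add: functor_ob[OF F] functor_ar[OF F] nat_transD[OF t])

text \<open>Restriction along \<open>F\<close> yields a model because \<open>F\<close> sends every
  product cone of \<open>S\<close>, of whatever objects, to a product cone of
  \<open>T\<close>.\<close>

lemma Mod_comp:
  assumes S: "lawvere_theory S" and T: "lawvere_theory T" and F: "law_morphism S T F" and M: "M \<in> Ob (Mod T)"
  shows "comp_func S M F \<in> Ob (Mod S)"
proof -
  note C = lawvere_theoryD(1)[OF S]
  have F': "is_functor S T F" and M': "is_functor T SetC M" "preserves_finite_products T SetC M"
    using F M by (simp_all add: law_morphismD)
  have "is_product SetC n (\<lambda>i. fob (comp_func S M F) (A i)) (fob (comp_func S M F) P)
      (\<lambda>i. far (comp_func S M F) P (A i) (p i))" if P: "is_product S n A P p" for n A P p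
  proof -
    have "is_product SetC n (\<lambda>i. fob M (fob F (A i))) (fob M (fob F P)) (\<lambda>i. far M (fob F P) (fob F (A i)) (far F P (A i) (p i)))"
      using law_morphism_preserves[OF S T F] M'(2) P unfolding preserves_finite_products_def by blast
    then show ?thesis
      by (rule iffD2[OF is_product_cong, rotated -1]) (use P in \<open>simp_all add: is_product_def\<close>)
  qed
  then show ?thesis
    by (simp add: is_functor_comp_func[OF C F' M'(1)] preserves_finite_products_def)
qed

lemma is_functor_Mod_precomp:
  assumes S: "lawvere_theory S" and T: "lawvere_theory T" and F: "law_morphism S T F"
  shows "is_functor (Mod T) (Mod S) (Mod_precomp S T F)"
proof (rule functorI)
  let ?F = "Mod_precomp S T F"
  note F' = law_morphismD(1)[OF F]
  note whisker = nat_trans_whisker[OF F']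
  show "fob ?F M \<in> Ob (Mod S)" if "M \<in> Ob (Mod T)" for M
    using Mod_comp[OF S T F that] that by (simp del: Mod_simps)
  show "far ?F M N t \<in> Hom (Mod S) (fob ?F M) (fob ?F N)"
    if "M \<in> Ob (Mod T)" "N \<in> Ob (Mod T)" "t \<in> Hom (Mod T) M N" for M N t
    using that by (simp add: whisker del: Mod_simps(1))
  show "far ?F M M (Idn (Mod T) M) = Idn (Mod S) (fob ?F M)"
    if "M \<in> Ob (Mod T)" for M
    using that cat_id[OF category_Mod that]
    by (simp del: Mod_simps(1)) (auto intro!: restrict_ext simp: Mod_Idn functor_ob[OF F'])
  show "far ?F M P (Cmp (Mod T) M N P t s) =
     Cmp (Mod S) (fob ?F M) (fob ?F N) (fob ?F P)
       (far ?F N P t) (far ?F M N s)"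
    if "M \<in> Ob (Mod T)" "N \<in> Ob (Mod T)" "P \<in> Ob (Mod T)" "t \<in> Hom (Mod T) N P" "s \<in> Hom (Mod T) M N" for M N P t s
    using that cat_comp[OF category_Mod that]
    by (simp del: Mod_simps(1)) (auto intro!: restrict_ext simp: Mod_Cmp functor_ob[OF F'])
qed (simp_all add: Mod_precomp_def)

lemma Mod_functor_simps [simp]:
  "lawvere_theory T \<Longrightarrow> fob Mod_functor T = Mod T"
  "lawvere_theory T \<Longrightarrow> lawvere_theory S \<Longrightarrow> law_morphism S T F \<Longrightarrow> far Mod_functor T S F = Mod_precomp S T F"
  by (simp_all add: Mod_functor_def)

lemma is_functor_Mod_functor: "is_functor (opcat Law) CAT Mod_functor"
proof (rule functorI)
  show "fob Mod_functor T \<in> Ob CAT" if "T \<in> Ob (opcat Law)" for T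
    using that by (simp add: category_Mod)
  show "far Mod_functor T S F \<in> Hom CAT (fob Mod_functor T) (fob Mod_functor S)"
    if "T \<in> Ob (opcat Law)" "S \<in> Ob (opcat Law)" "F \<in> Hom (opcat Law) T S" for T S F
    using that by (simp add: is_functor_Mod_precomp)
  show "far Mod_functor T T (Idn (opcat Law) T) = Idn CAT (fob Mod_functor T)" if "T \<in> Ob (opcat Law)" for T
  proof -
    have T: "lawvere_theory T" using that by simp
    note C = lawvere_theoryD(1)[OF T]
    have "Mod_precomp T T (id_func T) = id_func (Mod T)"
    proof (rule functor_eqI[OF is_functor_Mod_precomp[OF T T law_morphism_id[OF T]] is_functor_id_func[OF category_Mod]])
      fix M assume M: "M \<in> Ob (Mod T)"
      then show "fob (Mod_precomp T T (id_func T)) M = fob (id_func (Mod T)) M"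
        using comp_func_id[OF C, of SetC M] by (simp del: Mod_simps) simp
      fix N t assume N: "N \<in> Ob (Mod T)" and t: "t \<in> Hom (Mod T) M N"
      have "(\<lambda>A\<in>Ob T. t (fob (id_func T) A)) = t"
        using t by (intro extensionalityI[OF _ nat_transD(2)[of t T SetC M N]]) simp_all
      then show "far (Mod_precomp T T (id_func T)) M N t = far (id_func (Mod T)) M N t"
        using M N t by (simp del: Mod_simps(1))
    qed
    then show ?thesis using T by (simp add: law_morphism_id)
  qed
  show "far Mod_functor X Z (Cmp (opcat Law) X Y Z g f) =
      Cmp CAT (fob Mod_functor X) (fob Mod_functor Y) (fob Mod_functor Z) (far Mod_functor Y Z g) (far Mod_functor X Y f)"
    if X0: "X \<in> Ob (opcat Law)" and Y0: "Y \<in> Ob (opcat Law)" and Z0: "Z \<in> Ob (opcat Law)"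
      and g0: "g \<in> Hom (opcat Law) Y Z" and f0: "f \<in> Hom (opcat Law) X Y" for X Y Z f g
  proof -
    have X: "lawvere_theory X" and Y: "lawvere_theory Y" and Z: "lawvere_theory Z"
      and g: "law_morphism Z Y g" and f: "law_morphism Y X f"
      using X0 Y0 Z0 f0 g0 by simp_all
    note fg = law_morphism_comp[OF Z g f]
    note g' = law_morphismD(1)[OF g] and f' = law_morphismD(1)[OF f]
    have "Mod_precomp Z X (comp_func Z f g) = comp_func (Mod X) (Mod_precomp Z Y g) (Mod_precomp Y X f)"
    proof (rule functor_eqI[OF is_functor_Mod_precomp[OF Z X fg]
          is_functor_comp_func[OF category_Mod is_functor_Mod_precomp[OF Y X f] is_functor_Mod_precomp[OF Z Y g]]])
      fix M assume M: "M \<in> Ob (Mod X)"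
      then have M': "is_functor X SetC M" by simp
      note YM = Mod_comp[OF Y X f M]
      show "fob (Mod_precomp Z X (comp_func Z f g)) M =
          fob (comp_func (Mod X) (Mod_precomp Z Y g) (Mod_precomp Y X f)) M"
        using M YM comp_func_assoc[OF lawvere_theoryD(1)[OF Z] g' f' M'] by (simp del: Mod_simps)
      fix N t assume N: "N \<in> Ob (Mod X)" and t: "t \<in> Hom (Mod X) M N"
      note YN = Mod_comp[OF Y X f N]
      show "far (Mod_precomp Z X (comp_func Z f g)) M N t =
          far (comp_func (Mod X) (Mod_precomp Z Y g) (Mod_precomp Y X f)) M N t"
        using M N t YM YN nat_trans_whisker[OF f', of t SetC M N]
        by (simp del: Mod_simps(1)) (auto intro!: restrict_ext simp: functor_ob[OF g'])
    qed
    then show ?thesis using X Y Z g f fg by simp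
  qed
qed (simp_all add: Mod_functor_def)

section \<open>The comparison between models and enriched functors\<close>

lemma comp_func_law_powers [simp]: "comp_func (law_powers T) G F = comp_func T G F"
  by (simp add: comp_func_def)

lemma id_func_law_powers [simp]: "id_func (law_powers T) = id_func T"
  by (simp add: id_func_def)

text \<open>\<open>law_powers\<close> also has powers of the objects \<open>X^k\<close>, with tuples
  as projections; a morphism of theories respects these because it preserves all finite
  products.\<close>

lemma power_functor_law_morphism:
  assumes S: "lawvere_theory S" and T: "lawvere_theory T" and F: "law_morphism S T F"
  shows "power_functor (law_powers S) (law_powers T) F"
proof
  show "preserves_powers (law_powers S) (law_powers T) F"
    using law_morphism_preserves[OF S T F] finite_powers_law_powers[OF S]
    by (intro preserves_powersI) simp_all
qed (simp_all add: finite_powers_law_powers S T law_morphismD(1)[OF F])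

lemma power_functor_model:
  assumes T: "lawvere_theory T" and M: "M \<in> Ob (Mod T)"
  shows "power_functor (law_powers T) SetP M"
proof
  show "preserves_powers (law_powers T) SetP M"
    using M finite_powers_law_powers[OF T] by (intro preserves_powersI) simp_all
qed (use M in \<open>simp_all add: finite_powers_law_powers T finite_powers_SetP\<close>)

lemma R_Law_simps [simp]:
  "lawvere_theory T \<Longrightarrow> fob R_Law T = R (law_powers T)"
  "lawvere_theory S \<Longrightarrow> lawvere_theory T \<Longrightarrow> law_morphism S T F \<Longrightarrow>
   far R_Law S T F = R_func (law_powers S) (law_powers T) F"
  by (simp_all add: R_Law_def)

lemma is_functor_R_Law: "is_functor Law ECAT (R_Law :: (('o, 'a) law, _, _, _) func)"
proof (rule functorI)
  fix S T U :: "('o, 'a) law" and F G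
  assume S0: "S \<in> Ob Law"
  then have S: "lawvere_theory S" by simp
  show "fob R_Law S \<in> Ob ECAT"
    using S by (simp add: enriched_category_R finite_powers_law_powers)
  show "far R_Law S S (Idn Law S) = Idn ECAT (fob R_Law S)"
    using R_func_id_func[OF finite_powers_law_powers[OF S]] S by (simp add: law_morphism_id)
  assume T0: "T \<in> Ob Law"
  then have T: "lawvere_theory T" by simp
  assume F0: "F \<in> Hom Law S T"
  then have F: "law_morphism S T F" by simp
  show "far R_Law S T F \<in> Hom ECAT (fob R_Law S) (fob R_Law T)"
    using power_functor.enriched_functor_R_func[OF power_functor_law_morphism[OF S T F]] S T F by simp
  assume U0: "U \<in> Ob Law"
  then have U: "lawvere_theory U" by simp
  assume G0: "G \<in> Hom Law T U"
  then have G: "law_morphism T U G" by simp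
  note GF = law_morphism_comp[OF S F G]
  show "far R_Law S U (Cmp Law S T U G F) =
      Cmp ECAT (fob R_Law S) (fob R_Law T) (fob R_Law U) (far R_Law T U G) (far R_Law S T F)"
    using R_func_comp_func[of "law_powers S" "law_powers T" F "law_powers U" G]
    by (simp add: power_functor_law_morphism S T U F G GF)
qed (simp_all add: R_Law_def)

lemma is_functor_ECAT_R_S: "is_functor (opcat Law) CAT ECAT_R_S"
  unfolding ECAT_R_S_def S_ecat_def
  by (rule is_functor_comp_op_func[OF category_Law is_functor_R_Law is_functor_ECAT_into[OF finite_powers_SetP]])

lemma ECAT_R_S_simps:
  assumes T: "lawvere_theory T"
  shows "fob ECAT_R_S T = enriched_functor_cat (R (law_powers T)) (R SetP)"
    and "lawvere_theory S \<Longrightarrow> law_morphism S T F \<Longrightarrow> far ECAT_R_S T S F =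
      enriched_precomp (R SetP) (R (law_powers S)) (R (law_powers T)) (R_func (law_powers S) (law_powers T) F)"
proof -
  have R: "enriched_category (R (law_powers T))" if "lawvere_theory T" for T :: "('a, 'b) law"
    by (rule enriched_category_R[OF finite_powers_law_powers[OF that]])
  show "fob ECAT_R_S T = enriched_functor_cat (R (law_powers T)) (R SetP)"
    using T R by (simp add: ECAT_R_S_def ECAT_into_def op_func_def S_ecat_def)
  assume S: "lawvere_theory S" and F: "law_morphism S T F"
  show "far ECAT_R_S T S F =
      enriched_precomp (R SetP) (R (law_powers S)) (R (law_powers T)) (R_func (law_powers S) (law_powers T) F)"
    using T S F R power_functor.enriched_functor_R_func[OF power_functor_law_morphism[OF S T F]]
    by (simp add: ECAT_R_S_def ECAT_into_def op_func_def S_ecat_def)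
qed

definition Mod_to_enriched ::
  "('o, 'a) law \<Rightarrow> (('o, 'a, 'u::infinite set, 'u \<Rightarrow> 'u) func, 'o \<Rightarrow> 'u \<Rightarrow> 'u,
    ('o, 'a, 'u set, 'u \<Rightarrow> 'u) efunc, 'o \<Rightarrow> nat \<Rightarrow> nat \<Rightarrow> 'u \<Rightarrow> 'u) func" where
  "Mod_to_enriched T =
     \<lparr>fob = (\<lambda>M\<in>Ob (Mod T). R_func (law_powers T) SetP M),
      far = (\<lambda>M\<in>Ob (Mod T). \<lambda>N\<in>Ob (Mod T). \<lambda>t\<in>Hom (Mod T) M N.
        etrans (R (law_powers T)) SetP (R_func (law_powers T) SetP M) (R_func (law_powers T) SetP N) t)\<rparr>"

definition enriched_to_Mod ::
  "('o, 'a) law \<Rightarrow> (('o, 'a, 'u::infinite set, 'u \<Rightarrow> 'u) efunc, 'o \<Rightarrow> nat \<Rightarrow> nat \<Rightarrow> 'u \<Rightarrow> 'u,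
    ('o, 'a, 'u set, 'u \<Rightarrow> 'u) func, 'o \<Rightarrow> 'u \<Rightarrow> 'u) func" where
  "enriched_to_Mod T =
     (let E = enriched_functor_cat (R (law_powers T)) (R SetP) in
     \<lparr>fob = (\<lambda>G\<in>Ob E. underlying_func (law_powers T) G),
      far = (\<lambda>G\<in>Ob E. \<lambda>H\<in>Ob E. \<lambda>t\<in>Hom E G H. \<lambda>X\<in>Ob T. t X 1 0)\<rparr>)"

lemma Mod_to_enriched_simps [simp]:
  "M \<in> Ob (Mod T) \<Longrightarrow> fob (Mod_to_enriched T) M = R_func (law_powers T) SetP M"
  "M \<in> Ob (Mod T) \<Longrightarrow> N \<in> Ob (Mod T) \<Longrightarrow> t \<in> nat_trans T SetC M N \<Longrightarrow> far (Mod_to_enriched T) M N t =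
     etrans (R (law_powers T)) SetP (R_func (law_powers T) SetP M) (R_func (law_powers T) SetP N) t"
  by (simp_all add: Mod_to_enriched_def)

lemma enriched_to_Mod_simps [simp]:
  "enriched_functor (R (law_powers T)) (R SetP) G \<Longrightarrow> fob (enriched_to_Mod T) G = underlying_func (law_powers T) G"
  "enriched_functor (R (law_powers T)) (R SetP) G \<Longrightarrow> enriched_functor (R (law_powers T)) (R SetP) H \<Longrightarrow>
   t \<in> enriched_trans (R (law_powers T)) (R SetP) G H \<Longrightarrow> far (enriched_to_Mod T) G H t = (\<lambda>X\<in>Ob T. t X 1 0)"
  by (simp_all add: enriched_to_Mod_def)

lemma nat_trans_law_powers [simp]: "nat_trans (law_powers T) D F G = nat_trans T D F G"
  by (simp add: nat_trans_def)

lemma nat_trans_SetP [simp]: "nat_trans C SetP F G = nat_trans C SetC F G"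
  by (simp add: nat_trans_def)

text \<open>Identities and composites of enriched transformations are the extensions of those of
  unary components, and \<open>etrans\<close> has the given components at arity 1, so both functor
  laws reduce to pointwise composition in \<open>Mod T\<close>.\<close>

lemma is_functor_Mod_to_enriched:
  assumes T: "lawvere_theory T"
  shows "is_functor (Mod T) (enriched_functor_cat (R (law_powers T)) (R SetP)) (Mod_to_enriched T)"
    (is "is_functor _ ?E ?F")
proof (rule functorI)
  let ?C = "law_powers T"
  let ?R = "\<lambda>M. R_func ?C SetP M"
  note S = finite_powers_SetP
  note pf = power_functor_model[OF T]
  note R = power_functor.enriched_functor_R_func[OF pf]
  note R_ob = power_functor.R_func_simps(1)[OF pf, simplified law_powers_simps]
  have trans: "etrans (R ?C) SetP (?R M) (?R N) t \<in> enriched_trans (R ?C) (R SetP) (?R M) (?R N)"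
    if "M \<in> Ob (Mod T)" "N \<in> Ob (Mod T)" "t \<in> nat_trans T SetC M N" for M N t
    by (rule power_functor.etrans_R_func[OF pf pf]) (use that in simp_all)
  show "fob ?F M \<in> Ob ?E" if "M \<in> Ob (Mod T)" for M
    using R[OF that] that by (simp del: Mod_simps)
  show "far ?F M N t \<in> Hom ?E (fob ?F M) (fob ?F N)"
    if "M \<in> Ob (Mod T)" "N \<in> Ob (Mod T)" "t \<in> Hom (Mod T) M N" for M N t
    using that trans by (simp del: Mod_simps(1))
  show "far ?F M M (Idn (Mod T) M) = Idn ?E (fob ?F M)" if M: "M \<in> Ob (Mod T)" for M
  proof -
    have "far ?F M M (Idn (Mod T) M) = etrans (R ?C) SetP (?R M) (?R M) (Idn (Mod T) M)"
      using M cat_id[OF category_Mod M] by (simp del: Mod_simps(1))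
    also have "\<dots> = etrans (R ?C) SetP (?R M) (?R M) (\<lambda>X. Idn SetP (eob (?R M) X))"
      by (rule etrans_cong) (simp add: Mod_Idn R_ob[OF M])
    finally show ?thesis
      using M by (simp add: enriched_functor_cat_Idn[OF S R[OF M]] del: Mod_simps)
  qed
  show "far ?F M P (Cmp (Mod T) M N P u t) = Cmp ?E (fob ?F M) (fob ?F N) (fob ?F P) (far ?F N P u) (far ?F M N t)"
    if M: "M \<in> Ob (Mod T)" and N: "N \<in> Ob (Mod T)" and P: "P \<in> Ob (Mod T)"
      and u0: "u \<in> Hom (Mod T) N P" and t0: "t \<in> Hom (Mod T) M N" for M N P u t
  proof -
    have u: "u \<in> nat_trans T SetC N P" and t: "t \<in> nat_trans T SetC M N" using u0 t0 by simp_all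
    have ut: "Cmp (Mod T) M N P u t \<in> nat_trans T SetC M P"
      using cat_comp[OF category_Mod M N P u0 t0] by (simp del: Mod_simps(1))
    have 1: "etrans (R ?C) SetP (?R A) (?R B) s X 1 0 = s X"
      if "A \<in> Ob (Mod T)" "B \<in> Ob (Mod T)" "s \<in> nat_trans T SetC A B" "X \<in> Ob T" for A B s X
      using nat_transD(1)[OF that(3,4)] that
      by (intro etrans_1[OF S]) (simp_all add: R_ob del: Mod_simps)
    have "etrans (R ?C) SetP (?R M) (?R P) (Cmp (Mod T) M N P u t) =
       etrans (R ?C) SetP (?R M) (?R P) (\<lambda>X. Cmp SetP (eob (?R M) X) (eob (?R N) X) (eob (?R P) X)
        (etrans (R ?C) SetP (?R N) (?R P) u X 1 0) (etrans (R ?C) SetP (?R M) (?R N) t X 1 0))"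
      by (rule etrans_cong) (simp add: Mod_Cmp R_ob M N P u t 1 del: Mod_simps)
    then show ?thesis
      using M N P u t ut
      by (simp add: enriched_functor_cat_Cmp[OF S R[OF M] R[OF N] R[OF P] trans[OF M N t] trans[OF N P u]] del: Mod_simps)
  qed
qed (simp_all add: Mod_to_enriched_def)

text \<open>An enriched functor yields preservation of the powers chosen in
  \<open>law_powers\<close>. For the generator these are the cones belonging to the theory, and
  \<open>law_preserves_finite_products\<close> extends this to all finite products, as a model
  requires.\<close>

lemma is_functor_enriched_to_Mod:
  assumes T: "lawvere_theory T"
  shows "is_functor (enriched_functor_cat (R (law_powers T)) (R SetP)) (Mod T) (enriched_to_Mod T)"
    (is "is_functor ?E _ ?F")
proof (rule functorI)
  let ?U = "underlying_func (law_powers T)"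
  let ?C = "law_powers T"
  note S = finite_powers_SetP
  have loc: "R_enriched_functor ?C SetP G" if "enriched_functor (R ?C) (R SetP) G" for G
    by unfold_locales (simp_all add: that S finite_powers_law_powers T)
  have ob: "?U G \<in> Ob (Mod T)" if G: "enriched_functor (R ?C) (R SetP) G" for G
  proof -
    interpret R_enriched_functor ?C SetP G by (rule loc[OF G])
    have U: "is_functor T SetC (?U G)" using is_functor_underlying by simp
    have "preserves_finite_products T SetC (?U G)"
    proof (rule law_preserves_finite_products[OF T category_SetC U])
      fix n
      have Pwr: "Pwr ?C (pw T 1) n = pw T n" by (simp add: Pwr_law_powers T)
      \<comment> \<open>For the generator every block has width 1, and a tuple with one component is
        that component because \<open>pr T 1 0\<close> is an identity.\<close>
      have Prj: "Prj ?C (pw T 1) n i = pr T n i" if "i < n" for i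
      proof -
        have "tuple T 1 (\<lambda>_. pw T 1) (pw T 1) (pr T 1) (pw T n) (\<lambda>j. pr T n (i + j)) = pr T n i"
          by (rule tuple_eqI[OF lawvere_theoryD(1)[OF T] lawvere_theoryD(5)[OF T]])
            (simp_all add: lawvere_theoryD(1,4,6) T law_pr_hom that cat_id_left)
        then show ?thesis by (simp add: law_powers_def T)
      qed
      have "is_product SetC n (\<lambda>_. fob (?U G) (pw T 1)) (fob (?U G) (pw T n))
          (\<lambda>i. far (?U G) (pw T n) (pw T 1) (Prj ?C (pw T 1) n i))"
        using preserves_powersD[OF preserves_powers_underlying, of "pw T 1" n] lawvere_theoryD(4)[OF T]
        by (simp add: Pwr)
      then show "is_product SetC n (\<lambda>_. fob (?U G) (pw T 1)) (fob (?U G) (pw T n))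
          (\<lambda>i. far (?U G) (pw T n) (pw T 1) (pr T n i))"
        by (rule iffD2[OF is_product_cong, rotated -1]) (simp_all add: Prj)
    qed
    with U show ?thesis by simp
  qed
  show "fob ?F G \<in> Ob (Mod T)" if "G \<in> Ob ?E" for G
    using that ob by (simp del: Mod_simps)
  show "far ?F G H t \<in> Hom (Mod T) (fob ?F G) (fob ?F H)" if "G \<in> Ob ?E" "H \<in> Ob ?E" "t \<in> Hom ?E G H" for G H t
    using that R_enriched_functor.underlying_trans[OF loc, of G H t] by simp
  show "far ?F G G (Idn ?E G) = Idn (Mod T) (fob ?F G)" if "G \<in> Ob ?E" for G
    using that by (simp add: enriched_functor_cat_Idn_in[OF S] Mod_Idn enriched_functor_cat_Idn_1[OF S] cong: restrict_cong)
  show "far ?F F H (Cmp ?E F G H u t) = Cmp (Mod T) (fob ?F F) (fob ?F G) (fob ?F H) (far ?F G H u) (far ?F F G t)"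
    if "F \<in> Ob ?E" "G \<in> Ob ?E" "H \<in> Ob ?E" "u \<in> Hom ?E G H" "t \<in> Hom ?E F G" for F G H u t
    using that by (simp add: enriched_functor_cat_Cmp_in[OF S] Mod_Cmp enriched_functor_cat_Cmp_1[OF S] cong: restrict_cong)
qed (simp_all add: enriched_to_Mod_def)

text \<open>The two functors are strict inverses: on objects by \<open>underlying_R_func\<close> and
  \<open>R_func_underlying\<close>, on arrows because extending unary components and reading them
  off undo each other.\<close>

lemma equivalence_Mod_to_enriched:
  fixes T :: "('o, 'a) law"
  assumes T: "lawvere_theory T"
  shows "equivalence_functor (Mod T) (enriched_functor_cat (R (law_powers T)) (R (SetP :: ('u::infinite set, 'u \<Rightarrow> 'u) pcat)))
    (Mod_to_enriched T)" (is "equivalence_functor _ ?E _")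
proof (rule equivalence_functorI[OF category_Mod category_enriched_functor_cat[OF finite_powers_SetP]
      is_functor_Mod_to_enriched[OF T] is_functor_enriched_to_Mod[OF T]])
  let ?C = "law_powers T"
  let ?M = "Mod T :: (('o, 'a, 'u set, 'u \<Rightarrow> 'u) func, _) cat"
  note S = finite_powers_SetP
  note C = finite_powers_law_powers[OF T]
  note MF = is_functor_Mod_to_enriched[OF T] and FM = is_functor_enriched_to_Mod[OF T]
  note pf = power_functor_model[OF T]
  note R_ob = power_functor.R_func_simps(1)[OF pf, simplified law_powers_simps]
  show "comp_func ?M (enriched_to_Mod T) (Mod_to_enriched T) = id_func ?M"
  proof (rule functor_eqI[OF is_functor_comp_func[OF category_Mod MF FM] is_functor_id_func[OF category_Mod]])
    fix M assume M: "M \<in> Ob ?M"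
    note RM = power_functor.enriched_functor_R_func[OF pf[OF M]]
    show "fob (comp_func ?M (enriched_to_Mod T) (Mod_to_enriched T)) M = fob (id_func ?M) M"
      using M RM power_functor.underlying_R_func[OF pf[OF M]] by (simp del: Mod_simps)
    fix N t assume N: "N \<in> Ob ?M" and t0: "t \<in> Hom ?M M N"
    then have t: "t \<in> nat_trans T SetC M N" by simp
    note RN = power_functor.enriched_functor_R_func[OF pf[OF N]]
    let ?t = "etrans (R ?C) SetP (R_func ?C SetP M) (R_func ?C SetP N) t"
    have "?t \<in> enriched_trans (R ?C) (R SetP) (R_func ?C SetP M) (R_func ?C SetP N)"
      by (rule power_functor.etrans_R_func[OF pf[OF M] pf[OF N]]) (use t in simp)
    moreover have "?t X 1 0 = t X" if X: "X \<in> Ob T" for X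
      using nat_transD(1)[OF t X] X
      by (intro etrans_1[OF S]) (simp_all add: R_ob M N del: Mod_simps)
    then have "(\<lambda>X\<in>Ob T. ?t X 1 0) = t"
      by (intro extensionalityI[OF _ nat_transD(2)[OF t]]) simp_all
    ultimately show "far (comp_func ?M (enriched_to_Mod T) (Mod_to_enriched T)) M N t = far (id_func ?M) M N t"
      using M N t RM RN by (simp del: Mod_simps(1))
  qed
  show "comp_func ?E (Mod_to_enriched T) (enriched_to_Mod T) = id_func ?E"
  proof (rule functor_eqI[OF is_functor_comp_func[OF category_enriched_functor_cat[OF S] FM MF]
        is_functor_id_func[OF category_enriched_functor_cat[OF S]]])
    fix G assume G0: "G \<in> Ob ?E"
    then have G: "enriched_functor (R ?C) (R SetP) G" by simp
    interpret G: R_enriched_functor ?C SetP G by unfold_locales (simp_all add: C S G)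
    have UG: "underlying_func ?C G \<in> Ob ?M" using functor_ob[OF FM G0] G by (simp del: Mod_simps)
    show "fob (comp_func ?E (Mod_to_enriched T) (enriched_to_Mod T)) G = fob (id_func ?E) G"
      using G UG G.R_func_underlying by (simp del: Mod_simps)
    fix H t assume H0: "H \<in> Ob ?E" and t0: "t \<in> Hom ?E G H"
    then have H: "enriched_functor (R ?C) (R SetP) H" and t: "t \<in> enriched_trans (R ?C) (R SetP) G H" by simp_all
    interpret H: R_enriched_functor ?C SetP H by unfold_locales (simp_all add: C S H)
    have UH: "underlying_func ?C H \<in> Ob ?M" using functor_ob[OF FM H0] H by (simp del: Mod_simps)
    have Ut: "(\<lambda>X\<in>Ob T. t X 1 0) \<in> nat_trans T SetC (underlying_func ?C G) (underlying_func ?C H)"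
      using G.underlying_trans[OF H t] by simp
    have "etrans (R ?C) SetP G H (\<lambda>X\<in>Ob T. t X 1 0) = etrans (R ?C) SetP G H (\<lambda>X. t X 1 0)"
      by (rule etrans_cong) simp
    also have "\<dots> = t" by (rule etrans_eta[OF S G H t])
    finally show "far (comp_func ?E (Mod_to_enriched T) (enriched_to_Mod T)) G H t = far (id_func ?E) G H t"
      using G H t UG UH Ut by (simp add: G.R_func_underlying H.R_func_underlying del: Mod_simps)
  qed
qed

text \<open>On objects this is the strict functoriality \<open>R_func_comp_func\<close> applied to a
  morphism of theories followed by a model. On arrows both sides are extensions of the same
  whiskered family.\<close>

lemma Mod_to_enriched_natural:
  fixes S T :: "('o, 'a) law"
  assumes S: "lawvere_theory S" and T: "lawvere_theory T" and F: "law_morphism S T F"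
  shows "comp_func (Mod T) (enriched_precomp (R (SetP :: ('u::infinite set, 'u \<Rightarrow> 'u) pcat)) (R (law_powers S)) (R (law_powers T))
      (R_func (law_powers S) (law_powers T) F)) (Mod_to_enriched T) =
    comp_func (Mod T) (Mod_to_enriched S) (Mod_precomp S T F)"
proof (rule functor_eqI)
  let ?S = "law_powers S" and ?T = "law_powers T"
  let ?RF = "R_func ?S ?T F" and ?Set = "SetP :: ('u set, 'u \<Rightarrow> 'u) pcat"
  let ?RT = "R_func ?T ?Set" and ?RS = "R_func ?S ?Set"
  let ?K = "enriched_precomp (R ?Set) (R ?S) (R ?T) ?RF"
  note C = finite_powers_law_powers[OF S]
  note pF = power_functor_law_morphism[OF S T F]
  note F' = law_morphismD(1)[OF F]
  show "is_functor (Mod T) (enriched_functor_cat (R ?S) (R SetP))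
     (comp_func (Mod T) ?K (Mod_to_enriched T))"
    by (rule is_functor_comp_func[OF category_Mod is_functor_Mod_to_enriched[OF T]
          is_functor_enriched_precomp[OF finite_powers_SetP enriched_category_R[OF C]
            power_functor.enriched_functor_R_func[OF pF]]])
  show "is_functor (Mod T) (enriched_functor_cat (R ?S) (R SetP)) (comp_func (Mod T) (Mod_to_enriched S) (Mod_precomp S T F))"
    by (rule is_functor_comp_func[OF category_Mod is_functor_Mod_precomp[OF S T F] is_functor_Mod_to_enriched[OF S]])
  have R: "comp_efunc (R ?S) (?RT M) ?RF = ?RS (comp_func S M F)"
    if "M \<in> Ob (Mod T)" for M :: "('o, 'a, 'u set, 'u \<Rightarrow> 'u) func"
    using R_func_comp_func[OF pF power_functor_model[OF T that]] power_functor_model[OF S Mod_comp[OF S T F that]]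
    by simp
  have RM: "enriched_functor (R ?T) (R SetP) (?RT M)" if "M \<in> Ob (Mod T)" for M :: "('o, 'a, 'u set, 'u \<Rightarrow> 'u) func"
    by (rule power_functor.enriched_functor_R_func[OF power_functor_model[OF T that]])
  fix M :: "('o, 'a, 'u set, 'u \<Rightarrow> 'u) func" assume M: "M \<in> Ob (Mod T)"
  show "fob (comp_func (Mod T) ?K (Mod_to_enriched T)) M =
    fob (comp_func (Mod T) (Mod_to_enriched S) (Mod_precomp S T F)) M"
    using M RM[OF M] Mod_comp[OF S T F M] R[OF M] by (simp del: Mod_simps)
  fix N t assume N: "N \<in> Ob (Mod T)" and "t \<in> Hom (Mod T) M N"
  then have t: "t \<in> nat_trans T SetC M N" by simp
  have tr: "etrans (R ?T) SetP (?RT M) (?RT N) t \<in>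
      enriched_trans (R ?T) (R SetP) (?RT M) (?RT N)"
    by (rule power_functor.etrans_R_func[OF power_functor_model[OF T M] power_functor_model[OF T N]]) (use t in simp)
  have Ft: "(\<lambda>A\<in>Ob S. t (fob F A)) \<in> nat_trans S SetC (comp_func S M F) (comp_func S N F)"
    by (rule nat_trans_whisker[OF F' t])
  have ob: "eob ?RF X = fob F X" if "X \<in> Ob S" for X
    using power_functor.R_func_simps(1)[OF pF, of X] that by simp
  have obT: "eob (?RT L) X = fob L X" if "L \<in> Ob (Mod T)" "X \<in> Ob T" for L :: "('o, 'a, 'u set, 'u \<Rightarrow> 'u) func" and X
    using power_functor.R_func_simps(1)[OF power_functor_model[OF T that(1)], of X] that by simp
  have obS: "eob (?RS (comp_func S L F)) X = fob L (fob F X)" if "L \<in> Ob (Mod T)" "X \<in> Ob S" for L :: "('o, 'a, 'u set, 'u \<Rightarrow> 'u) func" and X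
    using power_functor.R_func_simps(1)[OF power_functor_model[OF S Mod_comp[OF S T F that(1)]], of X] that by simp
  \<comment> \<open>The extension \<open>etrans\<close> at an object depends only on the component
    and the two values there, so it commutes with restriction along \<open>F\<close>.\<close>
  have "(\<lambda>X\<in>Ob S. etrans (R ?T) SetP (?RT M) (?RT N) t (eob ?RF X)) =
      etrans (R ?S) SetP (?RS (comp_func S M F)) (?RS (comp_func S N F)) (\<lambda>A\<in>Ob S. t (fob F A))"
    unfolding etrans_def[of "R ?S"] R_simps law_powers_simps
    by (rule restrict_ext) (simp add: etrans_def ob obT obS M N functor_ob[OF F'] del: Mod_simps cong: restrict_cong)
  then show "far (comp_func (Mod T) ?K (Mod_to_enriched T)) M N t =
    far (comp_func (Mod T) (Mod_to_enriched S) (Mod_precomp S T F)) M N t"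
    using M N t RM[OF M] RM[OF N] tr Ft Mod_comp[OF S T F M] Mod_comp[OF S T F N] by (simp del: Mod_simps(1))
qed

theorem proposition4p4:
  shows "is_functor Law ECAT (R_Law :: (('o, 'a) law, _, _, _) func) \<and>
         is_functor (opcat Law) CAT
           (Mod_functor :: (('o, 'a) law, _, (('o, 'a, 'u::infinite set, 'u \<Rightarrow> 'u) func, _) cat, _) func) \<and>
         is_functor (opcat Law) CAT
           (ECAT_R_S :: (('o, 'a) law, _, (('o, 'a, 'u set, 'u \<Rightarrow> 'u) efunc, _) cat, _) func) \<and>
         pseudonaturally_equivalent (opcat Law)
           (Mod_functor :: (('o, 'a) law, _, (('o, 'a, 'u set, 'u \<Rightarrow> 'u) func, _) cat, _) func)
           (ECAT_R_S :: (('o, 'a) law, _, (('o, 'a, 'u set, 'u \<Rightarrow> 'u) efunc, _) cat, _) func)"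
proof (intro conjI)
  let ?M = "Mod_functor :: (('o, 'a) law, _, (('o, 'a, 'u set, 'u \<Rightarrow> 'u) func, _) cat, _) func"
  let ?E = "ECAT_R_S :: (('o, 'a) law, _, (('o, 'a, 'u set, 'u \<Rightarrow> 'u) efunc, _) cat, _) func"
  show "is_functor Law ECAT (R_Law :: (('o, 'a) law, _, _, _) func)" by (rule is_functor_R_Law)
  show "is_functor (opcat Law) CAT ?M" by (rule is_functor_Mod_functor)
  show "is_functor (opcat Law) CAT ?E" by (rule is_functor_ECAT_R_S)
  have "pseudonatural_trans (opcat Law) ?M ?E Mod_to_enriched
     (\<lambda>X Y f. \<lambda>M\<in>Ob (fob ?M X). Idn (fob ?E Y) (fob (Mod_to_enriched Y) (fob (far ?M X Y f) M)))"
  proof (rule strictly_natural_imp_pseudonatural[OF is_functor_Mod_functor is_functor_ECAT_R_S])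
    show "Idn (opcat Law) T \<in> Hom (opcat Law) T T" if "T \<in> Ob (opcat Law)" for T :: "('o, 'a) law"
      using that by (simp add: law_morphism_id)
    show "is_functor (fob ?M T) (fob ?E T) (Mod_to_enriched T)" if "T \<in> Ob (opcat Law)" for T
      using that by (simp add: is_functor_Mod_to_enriched ECAT_R_S_simps)
    show "comp_func (fob ?M T) (far ?E T S F) (Mod_to_enriched T) = comp_func (fob ?M T) (Mod_to_enriched S) (far ?M T S F)"
      if "T \<in> Ob (opcat Law)" "S \<in> Ob (opcat Law)" "F \<in> Hom (opcat Law) T S" for T S F
      using that by (simp add: ECAT_R_S_simps Mod_to_enriched_natural)
  qed
  moreover have "equivalence_functor (fob ?M T) (fob ?E T) (Mod_to_enriched T)" if "T \<in> Ob (opcat Law)" for T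
    using that by (simp add: equivalence_Mod_to_enriched ECAT_R_S_simps)
  ultimately show "pseudonaturally_equivalent (opcat Law) ?M ?E"
    unfolding pseudonaturally_equivalent_def by blast
qed

end
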